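(* Let $\star\in\{\mathrm{inj},\le\}$. For any small category $\mathscr{D}$, the topological space $B(\Lambda_\star\mathscr{D})$ is homotopy equivalent to the topological space $B(\mathscr{D})$. This homotopy equivalence is induced by the functor $i\colon\mathscr{D}\to\Lambda_\star\mathscr{D}$ assigning to $Y\in\mathscr{D}$ the object $([0],Y)$ of length $0$. Its homotopy inverse is induced by the functor $\Lambda_\star\mathscr{D}\to\mathscr{D}$ assigning to $([n],\underline{Y})$ its $0$-th component $\bar Y_0$.
   Context: $B\mathscr{C}=|N\mathscr{C}|$ is the classifying space (geometric realization of the nerve) of a small category. For $n\ge0$, an object $\underline{Y}$ of $\Lambda_n\mathscr{D}$ is a zig-zag in $\mathscr{D}$ $$\bar Y_0\to Y_1\leftarrow\bar Y_1\to Y_2\leftarrow\bar Y_2\to\dots\to Y_n\leftarrow\bar Y_n,$$ and a morphism $\underline{Y}\to\underline{Z}$ is a family of maps $Y_i\to Z_i$, $\bar Y_i\to\bar Z_i$ making all squares commute; in particular $\Lambda_0\mathscr{D}=\mathscr{D}$. $\Delta_{\mathrm{inj}}$ is the category with objects $[0],[1],[2],\dots$ and morphisms $[m]\to[n]$ the strictly order-preserving maps $\{0<\dots<m\}\to\{0<\dots<n\}$. $\Delta_{\le}$ has the same objects, a single morphism $[m]\to[n]$ if $m\le n$, interpreted as the map $\phi(i)=n-m+i$, and no morphism otherwise. A morphism $\phi\colon[m]\to[n]$ of either category induces a functor $\Lambda(\phi)\colon\Lambda_m\mathscr{D}\to\Lambda_n\mathscr{D}$: the zig-zag $\Lambda(\phi)(\underline{Y})$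 has $\bar Y_i$ as its $\phi(i)$-th barred entry; it is padded by identity zig-zags $\bar Y_0\xrightarrow{\mathrm{id}}\bar Y_0\xleftarrow{\mathrm{id}}\bar Y_0$ up to position $\phi(0)$; between positions $\phi(i-1)$ and $\phi(i)$ it consists of identity zig-zags on $\bar Y_{i-1}$ followed by one final step $\bar Y_{i-1}\to Y_i\leftarrow\bar Y_i$; after position $\phi(m)$ it is padded by identity zig-zags on $\bar Y_m$. $\Lambda_\star\mathscr{D}$ is the (cofibred) Grothendieck construction of $[n]\mapsto\Lambda_n\mathscr{D}$ on $\Delta_\star$: objects are pairs $([n],\underline{Y})$ with $\underline{Y}\in\Lambda_n\mathscr{D}$, and a morphism $([m],\underline{Y})\to([n],\underline{Z})$ is a pair of a morphism $\phi\colon[m]\to[n]$ in $\Delta_\star$ and a morphism $\Lambda(\phi)(\underline{Y})\to\underline{Z}$ in $\Lambda_n\mathscr{D}$. *)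

theory Defs
  imports "HOL-Analysis.Analysis" "HOL-Homology.Simplices"
begin

section \<open>Small categories and functors\<close>

text \<open>A small category has a set of objects and a set of arrows. \<open>Comp C g f\<close> is the composite
  \<open>g\<close> after \<open>f\<close>; the operations are unconstrained outside their domains.\<close>

record ('o, 'm) cat =
  Obj :: "'o set"
  Arr :: "'m set"
  Dom :: "'m \<Rightarrow> 'o"
  Cod :: "'m \<Rightarrow> 'o"
  Ide :: "'o \<Rightarrow> 'm"
  Comp :: "'m \<Rightarrow> 'm \<Rightarrow> 'm"

locale category =
  fixes C :: "('o, 'm) cat"
  assumes Dom_Obj: "f \<in> Arr C \<Longrightarrow> Dom C f \<in> Obj C"
    and Cod_Obj: "f \<in> Arr C \<Longrightarrow> Cod C f \<in> Obj C"
    and Ide_Arr: "X \<in> Obj C \<Longrightarrow> Ide C X \<in> Arr C"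
    and Dom_Ide: "X \<in> Obj C \<Longrightarrow> Dom C (Ide C X) = X"
    and Cod_Ide: "X \<in> Obj C \<Longrightarrow> Cod C (Ide C X) = X"
    and Comp_Arr: "\<lbrakk>g \<in> Arr C; f \<in> Arr C; Dom C g = Cod C f\<rbrakk> \<Longrightarrow> Comp C g f \<in> Arr C"
    and Dom_Comp: "\<lbrakk>g \<in> Arr C; f \<in> Arr C; Dom C g = Cod C f\<rbrakk> \<Longrightarrow> Dom C (Comp C g f) = Dom C f"
    and Cod_Comp: "\<lbrakk>g \<in> Arr C; f \<in> Arr C; Dom C g = Cod C f\<rbrakk> \<Longrightarrow> Cod C (Comp C g f) = Cod C g"
    and Comp_Ide: "f \<in> Arr C \<Longrightarrow> Comp C f (Ide C (Dom C f)) = f"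
    and Ide_Comp: "f \<in> Arr C \<Longrightarrow> Comp C (Ide C (Cod C f)) f = f"
    and Comp_assoc: "\<lbrakk>h \<in> Arr C; g \<in> Arr C; f \<in> Arr C; Dom C h = Cod C g; Dom C g = Cod C f\<rbrakk>
      \<Longrightarrow> Comp C (Comp C h g) f = Comp C h (Comp C g f)"

record ('o, 'm, 'p, 'q) ftor =
  obj_map :: "'o \<Rightarrow> 'p"
  arr_map :: "'m \<Rightarrow> 'q"

text \<open>Both components are extensional, so that functors with the same values are equal.\<close>

definition is_functor :: "('o, 'm) cat \<Rightarrow> ('p, 'q) cat \<Rightarrow> ('o, 'm, 'p, 'q) ftor \<Rightarrow> bool" where
  "is_functor C D F \<longleftrightarrow>
     obj_map F \<in> Obj C \<rightarrow>\<^sub>E Obj D \<and> arr_map F \<in> Arr C \<rightarrow>\<^sub>E Arr D \<and>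
     (\<forall>f\<in>Arr C. Dom D (arr_map F f) = obj_map F (Dom C f)) \<and>
     (\<forall>f\<in>Arr C. Cod D (arr_map F f) = obj_map F (Cod C f)) \<and>
     (\<forall>X\<in>Obj C. arr_map F (Ide C X) = Ide D (obj_map F X)) \<and>
     (\<forall>g\<in>Arr C. \<forall>f\<in>Arr C. Dom C g = Cod C f \<longrightarrow>
        arr_map F (Comp C g f) = Comp D (arr_map F g) (arr_map F f))"

text \<open>The composite \<open>G\<close> after \<open>F\<close> of functors, where \<open>F\<close> has domain \<open>C\<close>.\<close>

definition fcomp :: "('o, 'm) cat \<Rightarrow> ('p, 'q, 'r, 's) ftor \<Rightarrow> ('o, 'm, 'p, 'q) ftor
    \<Rightarrow> ('o, 'm, 'r, 's) ftor" where
  "fcomp C G F = \<lparr>obj_map = compose (Obj C) (obj_map G) (obj_map F),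
                  arr_map = compose (Arr C) (arr_map G) (arr_map F)\<rparr>"

definition fident :: "('o, 'm) cat \<Rightarrow> ('o, 'm, 'o, 'm) ftor" where
  "fident C = \<lparr>obj_map = (\<lambda>X\<in>Obj C. X), arr_map = (\<lambda>f\<in>Arr C. f)\<rparr>"


section \<open>Categories of finite ordinals\<close>

text \<open>A map \<open>[m] \<rightarrow> [n]\<close> is a triple \<open>(m, \<phi>, n)\<close> with \<open>\<phi>\<close> extensional on \<open>{0, \<dots>, m}\<close>.\<close>

type_synonym ord_map = "nat \<times> (nat \<Rightarrow> nat) \<times> nat"

definition Delta :: "(nat, ord_map) cat" where
  "Delta = \<lparr>Obj = UNIV,
     Arr = {(m, \<phi>, n). \<phi> \<in> {..m} \<rightarrow>\<^sub>E {..n} \<and> mono_on {..m} \<phi>},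
     Dom = (\<lambda>(m, \<phi>, n). m),
     Cod = (\<lambda>(m, \<phi>, n). n),
     Ide = (\<lambda>n. (n, (\<lambda>i\<in>{..n}. i), n)),
     Comp = (\<lambda>(n', \<psi>, p) (m, \<phi>, n). (m, compose {..m} \<psi> \<phi>, p))\<rparr>"

definition Delta_inj :: "(nat, ord_map) cat" where
  "Delta_inj = Delta\<lparr>Arr := {(m, \<phi>, n). \<phi> \<in> {..m} \<rightarrow>\<^sub>E {..n} \<and> strict_mono_on {..m} \<phi>}\<rparr>"

definition Delta_le :: "(nat, ord_map) cat" where
  "Delta_le = Delta\<lparr>Arr := {(m, (\<lambda>i\<in>{..m}. n - m + i), n) | m n. m \<le> n}\<rparr>"

text \<open>The ordinal \<open>[n]\<close> as a category; the arrow \<open>i \<rightarrow> j\<close> is the pair \<open>(i, j)\<close>.\<close>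

definition ordinal :: "nat \<Rightarrow> (nat, nat \<times> nat) cat" where
  "ordinal n = \<lparr>Obj = {..n}, Arr = {(i, j). i \<le> j \<and> j \<le> n}, Dom = fst, Cod = snd,
     Ide = (\<lambda>i. (i, i)), Comp = (\<lambda>(j, k) (i, j'). (i, k))\<rparr>"

definition ordinal_functor :: "ord_map \<Rightarrow> (nat, nat \<times> nat, nat, nat \<times> nat) ftor" where
  "ordinal_functor = (\<lambda>(m, \<theta>, n). \<lparr>obj_map = (\<lambda>i\<in>Obj (ordinal m). \<theta> i),
     arr_map = (\<lambda>(i, j)\<in>Arr (ordinal m). (\<theta> i, \<theta> j))\<rparr>)"


section \<open>Simplicial sets and geometric realization\<close>

text \<open>A simplicial set \<open>X\<close>; an arrow \<open>(m, \<theta>, n)\<close> of \<open>\<Delta>\<close> acts as a map \<open>X\<^sub>n \<rightarrow> X\<^sub>m\<close>.\<close>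

record 's sset =
  simplices :: "nat \<Rightarrow> 's set"
  action :: "ord_map \<Rightarrow> 's \<Rightarrow> 's"

locale simplicial_set =
  fixes X :: "'s sset"
  assumes action_closed:
      "\<lbrakk>\<theta> \<in> Arr Delta; s \<in> simplices X (Cod Delta \<theta>)\<rbrakk> \<Longrightarrow> action X \<theta> s \<in> simplices X (Dom Delta \<theta>)"
    and action_Ide: "s \<in> simplices X n \<Longrightarrow> action X (Ide Delta n) s = s"
    and action_Comp:
      "\<lbrakk>\<eta> \<in> Arr Delta; \<theta> \<in> Arr Delta; Dom Delta \<eta> = Cod Delta \<theta>; s \<in> simplices X (Cod Delta \<eta>)\<rbrakk>
       \<Longrightarrow> action X (Comp Delta \<eta> \<theta>) s = action X \<theta> (action X \<eta> s)"

text \<open>The affine map \<open>\<Delta>\<^sup>m \<rightarrow> \<Delta>\<^sup>n\<close> of standard simplices sending the vertex \<open>i\<close> to \<open>\<theta> i\<close>.\<close>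

definition simplex_push :: "ord_map \<Rightarrow> (nat \<Rightarrow> real) \<Rightarrow> nat \<Rightarrow> real" where
  "simplex_push = (\<lambda>(m, \<theta>, n) t j. \<Sum>i\<in>{i. i \<le> m \<and> \<theta> i = j}. t i)"

text \<open>The disjoint union of the spaces \<open>X\<^sub>n \<times> \<Delta>\<^sup>n\<close> with \<open>X\<^sub>n\<close> discrete.\<close>

definition presentation :: "'s sset \<Rightarrow> (nat \<times> 's \<times> (nat \<Rightarrow> real)) topology" where
  "presentation X = sum_topology
     (\<lambda>n. prod_topology (discrete_topology (simplices X n))
            (subtopology (powertop_real UNIV) (standard_simplex n))) UNIV"

definition gluing ::
    "'s sset \<Rightarrow> ((nat \<times> 's \<times> (nat \<Rightarrow> real)) \<times> (nat \<times> 's \<times> (nat \<Rightarrow> real))) set" where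
  "gluing X = {((m, action X (m, \<theta>, n) s, t), (n, s, simplex_push (m, \<theta>, n) t)) | m \<theta> n s t.
     (m, \<theta>, n) \<in> Arr Delta \<and> s \<in> simplices X n \<and> t \<in> standard_simplex m}"

definition gluing_equiv ::
    "'s sset \<Rightarrow> ((nat \<times> 's \<times> (nat \<Rightarrow> real)) \<times> (nat \<times> 's \<times> (nat \<Rightarrow> real))) set" where
  "gluing_equiv X = Restr ((gluing X \<union> (gluing X)\<inverse>)\<^sup>*) (topspace (presentation X))"

definition quotient_topology :: "'a topology \<Rightarrow> ('a \<times> 'a) set \<Rightarrow> 'a set topology" where
  "quotient_topology T R = topology (\<lambda>U. U \<subseteq> topspace T // R \<and>
     openin T {x \<in> topspace T. R `` {x} \<in> U})"

definition realization :: "'s sset \<Rightarrow> (nat \<times> 's \<times> (nat \<Rightarrow> real)) set topology" where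
  "realization X = quotient_topology (presentation X) (gluing_equiv X)"

text \<open>The map of realizations \<open>[n, s, t] \<mapsto> [n, f\<^sub>n s, t]\<close> induced by a simplicial map
  \<open>f\<close> with codomain \<open>Y\<close>; the image of a class lies in a single class of the codomain.\<close>

definition realization_map :: "'s sset \<Rightarrow> (nat \<Rightarrow> 'r \<Rightarrow> 's) \<Rightarrow> (nat \<times> 'r \<times> (nat \<Rightarrow> real)) set
    \<Rightarrow> (nat \<times> 's \<times> (nat \<Rightarrow> real)) set" where
  "realization_map Y f c = gluing_equiv Y `` ((\<lambda>(n, s, t). (n, f n s, t)) ` c)"


section \<open>Nerve and classifying space\<close>

type_synonym ('o, 'm) nerve_simplex = "(nat, nat \<times> nat, 'o, 'm) ftor"

definition nerve :: "('o, 'm) cat \<Rightarrow> ('o, 'm) nerve_simplex sset" where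
  "nerve C = \<lparr>simplices = (\<lambda>n. {\<sigma>. is_functor (ordinal n) C \<sigma>}),
     action = (\<lambda>\<theta> \<sigma>. fcomp (ordinal (Dom Delta \<theta>)) \<sigma> (ordinal_functor \<theta>))\<rparr>"

definition nerve_map :: "('o, 'm, 'p, 'q) ftor \<Rightarrow> nat \<Rightarrow> ('o, 'm) nerve_simplex
    \<Rightarrow> ('p, 'q) nerve_simplex" where
  "nerve_map F n \<sigma> = fcomp (ordinal n) F \<sigma>"

definition classifying_space ::
    "('o, 'm) cat \<Rightarrow> (nat \<times> ('o, 'm) nerve_simplex \<times> (nat \<Rightarrow> real)) set topology" where
  "classifying_space C = realization (nerve C)"

text \<open>The map induced on classifying spaces by a functor \<open>F\<close> with codomain \<open>D\<close>.\<close>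

definition classifying_map :: "('p, 'q) cat \<Rightarrow> ('o, 'm, 'p, 'q) ftor
    \<Rightarrow> (nat \<times> ('o, 'm) nerve_simplex \<times> (nat \<Rightarrow> real)) set
    \<Rightarrow> (nat \<times> ('p, 'q) nerve_simplex \<times> (nat \<Rightarrow> real)) set" where
  "classifying_map D F = realization_map (nerve D) (nerve_map F)"


section \<open>Zig-zags\<close>

text \<open>The zig-zag with barred entries \<open>bar i\<close> (\<open>0 \<le> i \<le> n\<close>), unbarred entries \<open>mid i\<close>
  (\<open>1 \<le> i \<le> n\<close>) and arrows \<open>fwd i : bar (i - 1) \<rightarrow> mid i\<close> and \<open>bwd i : bar i \<rightarrow> mid i\<close>.\<close>

record ('o, 'm) zigzag =
  bar :: "nat \<Rightarrow> 'o"
  mid :: "nat \<Rightarrow> 'o"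
  fwd :: "nat \<Rightarrow> 'm"
  bwd :: "nat \<Rightarrow> 'm"

record ('o, 'm) zigzag_map =
  zz_dom :: "('o, 'm) zigzag"
  zz_cod :: "('o, 'm) zigzag"
  bar_map :: "nat \<Rightarrow> 'm"
  mid_map :: "nat \<Rightarrow> 'm"

definition zigzags :: "('o, 'm) cat \<Rightarrow> nat \<Rightarrow> ('o, 'm) zigzag set" where
  "zigzags D n = {Y. bar Y \<in> {..n} \<rightarrow>\<^sub>E Obj D \<and> mid Y \<in> {1..n} \<rightarrow>\<^sub>E Obj D \<and>
     fwd Y \<in> {1..n} \<rightarrow>\<^sub>E Arr D \<and> bwd Y \<in> {1..n} \<rightarrow>\<^sub>E Arr D \<and>
     (\<forall>i\<in>{1..n}. Dom D (fwd Y i) = bar Y (i - 1) \<and> Cod D (fwd Y i) = mid Y i \<and>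
                 Dom D (bwd Y i) = bar Y i \<and> Cod D (bwd Y i) = mid Y i)}"

definition zigzag_maps :: "('o, 'm) cat \<Rightarrow> nat \<Rightarrow> ('o, 'm) zigzag_map set" where
  "zigzag_maps D n = {f. zz_dom f \<in> zigzags D n \<and> zz_cod f \<in> zigzags D n \<and>
     bar_map f \<in> {..n} \<rightarrow>\<^sub>E Arr D \<and> mid_map f \<in> {1..n} \<rightarrow>\<^sub>E Arr D \<and>
     (\<forall>i\<in>{..n}. Dom D (bar_map f i) = bar (zz_dom f) i \<and>
                Cod D (bar_map f i) = bar (zz_cod f) i) \<and>
     (\<forall>i\<in>{1..n}. Dom D (mid_map f i) = mid (zz_dom f) i \<and>
                 Cod D (mid_map f i) = mid (zz_cod f) i \<and>
                 Comp D (mid_map f i) (fwd (zz_dom f) i)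
                   = Comp D (fwd (zz_cod f) i) (bar_map f (i - 1)) \<and>
                 Comp D (mid_map f i) (bwd (zz_dom f) i)
                   = Comp D (bwd (zz_cod f) i) (bar_map f i))}"

definition Lambda :: "('o, 'm) cat \<Rightarrow> nat \<Rightarrow> (('o, 'm) zigzag, ('o, 'm) zigzag_map) cat" where
  "Lambda D n = \<lparr>Obj = zigzags D n, Arr = zigzag_maps D n, Dom = zz_dom, Cod = zz_cod,
     Ide = (\<lambda>Y. \<lparr>zz_dom = Y, zz_cod = Y, bar_map = (\<lambda>i\<in>{..n}. Ide D (bar Y i)),
                 mid_map = (\<lambda>i\<in>{1..n}. Ide D (mid Y i))\<rparr>),
     Comp = (\<lambda>g f. \<lparr>zz_dom = zz_dom f, zz_cod = zz_cod g,
                 bar_map = (\<lambda>i\<in>{..n}. Comp D (bar_map g i) (bar_map f i)),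
                 mid_map = (\<lambda>i\<in>{1..n}. Comp D (mid_map g i) (mid_map f i))\<rparr>)\<rparr>"

text \<open>For \<open>\<phi> : [m] \<rightarrow> [n]\<close>, the barred entry of \<open>\<Lambda>(\<phi>)(Y)\<close> in position \<open>j\<close> is the barred entry of \<open>Y\<close>
  in position \<open>last_index m \<phi> j\<close>: the largest \<open>i\<close> with \<open>\<phi> i \<le> j\<close>, or \<open>0\<close> if \<open>j < \<phi> 0\<close>.
  The step leading to position \<open>j\<close> is the \<open>i\<close>-th step of \<open>Y\<close> if \<open>j = \<phi> i\<close> with \<open>i \<ge> 1\<close>
  (and then \<open>last_index m \<phi> j = i\<close>), and an identity zig-zag otherwise.\<close>

definition last_index :: "nat \<Rightarrow> (nat \<Rightarrow> nat) \<Rightarrow> nat \<Rightarrow> nat" where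
  "last_index m \<phi> j = Max ({0} \<union> {i. i \<le> m \<and> \<phi> i \<le> j})"

definition Lambda_obj :: "('o, 'm) cat \<Rightarrow> ord_map \<Rightarrow> ('o, 'm) zigzag \<Rightarrow> ('o, 'm) zigzag" where
  "Lambda_obj D = (\<lambda>(m, \<phi>, n) Y. let k = last_index m \<phi> in
     \<lparr>bar = (\<lambda>j\<in>{..n}. bar Y (k j)),
      mid = (\<lambda>j\<in>{1..n}. if j \<in> \<phi> ` {1..m} then mid Y (k j) else bar Y (k j)),
      fwd = (\<lambda>j\<in>{1..n}. if j \<in> \<phi> ` {1..m} then fwd Y (k j) else Ide D (bar Y (k j))),
      bwd = (\<lambda>j\<in>{1..n}. if j \<in> \<phi> ` {1..m} then bwd Y (k j) else Ide D (bar Y (k j)))\<rparr>)"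

definition Lambda_arr :: "('o, 'm) cat \<Rightarrow> ord_map \<Rightarrow> ('o, 'm) zigzag_map \<Rightarrow> ('o, 'm) zigzag_map"
  where
  "Lambda_arr D = (\<lambda>(m, \<phi>, n) f. let k = last_index m \<phi> in
     \<lparr>zz_dom = Lambda_obj D (m, \<phi>, n) (zz_dom f), zz_cod = Lambda_obj D (m, \<phi>, n) (zz_cod f),
      bar_map = (\<lambda>j\<in>{..n}. bar_map f (k j)),
      mid_map = (\<lambda>j\<in>{1..n}. if j \<in> \<phi> ` {1..m} then mid_map f (k j) else bar_map f (k j))\<rparr>)"

definition Lambda_functor :: "('o, 'm) cat \<Rightarrow> ord_map
    \<Rightarrow> (('o, 'm) zigzag, ('o, 'm) zigzag_map, ('o, 'm) zigzag, ('o, 'm) zigzag_map) ftor" where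
  "Lambda_functor D \<phi> =
     \<lparr>obj_map = restrict (Lambda_obj D \<phi>) (Obj (Lambda D (Dom Delta \<phi>))),
      arr_map = restrict (Lambda_arr D \<phi>) (Arr (Lambda D (Dom Delta \<phi>)))\<rparr>"


section \<open>Grothendieck construction\<close>

text \<open>The Grothendieck construction of a functor \<open>(F, Fm)\<close> from \<open>J\<close> to small categories. The triple
  \<open>(Y, \<phi>, f)\<close> is the arrow \<open>(m, Y) \<rightarrow> (n, Z)\<close> consisting of \<open>\<phi> : m \<rightarrow> n\<close> and
  \<open>f : Fm \<phi> Y \<rightarrow> Z\<close>; the object \<open>Y\<close> is recorded since \<open>\<phi>\<close> and \<open>f\<close> need not determine it.\<close>

definition grothendieck :: "('j, 'k) cat \<Rightarrow> ('j \<Rightarrow> ('o, 'm) cat) \<Rightarrow> ('k \<Rightarrow> ('o, 'm, 'o, 'm) ftor)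
    \<Rightarrow> ('j \<times> 'o, 'o \<times> 'k \<times> 'm) cat" where
  "grothendieck J F Fm =
     \<lparr>Obj = {(n, Y). n \<in> Obj J \<and> Y \<in> Obj (F n)},
      Arr = {(Y, \<phi>, f). \<phi> \<in> Arr J \<and> Y \<in> Obj (F (Dom J \<phi>)) \<and> f \<in> Arr (F (Cod J \<phi>)) \<and>
                Dom (F (Cod J \<phi>)) f = obj_map (Fm \<phi>) Y},
      Dom = (\<lambda>(Y, \<phi>, f). (Dom J \<phi>, Y)),
      Cod = (\<lambda>(Y, \<phi>, f). (Cod J \<phi>, Cod (F (Cod J \<phi>)) f)),
      Ide = (\<lambda>(n, Y). (Y, Ide J n, Ide (F n) Y)),
      Comp = (\<lambda>(Z, \<psi>, g) (Y, \<phi>, f).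
                (Y, Comp J \<psi> \<phi>, Comp (F (Cod J \<psi>)) g (arr_map (Fm \<psi>) f)))\<rparr>"

text \<open>The category \<open>\<Lambda>\<^sub>\<star> D\<close>, where \<open>J\<close> is \<open>Delta_inj\<close> or \<open>Delta_le\<close>.\<close>

definition Lambda_star :: "(nat, ord_map) cat \<Rightarrow> ('o, 'm) cat
    \<Rightarrow> (nat \<times> ('o, 'm) zigzag, ('o, 'm) zigzag \<times> ord_map \<times> ('o, 'm) zigzag_map) cat" where
  "Lambda_star J D = grothendieck J (Lambda D) (Lambda_functor D)"

text \<open>The isomorphism of \<open>D\<close> with \<open>\<Lambda>\<^sub>0 D\<close>, on objects and on arrows.\<close>

definition zigzag0 :: "'o \<Rightarrow> ('o, 'm) zigzag" where
  "zigzag0 Y = \<lparr>bar = (\<lambda>i\<in>{..0}. Y), mid = (\<lambda>i. undefined),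
                fwd = (\<lambda>i. undefined), bwd = (\<lambda>i. undefined)\<rparr>"

definition zigzag_map0 :: "('o, 'm) cat \<Rightarrow> 'm \<Rightarrow> ('o, 'm) zigzag_map" where
  "zigzag_map0 D f = \<lparr>zz_dom = zigzag0 (Dom D f), zz_cod = zigzag0 (Cod D f),
                      bar_map = (\<lambda>i\<in>{..0}. f), mid_map = (\<lambda>i. undefined)\<rparr>"

definition incl :: "(nat, ord_map) cat \<Rightarrow> ('o, 'm) cat
    \<Rightarrow> ('o, 'm, nat \<times> ('o, 'm) zigzag, ('o, 'm) zigzag \<times> ord_map \<times> ('o, 'm) zigzag_map) ftor" where
  "incl J D = \<lparr>obj_map = (\<lambda>Y\<in>Obj D. (0, zigzag0 Y)),
               arr_map = (\<lambda>f\<in>Arr D. (zigzag0 (Dom D f), Ide J 0, zigzag_map0 D f))\<rparr>"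

text \<open>The functor \<open>([n], Y) \<mapsto> bar Y 0\<close>. It sends \<open>(\<phi>, f)\<close> to the component of \<open>f\<close> in position \<open>0\<close>,
  since \<open>\<Lambda>(\<phi>)(Y)\<close> and \<open>Y\<close> have the same barred entry there.\<close>

definition proj0 :: "(nat, ord_map) cat \<Rightarrow> ('o, 'm) cat
    \<Rightarrow> (nat \<times> ('o, 'm) zigzag, ('o, 'm) zigzag \<times> ord_map \<times> ('o, 'm) zigzag_map, 'o, 'm) ftor" where
  "proj0 J D = \<lparr>obj_map = (\<lambda>(n, Y)\<in>Obj (Lambda_star J D). bar Y 0),
                arr_map = (\<lambda>(Y, \<phi>, f)\<in>Arr (Lambda_star J D). bar_map f 0)\<rparr>"


section \<open>Well-definedness\<close>

lemma istopology_quotient: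
  "istopology (\<lambda>U. U \<subseteq> topspace T // R \<and> openin T {x \<in> topspace T. R `` {x} \<in> U})"
proof -
  have 1: "{x \<in> topspace T. R `` {x} \<in> U \<inter> V}
    = {x \<in> topspace T. R `` {x} \<in> U} \<inter> {x \<in> topspace T. R `` {x} \<in> V}" for U V
    by auto
  have 2: "{x \<in> topspace T. R `` {x} \<in> \<Union>\<K>} = (\<Union>U\<in>\<K>. {x \<in> topspace T. R `` {x} \<in> U})" for \<K>
    by auto
  show ?thesis
    unfolding istopology_def 1 2 by (auto intro: openin_Int)
qed

lemma openin_quotient_topology:
  "openin (quotient_topology T R) U \<longleftrightarrow>
     U \<subseteq> topspace T // R \<and> openin T {x \<in> topspace T. R `` {x} \<in> U}"
  unfolding quotient_topology_def by (simp add: topology_inverse' istopology_quotient)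

lemma topspace_quotient_topology: "topspace (quotient_topology T R) = topspace T // R"
proof -
  have "{x \<in> topspace T. R `` {x} \<in> topspace T // R} = topspace T"
    by (auto intro: quotientI)
  then have "openin (quotient_topology T R) (topspace T // R)"
    by (simp add: openin_quotient_topology)
  then show ?thesis
    by (metis openin_quotient_topology openin_subset openin_topspace subset_antisym)
qed

lemma quotient_map_quotient_topology:
  "quotient_map T (quotient_topology T R) (\<lambda>x. R `` {x})"
  unfolding quotient_map_def topspace_quotient_topology openin_quotient_topology
  by (auto simp: quotient_def)

lemma equiv_gluing_equiv: "equiv (topspace (presentation X)) (gluing_equiv X)"
proof -
  have "sym ((gluing X \<union> (gluing X)\<inverse>)\<^sup>*)"
    by (simp add: sym_rtrancl sym_Un_converse)
  then show ?thesis
    unfolding gluing_equiv_def equiv_def refl_on_def sym_def trans_def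
    by (auto intro: rtrancl_trans)
qed

lemma topspace_presentation:
  "topspace (presentation X) = {(n, s, t). s \<in> simplices X n \<and> t \<in> standard_simplex n}"
  unfolding presentation_def by (auto simp: Sigma_def)

lemma category_Delta: "category Delta"
  by unfold_locales
    (auto simp: Delta_def compose_def PiE_iff mono_on_def restrict_def extensional_def fun_eq_iff)

lemma category_Delta_inj: "category Delta_inj"
  by unfold_locales
    (auto simp: Delta_def Delta_inj_def compose_def PiE_iff strict_mono_on_def restrict_def
      extensional_def fun_eq_iff)

lemma category_Delta_le: "category Delta_le"
  by unfold_locales
    (auto simp: Delta_def Delta_le_def compose_def restrict_def fun_eq_iff split: if_splits)

lemma Delta_le_subset: "Arr Delta_le \<subseteq> Arr Delta_inj"
  by (auto simp: Delta_def Delta_le_def Delta_inj_def strict_mono_on_def PiE_iff)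

lemma Delta_inj_subset: "Arr Delta_inj \<subseteq> Arr Delta"
  by (auto simp: Delta_def Delta_inj_def strict_mono_on_imp_mono_on)

lemma category_ordinal: "category (ordinal n)"
  by unfold_locales (auto simp: ordinal_def)

lemma is_functor_ordinal_functor:
  assumes "\<theta> \<in> Arr Delta"
  shows "is_functor (ordinal (Dom Delta \<theta>)) (ordinal (Cod Delta \<theta>)) (ordinal_functor \<theta>)"
  using assms
  by (auto simp: Delta_def ordinal_def ordinal_functor_def is_functor_def mono_on_def PiE_iff)

lemma is_functor_fcomp:
  assumes "category C" "is_functor C D F" "is_functor D E G"
  shows "is_functor C E (fcomp C G F)"
  using assms(2,3) category.Dom_Obj[OF assms(1)] category.Cod_Obj[OF assms(1)]
    category.Ide_Arr[OF assms(1)] category.Comp_Arr[OF assms(1)]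
  by (auto simp: is_functor_def fcomp_def compose_def PiE_iff)

lemma simplicial_set_nerve: "simplicial_set (nerve C)"
proof
  fix \<theta> s assume "\<theta> \<in> Arr Delta" "s \<in> simplices (nerve C) (Cod Delta \<theta>)"
  then show "action (nerve C) \<theta> s \<in> simplices (nerve C) (Dom Delta \<theta>)"
    using is_functor_fcomp[OF category_ordinal is_functor_ordinal_functor] by (simp add: nerve_def)
next
  fix s n assume "s \<in> simplices (nerve C) n"
  then show "action (nerve C) (Ide Delta n) s = s"
    by (cases s) (auto simp: nerve_def Delta_def is_functor_def fcomp_def compose_def PiE_iff
      ordinal_def ordinal_functor_def extensional_def fun_eq_iff restrict_def)
next
  fix \<eta> \<theta> s
  assume "\<eta> \<in> Arr Delta" "\<theta> \<in> Arr Delta" "Dom Delta \<eta> = Cod Delta \<theta>"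
    "s \<in> simplices (nerve C) (Cod Delta \<eta>)"
  then show "action (nerve C) (Comp Delta \<eta> \<theta>) s = action (nerve C) \<theta> (action (nerve C) \<eta> s)"
    by (auto simp: nerve_def Delta_def is_functor_def fcomp_def compose_def PiE_iff
      ordinal_def ordinal_functor_def extensional_def fun_eq_iff restrict_def mono_on_def)
qed


lemma zigzagsD:
  assumes "Y \<in> zigzags D n"
  shows "i \<le> n \<Longrightarrow> bar Y i \<in> Obj D"
    and "1 \<le> i \<Longrightarrow> i \<le> n \<Longrightarrow> mid Y i \<in> Obj D \<and> fwd Y i \<in> Arr D \<and> bwd Y i \<in> Arr D \<and>
      Dom D (fwd Y i) = bar Y (i - 1) \<and> Cod D (fwd Y i) = mid Y i \<and>
      Dom D (bwd Y i) = bar Y i \<and> Cod D (bwd Y i) = mid Y i"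
  using assms by (auto simp: zigzags_def PiE_iff)

lemma zigzag_mapsD:
  assumes "f \<in> zigzag_maps D n"
  shows "zz_dom f \<in> zigzags D n" "zz_cod f \<in> zigzags D n"
    and "i \<le> n \<Longrightarrow> bar_map f i \<in> Arr D \<and> Dom D (bar_map f i) = bar (zz_dom f) i \<and>
                Cod D (bar_map f i) = bar (zz_cod f) i"
    and "1 \<le> i \<Longrightarrow> i \<le> n \<Longrightarrow> mid_map f i \<in> Arr D \<and> Dom D (mid_map f i) = mid (zz_dom f) i \<and>
                 Cod D (mid_map f i) = mid (zz_cod f) i \<and>
                 Comp D (mid_map f i) (fwd (zz_dom f) i)
                   = Comp D (fwd (zz_cod f) i) (bar_map f (i - 1)) \<and>
                 Comp D (mid_map f i) (bwd (zz_dom f) i)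
                   = Comp D (bwd (zz_cod f) i) (bar_map f i)"
  using assms by (auto simp: zigzag_maps_def PiE_iff)

lemma zigzag_map_eqI:
  assumes "f \<in> zigzag_maps D n" "g \<in> zigzag_maps D n" "zz_dom f = zz_dom g" "zz_cod f = zz_cod g"
    "\<And>i. i \<le> n \<Longrightarrow> bar_map f i = bar_map g i"
    "\<And>i. 1 \<le> i \<Longrightarrow> i \<le> n \<Longrightarrow> mid_map f i = mid_map g i"
  shows "f = g"
proof -
  have "bar_map f = bar_map g"
    using assms by (intro PiE_ext[of _ "{..n}" "\<lambda>_. Arr D"]) (auto simp: zigzag_maps_def)
  moreover have "mid_map f = mid_map g"
    using assms by (intro PiE_ext[of _ "{1..n}" "\<lambda>_. Arr D"]) (auto simp: zigzag_maps_def)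
  ultimately show ?thesis
    using assms(3,4) by simp
qed

lemma category_Lambda:
  assumes "category D"
  shows "category (Lambda D n)"
proof -
  interpret category D by fact
  note c = Dom_Obj Cod_Obj Ide_Arr Dom_Ide Cod_Ide Comp_Arr Dom_Comp Cod_Comp Comp_Ide Ide_Comp
  have ide: "Ide (Lambda D n) Y \<in> zigzag_maps D n" if Y: "Y \<in> zigzags D n" for Y
  proof -
    have "Comp D (Ide D (mid Y i)) (fwd Y i) = Comp D (fwd Y i) (Ide D (bar Y (i - 1)))"
      "Comp D (Ide D (mid Y i)) (bwd Y i) = Comp D (bwd Y i) (Ide D (bar Y i))"
      if "1 \<le> i" "i \<le> n" for i
      using zigzagsD(2)[OF Y that] by (metis Comp_Ide Ide_Comp)+
    then show ?thesis
      using Y zigzagsD[OF Y] by (auto simp: Lambda_def zigzag_maps_def PiE_iff c)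
  qed
  have comp: "Comp (Lambda D n) g f \<in> zigzag_maps D n"
    if g: "g \<in> zigzag_maps D n" and f: "f \<in> zigzag_maps D n" and gf: "zz_dom g = zz_cod f" for f g
  proof -
    have "Comp D (Comp D (mid_map g i) (mid_map f i)) (fwd (zz_dom f) i)
        = Comp D (fwd (zz_cod g) i) (Comp D (bar_map g (i - 1)) (bar_map f (i - 1)))"
      "Comp D (Comp D (mid_map g i) (mid_map f i)) (bwd (zz_dom f) i)
        = Comp D (bwd (zz_cod g) i) (Comp D (bar_map g i) (bar_map f i))"
      if i: "1 \<le> i" "i \<le> n" for i
    proof -
      have i1: "i - 1 \<le> n" using i by simp
      note m = zigzag_mapsD(4)[OF g i] zigzag_mapsD(4)[OF f i] zigzag_mapsD(3)[OF g i1]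
        zigzag_mapsD(3)[OF f i1] zigzag_mapsD(3)[OF g i(2)] zigzag_mapsD(3)[OF f i(2)]
        zigzagsD(2)[OF zigzag_mapsD(1)[OF g] i] zigzagsD(2)[OF zigzag_mapsD(2)[OF g] i]
        zigzagsD(2)[OF zigzag_mapsD(1)[OF f] i] gf
      show "Comp D (Comp D (mid_map g i) (mid_map f i)) (fwd (zz_dom f) i)
        = Comp D (fwd (zz_cod g) i) (Comp D (bar_map g (i - 1)) (bar_map f (i - 1)))"
        using m by (metis Comp_assoc)
      show "Comp D (Comp D (mid_map g i) (mid_map f i)) (bwd (zz_dom f) i)
        = Comp D (bwd (zz_cod g) i) (Comp D (bar_map g i) (bar_map f i))"
        using m by (metis Comp_assoc)
    qed
    then show ?thesis
      using zigzag_mapsD[OF g] zigzag_mapsD[OF f] gf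
      by (auto simp: Lambda_def zigzag_maps_def PiE_iff c)
  qed
  have sel: "Obj (Lambda D n) = zigzags D n" "Arr (Lambda D n) = zigzag_maps D n"
    "Dom (Lambda D n) = zz_dom" "Cod (Lambda D n) = zz_cod"
    by (simp_all add: Lambda_def)
  have doms: "zz_dom (Ide (Lambda D n) Y) = Y" "zz_cod (Ide (Lambda D n) Y) = Y"
    "zz_dom (Comp (Lambda D n) g f) = zz_dom f" "zz_cod (Comp (Lambda D n) g f) = zz_cod g" for Y g f
    by (simp_all add: Lambda_def)
  show ?thesis
  proof (standard, unfold sel doms)
    fix f assume f: "f \<in> zigzag_maps D n"
    show "Comp (Lambda D n) f (Ide (Lambda D n) (zz_dom f)) = f"
    proof (intro zigzag_map_eqI[where D = D and n = n] comp ide f)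
      show "bar_map (Comp (Lambda D n) f (Ide (Lambda D n) (zz_dom f))) i = bar_map f i" if "i \<le> n" for i
        using zigzag_mapsD(3)[OF f that] that Comp_Ide[of "bar_map f i"] by (auto simp: Lambda_def)
      show "mid_map (Comp (Lambda D n) f (Ide (Lambda D n) (zz_dom f))) i = mid_map f i"
        if "1 \<le> i" "i \<le> n" for i
        using zigzag_mapsD(4)[OF f that] that Comp_Ide[of "mid_map f i"] by (auto simp: Lambda_def)
    qed (use zigzag_mapsD[OF f] in \<open>auto simp: doms\<close>)
    show "Comp (Lambda D n) (Ide (Lambda D n) (zz_cod f)) f = f"
    proof (intro zigzag_map_eqI[where D = D and n = n] comp ide f)
      show "bar_map (Comp (Lambda D n) (Ide (Lambda D n) (zz_cod f)) f) i = bar_map f i" if "i \<le> n" for i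
        using zigzag_mapsD(3)[OF f that] that Ide_Comp[of "bar_map f i"] by (auto simp: Lambda_def)
      show "mid_map (Comp (Lambda D n) (Ide (Lambda D n) (zz_cod f)) f) i = mid_map f i"
        if "1 \<le> i" "i \<le> n" for i
        using zigzag_mapsD(4)[OF f that] that Ide_Comp[of "mid_map f i"] by (auto simp: Lambda_def)
    qed (use zigzag_mapsD[OF f] in \<open>auto simp: doms\<close>)
  next
    fix h g f
    assume h: "h \<in> zigzag_maps D n" and g: "g \<in> zigzag_maps D n" and f: "f \<in> zigzag_maps D n"
      and hg: "zz_dom h = zz_cod g" and gf: "zz_dom g = zz_cod f"
    show "Comp (Lambda D n) (Comp (Lambda D n) h g) f = Comp (Lambda D n) h (Comp (Lambda D n) g f)"
    proof (intro zigzag_map_eqI[where D = D and n = n] comp h g f)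
      fix i assume i: "i \<le> n"
      show "bar_map (Comp (Lambda D n) (Comp (Lambda D n) h g) f) i
        = bar_map (Comp (Lambda D n) h (Comp (Lambda D n) g f)) i"
        using zigzag_mapsD(3)[OF h i] zigzag_mapsD(3)[OF g i] zigzag_mapsD(3)[OF f i] i hg gf
        by (simp add: Lambda_def Comp_assoc)
    next
      fix i assume i: "1 \<le> i" "i \<le> n"
      show "mid_map (Comp (Lambda D n) (Comp (Lambda D n) h g) f) i
        = mid_map (Comp (Lambda D n) h (Comp (Lambda D n) g f)) i"
        using zigzag_mapsD(4)[OF h i] zigzag_mapsD(4)[OF g i] zigzag_mapsD(4)[OF f i] i hg gf
        by (simp add: Lambda_def Comp_assoc)
    qed (auto simp: doms hg gf)
  qed (auto simp: ide comp zigzag_mapsD)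
qed

lemma category_grothendieck:
  assumes J: "category J" and F: "\<And>n. n \<in> Obj J \<Longrightarrow> category (F n)"
    and Fm: "\<And>\<phi>. \<phi> \<in> Arr J \<Longrightarrow> is_functor (F (Dom J \<phi>)) (F (Cod J \<phi>)) (Fm \<phi>)"
    and Fm_Ide: "\<And>n. n \<in> Obj J \<Longrightarrow> Fm (Ide J n) = fident (F n)"
    and Fm_Comp: "\<And>\<psi> \<phi>. \<psi> \<in> Arr J \<Longrightarrow> \<phi> \<in> Arr J \<Longrightarrow> Dom J \<psi> = Cod J \<phi> \<Longrightarrow>
      Fm (Comp J \<psi> \<phi>) = fcomp (F (Dom J \<phi>)) (Fm \<psi>) (Fm \<phi>)"
  shows "category (grothendieck J F Fm)"
proof -
  interpret J: category J by fact
  note Jc = J.Dom_Obj J.Cod_Obj J.Ide_Arr J.Dom_Ide J.Cod_Ide J.Comp_Arr J.Dom_Comp J.Cod_Comp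
    J.Comp_Ide J.Ide_Comp J.Comp_assoc
  note Fc = F[THEN category.Dom_Obj] F[THEN category.Cod_Obj] F[THEN category.Ide_Arr]
    F[THEN category.Dom_Ide] F[THEN category.Cod_Ide] F[THEN category.Comp_Arr]
    F[THEN category.Dom_Comp] F[THEN category.Cod_Comp] F[THEN category.Comp_Ide]
    F[THEN category.Ide_Comp] F[THEN category.Comp_assoc]
  have Fm1: "obj_map (Fm \<phi>) Y \<in> Obj (F (Cod J \<phi>))" if "\<phi> \<in> Arr J" "Y \<in> Obj (F (Dom J \<phi>))" for \<phi> Y
    using Fm[OF that(1)] that(2) unfolding is_functor_def by auto
  have Fm2: "arr_map (Fm \<phi>) f \<in> Arr (F (Cod J \<phi>))"
    "Dom (F (Cod J \<phi>)) (arr_map (Fm \<phi>) f) = obj_map (Fm \<phi>) (Dom (F (Dom J \<phi>)) f)"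
    "Cod (F (Cod J \<phi>)) (arr_map (Fm \<phi>) f) = obj_map (Fm \<phi>) (Cod (F (Dom J \<phi>)) f)"
    if "\<phi> \<in> Arr J" "f \<in> Arr (F (Dom J \<phi>))" for \<phi> f
    using Fm[OF that(1)] that(2) unfolding is_functor_def by auto
  have Fm3: "arr_map (Fm \<phi>) (Ide (F (Dom J \<phi>)) Y) = Ide (F (Cod J \<phi>)) (obj_map (Fm \<phi>) Y)"
    if "\<phi> \<in> Arr J" "Y \<in> Obj (F (Dom J \<phi>))" for \<phi> Y
    using Fm[OF that(1)] that(2) unfolding is_functor_def by auto
  have Fm4: "arr_map (Fm \<phi>) (Comp (F n) g f)
      = Comp (F (Cod J \<phi>)) (arr_map (Fm \<phi>) g) (arr_map (Fm \<phi>) f)"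
    if "\<phi> \<in> Arr J" "Dom J \<phi> = n" "g \<in> Arr (F n)" "f \<in> Arr (F n)"
      "Dom (F n) g = Cod (F n) f" for \<phi> n g f
    using Fm[OF that(1)] that(2-) unfolding is_functor_def by auto
  let ?G = "grothendieck J F Fm"
  show ?thesis
  proof
    fix f assume "f \<in> Arr ?G"
    then show "Dom ?G f \<in> Obj ?G" "Cod ?G f \<in> Obj ?G"
      by (auto simp: grothendieck_def Jc Fc)
  next
    fix X assume "X \<in> Obj ?G"
    then show "Ide ?G X \<in> Arr ?G" "Dom ?G (Ide ?G X) = X" "Cod ?G (Ide ?G X) = X"
      by (auto simp: grothendieck_def Jc Fc Fm_Ide fident_def)
  next
    fix g f assume "g \<in> Arr ?G" "f \<in> Arr ?G" "Dom ?G g = Cod ?G f"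
    then show "Comp ?G g f \<in> Arr ?G" "Dom ?G (Comp ?G g f) = Dom ?G f"
      "Cod ?G (Comp ?G g f) = Cod ?G g"
      by (auto simp: grothendieck_def Jc Fc Fm1 Fm2 Fm_Comp fcomp_def compose_def)
  next
    fix f assume "f \<in> Arr ?G"
    then show "Comp ?G f (Ide ?G (Dom ?G f)) = f" "Comp ?G (Ide ?G (Cod ?G f)) f = f"
      by (auto simp: grothendieck_def Jc Fc Fm1 Fm3 Fm_Ide fident_def)
        (metis Fc(9) J.Cod_Obj)
  next
    fix h g f assume "h \<in> Arr ?G" "g \<in> Arr ?G" "f \<in> Arr ?G" "Dom ?G h = Cod ?G g"
      "Dom ?G g = Cod ?G f"
    then show "Comp ?G (Comp ?G h g) f = Comp ?G h (Comp ?G g f)"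
      by (auto simp: grothendieck_def Jc Fc Fm1 Fm2 Fm4 Fm_Comp fcomp_def compose_def)
  qed
qed

lemma last_index_hit:
  assumes "strict_mono_on {..m} \<phi>" "i \<le> m"
  shows "last_index m \<phi> (\<phi> i) = i"
proof -
  have "{k. k \<le> m \<and> \<phi> k \<le> \<phi> i} = {..i}"
    using assms by (auto simp: strict_mono_on_leD strict_mono_on_less_eq)
  then show ?thesis
    unfolding last_index_def by (auto intro!: Max_eqI)
qed

lemma last_index_le: "last_index m \<phi> j \<le> m"
  unfolding last_index_def by (intro Max.boundedI) auto

lemma last_index_zero: "strict_mono_on {..m} \<phi> \<Longrightarrow> last_index m \<phi> 0 = 0"
proof -
  assume m: "strict_mono_on {..m} \<phi>"
  have "i = 0" if "i \<le> m" "\<phi> i \<le> 0" for i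
    using m[THEN strict_mono_onD, of 0 i] that by auto
  then have e: "{0} \<union> {i. i \<le> m \<and> \<phi> i \<le> 0} = {0}" by auto
  show ?thesis unfolding last_index_def e by simp
qed

lemma last_index_mono: "j \<le> j' \<Longrightarrow> last_index m \<phi> j \<le> last_index m \<phi> j'"
  unfolding last_index_def by (intro Max_mono) auto

lemma last_index_ge: "i \<le> m \<Longrightarrow> \<phi> i \<le> j \<Longrightarrow> i \<le> last_index m \<phi> j"
  unfolding last_index_def by (intro Max_ge) auto

lemma last_index_cases: "last_index m \<phi> j = 0 \<or> \<phi> (last_index m \<phi> j) \<le> j"
proof -
  have "last_index m \<phi> j \<in> {0} \<union> {i. i \<le> m \<and> \<phi> i \<le> j}"
    unfolding last_index_def by (intro Max_in) auto
  then show ?thesis by auto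
qed

lemma last_index_eqI:
  assumes "k = 0 \<or> (k \<le> m \<and> \<phi> k \<le> j)" "\<And>i. i \<le> m \<Longrightarrow> \<phi> i \<le> j \<Longrightarrow> i \<le> k"
  shows "last_index m \<phi> j = k"
  unfolding last_index_def using assms by (intro Max_eqI) auto

lemma last_index_pred:
  assumes m: "strict_mono_on {..m} \<phi>" and j: "1 \<le> j"
  shows "last_index m \<phi> (j - 1)
    = (if j \<in> \<phi> ` {1..m} then last_index m \<phi> j - 1 else last_index m \<phi> j)"
proof (cases "j \<in> \<phi> ` {1..m}")
  case True
  then obtain i where i: "1 \<le> i" "i \<le> m" "j = \<phi> i" by auto
  have "last_index m \<phi> (j - 1) = i - 1"
  proof (rule last_index_eqI)
    show "i - 1 = 0 \<or> (i - 1 \<le> m \<and> \<phi> (i - 1) \<le> j - 1)"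
      using strict_mono_onD[OF m, of "i - 1" i] i by fastforce
    show "k \<le> i - 1" if k: "k \<le> m" "\<phi> k \<le> j - 1" for k
    proof -
      have "\<phi> k < \<phi> i" using k i j by linarith
      then have "k < i"
        using strict_mono_on_leD[OF m, of i k] k i by (auto simp: not_le[symmetric])
      then show ?thesis by simp
    qed
  qed
  then show ?thesis using True i last_index_hit[OF m i(2)] by simp
next
  case False
  have "last_index m \<phi> (j - 1) = last_index m \<phi> j"
  proof (rule last_index_eqI)
    have "\<phi> (last_index m \<phi> j) \<noteq> j" if "last_index m \<phi> j \<noteq> 0"
    proof
      assume e: "\<phi> (last_index m \<phi> j) = j"
      have "last_index m \<phi> j \<in> {1..m}" using that last_index_le[of m \<phi> j] by simp
      then have "\<phi> (last_index m \<phi> j) \<in> \<phi> ` {1..m}" by (rule imageI)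
      then show False using e False by simp
    qed
    then show "last_index m \<phi> j = 0 \<or> (last_index m \<phi> j \<le> m \<and> \<phi> (last_index m \<phi> j) \<le> j - 1)"
      using last_index_cases[of m \<phi> j] last_index_le[of m \<phi> j] by fastforce
    show "k \<le> last_index m \<phi> j" if "k \<le> m" "\<phi> k \<le> j - 1" for k
      using that by (intro last_index_ge) auto
  qed
  then show ?thesis using False by simp
qed


lemma strict_mono_on_Delta_inj: "(m, \<phi>, n) \<in> Arr Delta_inj \<Longrightarrow> strict_mono_on {..m} \<phi>"
  by (simp add: Delta_inj_def)

lemma last_index_hit':
  assumes "strict_mono_on {..m} \<phi>" "j \<in> \<phi> ` {1..m}"
  shows "1 \<le> last_index m \<phi> j" "\<phi> (last_index m \<phi> j) = j"
  using assms last_index_hit[OF assms(1)] by auto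

lemma Lambda_obj_zigzags:
  assumes D: "category D" and \<phi>: "(m, \<phi>, n) \<in> Arr Delta_inj" and Y: "Y \<in> zigzags D m"
  shows "Lambda_obj D (m, \<phi>, n) Y \<in> zigzags D n"
proof -
  interpret category D by fact
  note sm = strict_mono_on_Delta_inj[OF \<phi>]
  show ?thesis
    using zigzagsD[OF Y] last_index_le[of m \<phi>] last_index_hit'(1)[OF sm] last_index_pred[OF sm]
    by (auto simp: zigzags_def Lambda_obj_def Let_def PiE_iff Ide_Arr Dom_Ide Cod_Ide)
qed

lemma Lambda_arr_zigzag_maps:
  assumes D: "category D" and \<phi>: "(m, \<phi>, n) \<in> Arr Delta_inj" and f: "f \<in> zigzag_maps D m"
  shows "Lambda_arr D (m, \<phi>, n) f \<in> zigzag_maps D n"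
proof -
  interpret category D by fact
  note sm = strict_mono_on_Delta_inj[OF \<phi>]
  have id: "Comp D (bar_map f i) (Ide D (bar (zz_dom f) i)) = Comp D (Ide D (bar (zz_cod f) i)) (bar_map f i)"
    if "i \<le> m" for i
    using zigzag_mapsD(3)[OF f that] by (metis Comp_Ide Ide_Comp)
  show ?thesis
    unfolding zigzag_maps_def
    using Lambda_obj_zigzags[OF D \<phi> zigzag_mapsD(1)[OF f]]
      Lambda_obj_zigzags[OF D \<phi> zigzag_mapsD(2)[OF f]]
      zigzag_mapsD(3,4)[OF f] last_index_le[of m \<phi>] last_index_hit'(1)[OF sm]
      last_index_pred[OF sm]
    by (auto simp: Lambda_arr_def Lambda_obj_def Let_def PiE_iff id)
qed

lemma is_functor_Lambda_functor:
  assumes D: "category D" and \<phi>: "\<phi> \<in> Arr Delta_inj"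
  shows "is_functor (Lambda D (Dom Delta \<phi>)) (Lambda D (Cod Delta \<phi>)) (Lambda_functor D \<phi>)"
proof -
  obtain m p n where [simp]: "\<phi> = (m, p, n)" by (cases \<phi>)
  note \<phi>' = \<phi>[simplified]
  note sm = strict_mono_on_Delta_inj[OF \<phi>']
  interpret category D by fact
  interpret Lm: category "Lambda D m" by (rule category_Lambda) fact
  have [simp]: "Dom Delta (m, p, n) = m" "Cod Delta (m, p, n) = n" by (auto simp: Delta_def)
  have sel: "Obj (Lambda D k) = zigzags D k" "Arr (Lambda D k) = zigzag_maps D k"
    "Dom (Lambda D k) = zz_dom" "Cod (Lambda D k) = zz_cod" for k
    by (simp_all add: Lambda_def)
  have 1: "Lambda_arr D (m, p, n) (Ide (Lambda D m) Y) = Ide (Lambda D n) (Lambda_obj D (m, p, n) Y)"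
    for Y
    using last_index_le[of m p] last_index_hit'(1)[OF sm]
    by (auto simp: Lambda_def Lambda_arr_def Lambda_obj_def Let_def restrict_def fun_eq_iff)
  have 2: "Lambda_arr D (m, p, n) (Comp (Lambda D m) g f)
      = Comp (Lambda D n) (Lambda_arr D (m, p, n) g) (Lambda_arr D (m, p, n) f)" for g f
    using last_index_le[of m p] last_index_hit'(1)[OF sm]
    by (auto simp: Lambda_def Lambda_arr_def Lambda_obj_def Let_def restrict_def fun_eq_iff)
  show ?thesis
    using Lm.Ide_Arr Lm.Comp_Arr
      Lambda_obj_zigzags[OF D \<phi>'] Lambda_arr_zigzag_maps[OF D \<phi>'] zigzag_mapsD(1,2)[of _ D m]
    by (auto simp: is_functor_def Lambda_functor_def sel 1 2) (auto simp: Lambda_arr_def Let_def)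
qed

lemma last_index_ident: "j \<le> n \<Longrightarrow> last_index n (\<lambda>i\<in>{..n}. i) j = j"
  by (rule last_index_eqI) auto

lemma last_index_compose:
  assumes \<psi>: "(n, \<psi>, p) \<in> Arr Delta_inj" and \<phi>: "(m, \<phi>, n) \<in> Arr Delta_inj"
  shows "last_index m (compose {..m} \<psi> \<phi>) j = last_index m \<phi> (last_index n \<psi> j)"
proof (rule last_index_eqI)
  let ?k = "last_index m \<phi> (last_index n \<psi> j)"
  have r: "i \<le> m \<Longrightarrow> \<phi> i \<le> n" for i
    using \<phi> by (auto simp: Delta_inj_def PiE_iff)
  have sp: "strict_mono_on {..n} \<psi>" "strict_mono_on {..m} \<phi>"
    using strict_mono_on_Delta_inj \<psi> \<phi> by auto
  have "\<psi> (\<phi> ?k) \<le> j" if "?k \<noteq> 0"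
  proof -
    have 1: "\<phi> ?k \<le> last_index n \<psi> j"
      using last_index_cases[of m \<phi> "last_index n \<psi> j"] that by blast
    have "\<phi> 0 < \<phi> ?k"
      using strict_mono_onD[OF sp(2), of 0 ?k] that last_index_le[of m \<phi>] by auto
    then have "last_index n \<psi> j \<noteq> 0"
      using 1 by linarith
    then have "\<psi> (last_index n \<psi> j) \<le> j"
      using last_index_cases[of n \<psi> j] by simp
    moreover have "\<psi> (\<phi> ?k) \<le> \<psi> (last_index n \<psi> j)"
      using strict_mono_on_leD[OF sp(1), of "\<phi> ?k" "last_index n \<psi> j"] 1 r last_index_le
      by auto
    ultimately show ?thesis by linarith
  qed
  then show "?k = 0 \<or> (?k \<le> m \<and> compose {..m} \<psi> \<phi> ?k \<le> j)"
    using last_index_le[of m \<phi>] by (auto simp: compose_def)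
  show "i \<le> ?k" if "i \<le> m" "compose {..m} \<psi> \<phi> i \<le> j" for i
    using that r by (intro last_index_ge) (auto simp: compose_def)
qed

lemma Lambda_functor_Ide:
  assumes D: "category D"
  shows "Lambda_functor D (Ide Delta_inj n) = fident (Lambda D n)"
proof -
  have 0: "(\<lambda>i\<in>{..n}. i) ` {1..n} = {1..n}" by auto
  have 1: "Lambda_obj D (n, (\<lambda>i\<in>{..n}. i), n) Y = Y" if "Y \<in> zigzags D n" for Y
    using that last_index_ident[of _ n]
    by (cases Y) (auto simp: Lambda_obj_def zigzags_def Let_def PiE_iff restrict_def extensional_def
      fun_eq_iff 0)
  have 2: "Lambda_arr D (n, (\<lambda>i\<in>{..n}. i), n) f = f" if "f \<in> zigzag_maps D n" for f
    using that last_index_ident[of _ n] 1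
    by (cases f) (auto simp: Lambda_arr_def zigzag_maps_def Let_def PiE_iff restrict_def
      extensional_def fun_eq_iff 0)
  show ?thesis
    by (auto simp: Lambda_functor_def fident_def Delta_inj_def Delta_def Lambda_def 1 2
      intro!: restrict_ext)
qed

lemma compose_image_iff:
  assumes \<psi>: "(n, \<psi>, p) \<in> Arr Delta_inj" and \<phi>: "(m, \<phi>, n) \<in> Arr Delta_inj"
  shows "j \<in> compose {..m} \<psi> \<phi> ` {1..m} \<longleftrightarrow>
    j \<in> \<psi> ` {1..n} \<and> last_index n \<psi> j \<in> \<phi> ` {1..m}"
proof -
  have r: "i \<le> m \<Longrightarrow> \<phi> i \<le> n" for i
    using \<phi> by (auto simp: Delta_inj_def PiE_iff)
  have sp: "strict_mono_on {..n} \<psi>" "strict_mono_on {..m} \<phi>"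
    using strict_mono_on_Delta_inj \<psi> \<phi> by auto
  have c: "compose {..m} \<psi> \<phi> ` {1..m} = (\<lambda>i. \<psi> (\<phi> i)) ` {1..m}"
    by (auto simp: compose_def image_iff)
  have pos: "1 \<le> \<phi> i" if "1 \<le> i" "i \<le> m" for i
    using strict_mono_onD[OF sp(2), of 0 i] that by auto
  show ?thesis
    unfolding c
  proof safe
    fix i assume i: "i \<in> {1..m}"
    then show "\<psi> (\<phi> i) \<in> \<psi> ` {1..n}" using r pos by auto
    show "last_index n \<psi> (\<psi> (\<phi> i)) \<in> \<phi> ` {1..m}"
      using i r last_index_hit[OF sp(1)] by auto
  next
    fix k i assume k: "k \<in> {1..n}" "last_index n \<psi> (\<psi> k) = \<phi> i" and i: "i \<in> {1..m}"
    then have "k = \<phi> i" using last_index_hit[OF sp(1)] by auto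
    then show "\<psi> k \<in> (\<lambda>i. \<psi> (\<phi> i)) ` {1..m}" using i by auto
  qed
qed

lemma Lambda_functor_Comp:
  assumes D: "category D" and \<psi>: "\<psi> \<in> Arr Delta_inj" and \<phi>: "\<phi> \<in> Arr Delta_inj"
    and dc: "Dom Delta_inj \<psi> = Cod Delta_inj \<phi>"
  shows "Lambda_functor D (Comp Delta_inj \<psi> \<phi>)
    = fcomp (Lambda D (Dom Delta_inj \<phi>)) (Lambda_functor D \<psi>) (Lambda_functor D \<phi>)"
proof -
  obtain m q n where p [simp]: "\<phi> = (m, q, n)" by (cases \<phi>)
  obtain n' r l where r [simp]: "\<psi> = (n', r, l)" by (cases \<psi>)
  have [simp]: "n' = n" using dc by (simp add: Delta_inj_def Delta_def)
  note \<phi>' = \<phi>[simplified] and \<psi>' = \<psi>[simplified]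
  note li = last_index_compose[OF \<psi>' \<phi>'] compose_image_iff[OF \<psi>' \<phi>', unfolded One_nat_def]
  have sp: "strict_mono_on {..n} r" using strict_mono_on_Delta_inj \<psi>' by auto
  note h = last_index_le[of n r] last_index_hit'(1)[OF sp, unfolded One_nat_def]
  have 1: "Lambda_obj D (m, compose {..m} r q, l) Y = Lambda_obj D (n, r, l) (Lambda_obj D (m, q, n) Y)"
    for Y
    by (simp add: Lambda_obj_def Let_def li restrict_def fun_eq_iff h)
  have 2: "Lambda_arr D (m, compose {..m} r q, l) f = Lambda_arr D (n, r, l) (Lambda_arr D (m, q, n) f)"
    for f
    by (simp add: Lambda_arr_def Let_def li restrict_def fun_eq_iff 1 h)
  define c where "c = compose {..m} r q"
  have 3: "Dom Delta (k, a, k') = k" "Comp Delta_inj \<psi> \<phi> = (m, compose {..m} r q, l)"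
    "Dom Delta_inj (k, a, k') = k" for a k k'
    by (simp_all add: Delta_inj_def Delta_def)
  show ?thesis
    using Lambda_obj_zigzags[OF D \<phi>'] Lambda_arr_zigzag_maps[OF D \<phi>']
    unfolding 3 c_def[symmetric]
    by (auto simp: Lambda_functor_def fcomp_def compose_def 3 Lambda_def restrict_def fun_eq_iff
      1[folded c_def] 2[folded c_def])
qed

lemma Delta_star_cases:
  assumes "J \<in> {Delta_inj, Delta_le}"
  shows "category J" "Arr J \<subseteq> Arr Delta_inj" "Obj J = UNIV" "Dom J = Dom Delta"
    "Cod J = Cod Delta" "Ide J = Ide Delta" "Comp J = Comp Delta"
proof -
  have J: "J = Delta_inj \<or> J = Delta_le" using assms by simp
  show "category J" "Arr J \<subseteq> Arr Delta_inj"
    using J category_Delta_inj category_Delta_le Delta_le_subset by (elim disjE; simp)+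
  show "Obj J = UNIV" "Dom J = Dom Delta" "Cod J = Cod Delta" "Ide J = Ide Delta"
    "Comp J = Comp Delta"
    using J by (elim disjE; simp add: Delta_inj_def Delta_le_def Delta_def)+
qed

lemma category_Lambda_star:
  assumes D: "category D" and J: "J \<in> {Delta_inj, Delta_le}"
  shows "category (Lambda_star J D)"
  unfolding Lambda_star_def
proof (rule category_grothendieck)
  have i: "Dom Delta_inj = Dom Delta" "Ide Delta_inj = Ide Delta" "Cod Delta_inj = Cod Delta" 
    "Comp Delta_inj = Comp Delta"
    by (auto simp: Delta_inj_def)
  note j = Delta_star_cases[OF J]
  show "category J" by (rule j)
  show "category (Lambda D n)" for n by (rule category_Lambda[OF D])
  show "is_functor (Lambda D (Dom J \<phi>)) (Lambda D (Cod J \<phi>)) (Lambda_functor D \<phi>)"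
    if "\<phi> \<in> Arr J" for \<phi>
    using is_functor_Lambda_functor[OF D, of \<phi>] that j by auto
  show "Lambda_functor D (Ide J n) = fident (Lambda D n)" for n
    using Lambda_functor_Ide[OF D, of n] j i by simp
  show "Lambda_functor D (Comp J \<psi> \<phi>) = fcomp (Lambda D (Dom J \<phi>)) (Lambda_functor D \<psi>) (Lambda_functor D \<phi>)"
    if "\<psi> \<in> Arr J" "\<phi> \<in> Arr J" "Dom J \<psi> = Cod J \<phi>" for \<psi> \<phi>
    using Lambda_functor_Comp[OF D, of \<psi> \<phi>] that j i by auto
qed

lemma is_functor_incl:
  assumes D: "category D" and J: "J \<in> {Delta_inj, Delta_le}"
  shows "is_functor D (Lambda_star J D) (incl J D)"
proof -
  interpret category D by fact
  note j = Delta_star_cases[OF J]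
  have z: "zigzag0 Y \<in> zigzags D 0" if "Y \<in> Obj D" for Y
    using that by (auto simp: zigzag0_def zigzags_def)
  have zm: "zigzag_map0 D f \<in> zigzag_maps D 0" if "f \<in> Arr D" for f
    using that z by (auto simp: zigzag_map0_def zigzag_maps_def Dom_Obj Cod_Obj)
      (auto simp: zigzag0_def)
  have id0: "Ide J 0 \<in> Arr J" "Dom J (Ide J 0) = 0" "Cod J (Ide J 0) = 0"
    using category.Ide_Arr[OF j(1)] category.Dom_Ide[OF j(1)] category.Cod_Ide[OF j(1)] j(3) by auto
  have comp0: "Comp J (Ide J 0) (Ide J 0) = Ide J 0"
    using category.Comp_Ide[OF j(1) id0(1)] id0 by simp
  have L0: "Lambda_functor D (Ide J 0) = fident (Lambda D 0)"
    using Lambda_functor_Ide[OF D, of 0] j by (simp add: Delta_inj_def)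
  have z1: "zz_dom (zigzag_map0 D f) = zigzag0 (Dom D f)" "zz_cod (zigzag_map0 D f) = zigzag0 (Cod D f)"
    for f by (auto simp: zigzag_map0_def)
  have i0: "Ide (Lambda D 0) (zigzag0 Y) = zigzag_map0 D (Ide D Y)" if "Y \<in> Obj D" for Y
    using that by (auto simp: Lambda_def zigzag0_def zigzag_map0_def Dom_Ide Cod_Ide restrict_def fun_eq_iff)
  have c0: "Comp (Lambda D 0) (zigzag_map0 D g) (zigzag_map0 D f) = zigzag_map0 D (Comp D g f)"
    if "g \<in> Arr D" "f \<in> Arr D" "Dom D g = Cod D f" for g f
    using that by (auto simp: Lambda_def zigzag_map0_def Dom_Comp Cod_Comp restrict_def fun_eq_iff)
  have sel: "Obj (Lambda D k) = zigzags D k" "Arr (Lambda D k) = zigzag_maps D k"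
    "Dom (Lambda D k) = zz_dom" "Cod (Lambda D k) = zz_cod" for k
    by (simp_all add: Lambda_def)
  show ?thesis
    by (auto simp: is_functor_def incl_def Lambda_star_def grothendieck_def Dom_Obj Cod_Obj
      Ide_Arr Dom_Ide Cod_Ide Comp_Arr Dom_Comp Cod_Comp z zm id0 comp0 L0 fident_def z1 i0 c0 sel j(3))
qed

lemma is_functor_proj0:
  assumes D: "category D" and J: "J \<in> {Delta_inj, Delta_le}"
  shows "is_functor (Lambda_star J D) D (proj0 J D)"
proof -
  note j = Delta_star_cases[OF J]
  interpret category "Lambda_star J D" by (rule category_Lambda_star[OF D J])
  have sel: "Obj (Lambda D k) = zigzags D k" "Arr (Lambda D k) = zigzag_maps D k"
    "Dom (Lambda D k) = zz_dom" "Cod (Lambda D k) = zz_cod" for k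
    by (simp_all add: Lambda_def)
  have o: "bar (obj_map (Lambda_functor D \<phi>) Y) 0 = bar Y 0"
    if "\<phi> \<in> Arr J" "Y \<in> zigzags D (Dom J \<phi>)" for \<phi> Y
  proof -
    obtain m p n where \<phi>: "\<phi> = (m, p, n)" by (cases \<phi>)
    then have "strict_mono_on {..m} p" using that j strict_mono_on_Delta_inj by auto
    then show ?thesis
      using that(2) last_index_zero by (auto simp: Lambda_functor_def Lambda_obj_def Let_def \<phi> sel j)
  qed
  have a: "bar_map (arr_map (Lambda_functor D \<phi>) f) 0 = bar_map f 0"
    if "\<phi> \<in> Arr J" "f \<in> zigzag_maps D (Dom J \<phi>)" for \<phi> f
  proof -
    obtain m p n where \<phi>: "\<phi> = (m, p, n)" by (cases \<phi>)
    then have "strict_mono_on {..m} p" using that j strict_mono_on_Delta_inj by auto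
    then show ?thesis
      using that(2) last_index_zero by (auto simp: Lambda_functor_def Lambda_arr_def Let_def \<phi> sel j)
  qed
  let ?L = "Lambda_star J D"
  have ide: "arr_map (proj0 J D) (Ide ?L X) = Ide D (obj_map (proj0 J D) X)" if X: "X \<in> Obj ?L" for X
    using Ide_Arr[OF X] X
    by (auto simp: proj0_def) (auto simp: Lambda_star_def grothendieck_def Lambda_def)
  have comp: "arr_map (proj0 J D) (Comp ?L g f) = Comp D (arr_map (proj0 J D) g) (arr_map (proj0 J D) f)"
    if gf: "g \<in> Arr ?L" "f \<in> Arr ?L" "Dom ?L g = Cod ?L f" for g f
    using Comp_Arr[OF gf] gf
    by (auto simp: proj0_def) (auto simp: Lambda_star_def grothendieck_def Lambda_def a)
  have arr: "arr_map (proj0 J D) f \<in> Arr D \<and> Dom D (arr_map (proj0 J D) f) = obj_map (proj0 J D) (Dom ?L f) \<and>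
     Cod D (arr_map (proj0 J D) f) = obj_map (proj0 J D) (Cod ?L f)" if f: "f \<in> Arr ?L" for f
    using Dom_Obj[OF f] Cod_Obj[OF f] f zigzag_mapsD(3)[where i = 0 and D = D] o
    by (auto simp: proj0_def) (auto simp: Lambda_star_def grothendieck_def sel)
  have obj: "obj_map (proj0 J D) X \<in> Obj D" if "X \<in> Obj ?L" for X
    using that zigzagsD(1)[where i = 0 and D = D]
    by (auto simp: proj0_def) (auto simp: Lambda_star_def grothendieck_def sel)
  have ext: "obj_map (proj0 J D) \<in> extensional (Obj ?L)" "arr_map (proj0 J D) \<in> extensional (Arr ?L)"
    by (auto simp: proj0_def)
  show ?thesis
    unfolding is_functor_def PiE_iff using obj arr ide comp ext by blast
qed

lemma simplex_push_standard_simplex: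
  assumes \<theta>: "(m, \<theta>, n) \<in> Arr Delta" and t: "t \<in> standard_simplex m"
  shows "simplex_push (m, \<theta>, n) t \<in> standard_simplex n"
proof -
  have r: "\<theta> i \<le> n" if "i \<le> m" for i
    using \<theta> that by (auto simp: Delta_def PiE_iff)
  have pos: "0 \<le> t i" and one: "(\<Sum>i\<le>m. t i) = 1" for i
    using t by (auto simp: standard_simplex_def)
  have le: "(\<Sum>i\<in>{i. i \<le> m \<and> \<theta> i = j}. t i) \<le> (\<Sum>i\<le>m. t i)" for j
    using pos by (intro sum_mono2) auto
  have "(\<Sum>j\<le>n. \<Sum>i\<in>{i \<in> {..m}. \<theta> i = j}. t i) = (\<Sum>i\<le>m. t i)"
    using r by (intro sum.group) auto
  moreover have "(\<Sum>i\<in>{i. i \<le> m \<and> \<theta> i = j}. t i) = 0" if "n < j" for j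
    using r that by (intro sum.neutral) (auto simp: not_le[symmetric])
  ultimately show ?thesis
    using le one by (auto simp: standard_simplex_def simplex_push_def pos sum_nonneg)
qed

lemma gluing_subset:
  assumes "simplicial_set X"
  shows "gluing X \<subseteq> topspace (presentation X) \<times> topspace (presentation X)"
  using simplicial_set.action_closed[OF assms] simplex_push_standard_simplex
  by (force simp: gluing_def topspace_presentation Delta_def)

end

theory Submission
  imports Defs
begin

text \<open>
  The functor \<open>proj0\<close> is a strict left inverse of \<open>incl\<close>, so all that is at stake is a homotopy on
  \<open>B(\<Lambda>\<^sub>\<star> D)\<close> from \<open>incl \<circ> proj0\<close> to the identity: every zig-zag has to be shrunk to its entry in
  position \<open>0\<close>.

  A zig-zag with \<open>n\<close> steps is a diagram over the poset \<open>0 < 1 > 2 < 3 > \<dots> > 2n - 1 < 2n\<close> of its entries, and it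
  can be cut at each of these positions \<open>z\<close>: all later entries are replaced by the entry in position \<open>z\<close>.
  Cutting at \<open>2n\<close> changes nothing, cutting at \<open>0\<close> leaves a constant zig-zag, and the cuts at
  comparable positions are related by a map. However, \<open>n\<close> is unbounded, and padding moves positions by
  amounts that depend on the padding map. Therefore the cuts do not fit into a finite chain of natural
  transformations; in general, a cut at an intermediate position is not even natural in the zig-zag.

  The homotopy is instead defined point by point, by cutting at a moving position.
  Regard a point with barycentric coordinates \<open>t\<close> in a simplex of the nerve as a unit of mass, of which the
  share \<open>t\<^sub>k\<close> sits at the vertex \<open>k\<close>, a zig-zag with \<open>n\<^sub>k\<close> steps. Each step of the last zig-zag is already present in the
  zig-zags from some vertex on; let it take twice the mass of these vertices. A clock running up to
  \<open>2 \<Sum> t\<^sub>k n\<^sub>k\<close> then meets all steps one after the other. During the first half of a step,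
  the cut advances to its middle entry, for one particle of mass after the other, starting
  with the mass at the last vertex; during the second half, it advances to the next barred entry, starting with the first
  vertex at which the step is present. With these opposite orders, the occupied pairs of a vertex and a
  position always form a chain (\<open>schedule_comparable\<close>), so that they span a simplex; and a
  step that is absent from a face takes no time there, which is why the motions on different simplices agree
  (\<open>schedule_push\<close>). This works for any category over \<open>\<Delta>\<^sub>i\<^sub>n\<^sub>j\<close>, and results in a homotopy
  between the two extreme cuts, regarded as functors to a universal category of cut positions
  (\<open>homotopic_bottom_top_cut\<close>).

  Applied to the functor that cuts zig-zags, it connects the identity with \<open>([n], Y) \<mapsto> ([n], const)\<close>.
  For \<open>\<star> = \<le>\<close>, the arrow \<open>[0] \<rightarrow> [n]\<close> relates \<open>([0], Y\<^sub>0)\<close> naturally to \<open>([n], const)\<close>. For \<open>\<star> = inj\<close>, no arrow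
  \<open>[0] \<rightarrow> [n]\<close> is natural, but \<open>[0] \<rightarrow> [n + 1] \<leftarrow> [n]\<close> is, where a new first element is adjoined. Such a zig-zag of
  functors is itself a family of cuts of length one, so the same theorem turns it into a homotopy.
\<close>

section \<open>Points of a realization\<close>

abbreviation simplex_space :: "nat \<Rightarrow> (nat \<Rightarrow> real) topology" where
  "simplex_space n \<equiv> subtopology (powertop_real UNIV) (standard_simplex n)"

definition point :: "'s sset \<Rightarrow> nat \<times> 's \<times> (nat \<Rightarrow> real) \<Rightarrow> (nat \<times> 's \<times> (nat \<Rightarrow> real)) set" where
  "point X x = gluing_equiv X `` {x}"

lemma quotient_map_point: "quotient_map (presentation X) (realization X) (point X)"
  using quotient_map_quotient_topology[of "presentation X" "gluing_equiv X"]
  by (simp add: realization_def point_def[abs_def])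

lemma continuous_map_barycentric:
  "continuous_map (presentation X) (powertop_real UNIV) (\<lambda>x. snd (snd x))"
  unfolding continuous_map
proof (intro conjI allI impI)
  fix U :: "(nat \<Rightarrow> real) set" assume U: "openin (powertop_real UNIV) U"
  have "openin (prod_topology (discrete_topology (simplices X n)) (simplex_space n))
      {y. (n, y) \<in> {x \<in> topspace (presentation X). snd (snd x) \<in> U}}" for n
  proof -
    have "{y. (n, y) \<in> {x \<in> topspace (presentation X). snd (snd x) \<in> U}}
        = simplices X n \<times> (standard_simplex n \<inter> U)"
      by (auto simp: topspace_presentation)
    then show ?thesis
      using U by (simp add: openin_prod_Times_iff openin_subtopology_Int2)
  qed
  then show "openin (presentation X) {x \<in> topspace (presentation X). snd (snd x) \<in> U}"
    unfolding presentation_def by (subst openin_sum_topology) auto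
qed auto

text \<open>The cells \<open>{n} \<times> {s} \<times> \<Delta>\<^sup>n\<close> form a cover by disjoint open sets, so continuity can be
  tested on each of them.\<close>

lemma continuous_map_presentation_prodI:
  assumes "\<And>n s. s \<in> simplices X n \<Longrightarrow>
    continuous_map (prod_topology (simplex_space n) T) Z (\<lambda>(t, u). F ((n, s, t), u))"
  shows "continuous_map (prod_topology (presentation X) T) Z F"
proof (rule pasting_lemma[where I = "{(n, s). s \<in> simplices X n}" and f = "\<lambda>_. F" and
      T = "\<lambda>(n, s). ({n} \<times> {s} \<times> standard_simplex n) \<times> topspace T"])
  fix i :: "nat \<times> 'a" assume i: "i \<in> {(n, s). s \<in> simplices X n}"
  obtain n s where [simp]: "i = (n, s)" by (cases i)
  have s: "s \<in> simplices X n" using i by simp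
  let ?S = "({n} \<times> {s} \<times> standard_simplex n) \<times> topspace T"
  have "openin (presentation X) ({n} \<times> {s} \<times> standard_simplex n)"
    unfolding presentation_def openin_sum_topology
  proof (intro conjI ballI)
    fix m :: nat
    have "{x. (m, x) \<in> {n} \<times> {s} \<times> standard_simplex n}
        = (if m = n then {s} \<times> standard_simplex n else {})" by auto
    moreover have "openin (simplex_space n) (standard_simplex n)"
      by (metis openin_topspace topspace_standard_simplex)
    ultimately show "openin (prod_topology (discrete_topology (simplices X m)) (simplex_space m))
         {x. (m, x) \<in> {n} \<times> {s} \<times> standard_simplex n}"
      using s by (simp add: openin_prod_Times_iff)
  qed (use s in auto)
  then show "openin (prod_topology (presentation X) T) (case i of (n, s) \<Rightarrow> ({n} \<times> {s} \<times> standard_simplex n) \<times> topspace T)"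
    by (simp add: openin_prod_Times_iff)
  let ?q = "\<lambda>x :: (nat \<times> 'a \<times> (nat \<Rightarrow> real)) \<times> 'b. (snd (snd (fst x)), snd x)"
  have "continuous_map (subtopology (prod_topology (presentation X) T) ?S) (powertop_real UNIV)
      ((\<lambda>x. snd (snd x)) \<circ> fst)"
    by (rule continuous_map_compose[OF continuous_map_from_subtopology[OF continuous_map_fst]
        continuous_map_barycentric])
  then have "continuous_map (subtopology (prod_topology (presentation X) T) ?S) (simplex_space n)
      (\<lambda>x. snd (snd (fst x)))"
    by (auto simp: continuous_map_in_subtopology o_def)
  then have q: "continuous_map (subtopology (prod_topology (presentation X) T) ?S)
      (prod_topology (simplex_space n) T) ?q"
    by (intro continuous_map_pairedI) (auto intro: continuous_map_from_subtopology continuous_map_snd)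
  have "continuous_map (subtopology (prod_topology (presentation X) T) ?S) Z
      ((\<lambda>(t, u). F ((n, s, t), u)) \<circ> ?q)"
    using continuous_map_compose[OF q assms[OF s]] .
  then have "continuous_map (subtopology (prod_topology (presentation X) T) ?S) Z F"
    by (rule continuous_map_eq) auto
  then show "continuous_map (subtopology (prod_topology (presentation X) T)
      (case i of (n, s) \<Rightarrow> ({n} \<times> {s} \<times> standard_simplex n) \<times> topspace T)) Z F"
    by simp
qed (auto simp: topspace_presentation)

lemma point_eq_iff:
  assumes "x \<in> topspace (presentation X)" "y \<in> topspace (presentation X)"
  shows "point X x = point X y \<longleftrightarrow> (x, y) \<in> (gluing X \<union> (gluing X)\<inverse>)\<^sup>*"
  unfolding point_def using eq_equiv_class_iff[OF equiv_gluing_equiv assms] assms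
  by (auto simp: gluing_equiv_def)

lemma point_gluing:
  assumes "simplicial_set X" "(m, \<theta>, n) \<in> Arr Delta" "s \<in> simplices X n" "t \<in> standard_simplex m"
  shows "point X (m, action X (m, \<theta>, n) s, t) = point X (n, s, simplex_push (m, \<theta>, n) t)"
proof -
  have g: "((m, action X (m, \<theta>, n) s, t), (n, s, simplex_push (m, \<theta>, n) t)) \<in> gluing X"
    using assms by (auto simp: gluing_def)
  then show ?thesis
    using gluing_subset[OF assms(1)] by (subst point_eq_iff) blast+
qed

lemma gluing_invariant:
  assumes X: "simplicial_set X"
    and F: "\<And>m \<theta> n s t. (m, \<theta>, n) \<in> Arr Delta \<Longrightarrow> s \<in> simplices X n \<Longrightarrow> t \<in> standard_simplex m \<Longrightarrow>
      F (m, action X (m, \<theta>, n) s, t) = F (n, s, simplex_push (m, \<theta>, n) t)"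
    and xy: "x \<in> topspace (presentation X)" "y \<in> topspace (presentation X)" "point X x = point X y"
  shows "F x = F y"
proof -
  have "(x, y) \<in> (gluing X \<union> (gluing X)\<inverse>)\<^sup>*" using xy by (simp add: point_eq_iff)
  then show ?thesis
  proof induction
    case (step y z)
    then show ?case using F by (auto simp: gluing_def)
  qed simp
qed

text \<open>Since the parameter space is locally compact Hausdorff, its product with the quotient map onto
  the realization is again a quotient map, so a family of maps may be constructed simplex by simplex.\<close>

lemma realization_prod_map_exists:
  assumes X: "simplicial_set X"
    and T: "locally_compact_space T" "Hausdorff_space T"
    and cont: "\<And>n s. s \<in> simplices X n \<Longrightarrow>
      continuous_map (prod_topology (simplex_space n) T) Z (\<lambda>(t, u). F u (n, s, t))"
    and F: "\<And>u m \<theta> n s t. u \<in> topspace T \<Longrightarrow> (m, \<theta>, n) \<in> Arr Delta \<Longrightarrow> s \<in> simplices X n \<Longrightarrow>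
      t \<in> standard_simplex m \<Longrightarrow>
      F u (m, action X (m, \<theta>, n) s, t) = F u (n, s, simplex_push (m, \<theta>, n) t)"
  obtains h where "continuous_map (prod_topology (realization X) T) Z h"
    "\<And>x u. x \<in> topspace (presentation X) \<Longrightarrow> u \<in> topspace T \<Longrightarrow> h (point X x, u) = F u x"
proof -
  have q: "quotient_map (prod_topology (presentation X) T) (prod_topology (realization X) T)
      (\<lambda>(x, u). (point X x, u))"
    using T quotient_map_point by (intro quotient_map_prod_left) auto
  have c: "continuous_map (prod_topology (presentation X) T) Z (\<lambda>(x, u). F u x)"
    using cont by (intro continuous_map_presentation_prodI) simp
  have inv: "(case a of (x, u) \<Rightarrow> F u x) = (case b of (x, u) \<Rightarrow> F u x)"
    if "a \<in> topspace (prod_topology (presentation X) T)" "b \<in> topspace (prod_topology (presentation X) T)"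
      "(case a of (x, u) \<Rightarrow> (point X x, u)) = (case b of (x, u) \<Rightarrow> (point X x, u))" for a b
  proof -
    obtain x u y v where [simp]: "a = (x, u)" "b = (y, v)" by (cases a, cases b)
    have "F u x = F u y"
    proof (rule gluing_invariant[OF X, of "F u"])
      show "F u (m, action X (m, \<theta>, n) s, t) = F u (n, s, simplex_push (m, \<theta>, n) t)"
        if "(m, \<theta>, n) \<in> Arr Delta" "s \<in> simplices X n" "t \<in> standard_simplex m" for m \<theta> n s t
        using F[OF _ that, of u] \<open>a \<in> _\<close> by simp
    qed (use that in simp_all)
    then show ?thesis using that(3) by simp
  qed
  show thesis
  proof (rule quotient_map_lift_exists[OF q c])
    fix h assume h: "continuous_map (prod_topology (realization X) T) Z h"
      and eq: "\<And>a. a \<in> topspace (prod_topology (presentation X) T) \<Longrightarrow>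
        h (case a of (x, u) \<Rightarrow> (point X x, u)) = (case a of (x, u) \<Rightarrow> F u x)"
    have "h (point X x, u) = F u x" if "x \<in> topspace (presentation X)" "u \<in> topspace T" for x u
      using eq[of "(x, u)"] that by simp
    then show thesis using that[OF h] by blast
  qed (use inv in blast)+
qed

lemma continuous_map_point:
  assumes "s \<in> simplices X n"
  shows "continuous_map (simplex_space n) (realization X) (\<lambda>t. point X (n, s, t))"
proof -
  have "continuous_map (simplex_space n) (presentation X) (\<lambda>t. (n, s, t))"
    unfolding continuous_map
  proof (intro conjI allI impI)
    fix U assume "openin (presentation X) U"
    then have "openin (prod_topology (discrete_topology (simplices X n)) (simplex_space n)) {x. (n, x) \<in> U}"
      unfolding presentation_def openin_sum_topology by blast
    moreover have "continuous_map (simplex_space n)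
        (prod_topology (discrete_topology (simplices X n)) (simplex_space n)) (\<lambda>t. (s, t))"
      using assms by (intro continuous_map_pairedI) auto
    ultimately show "openin (simplex_space n) {t \<in> topspace (simplex_space n). (n, s, t) \<in> U}"
      unfolding continuous_map by auto
  qed (use assms in \<open>auto simp: topspace_presentation\<close>)
  from continuous_map_compose[OF this quotient_imp_continuous_map[OF quotient_map_point]]
  show ?thesis by (simp add: o_def)
qed

definition simplicial_map :: "'r sset \<Rightarrow> 's sset \<Rightarrow> (nat \<Rightarrow> 'r \<Rightarrow> 's) \<Rightarrow> bool" where
  "simplicial_map X Y f \<longleftrightarrow> (\<forall>n. \<forall>s\<in>simplices X n. f n s \<in> simplices Y n) \<and>
     (\<forall>m \<theta> n. (m, \<theta>, n) \<in> Arr Delta \<longrightarrow> (\<forall>s\<in>simplices X n.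
        f m (action X (m, \<theta>, n) s) = action Y (m, \<theta>, n) (f n s)))"

text \<open>Glued points have glued images. Hence all members of a class have images in one and the same class, and
  the union in \<open>realization_map_def\<close> is that class.\<close>

lemma realization_map_point:
  assumes X: "simplicial_set X" and Y: "simplicial_set Y" and f: "simplicial_map X Y f"
    and x: "s \<in> simplices X n" "t \<in> standard_simplex n"
  shows "realization_map Y f (point X (n, s, t)) = point Y (n, f n s, t)"
proof -
  let ?g = "\<lambda>(n, s, t). (n, f n s, t)"
  let ?F = "\<lambda>x. point Y (?g x)"
  have inv: "?F x = ?F y" if "x \<in> topspace (presentation X)" "y \<in> topspace (presentation X)"
    "point X x = point X y" for x y
  proof (rule gluing_invariant[OF X _ that])
    fix m \<theta> n s t assume a: "(m, \<theta>, n) \<in> Arr Delta" "s \<in> simplices X n" "t \<in> standard_simplex m"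
    have "point Y (m, action Y (m, \<theta>, n) (f n s), t) = point Y (n, f n s, simplex_push (m, \<theta>, n) t)"
      using a f by (intro point_gluing[OF Y]) (auto simp: simplicial_map_def)
    then show "?F (m, action X (m, \<theta>, n) s, t) = ?F (n, s, simplex_push (m, \<theta>, n) t)"
      using a f by (simp add: simplicial_map_def)
  qed
  have X0: "(n, s, t) \<in> topspace (presentation X)" using x by (simp add: topspace_presentation)
  have mem: "y \<in> point X (n, s, t) \<longleftrightarrow> y \<in> topspace (presentation X) \<and> point X (n, s, t) = point X y" for y
  proof -
    have "y \<in> point X (n, s, t) \<longleftrightarrow>
        y \<in> topspace (presentation X) \<and> ((n, s, t), y) \<in> (gluing X \<union> (gluing X)\<inverse>)\<^sup>*"
      using X0 by (auto simp: point_def gluing_equiv_def)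
    then show ?thesis using point_eq_iff[OF X0, of y] by blast
  qed
  have "realization_map Y f (point X (n, s, t)) = (\<Union>y\<in>point X (n, s, t). ?F y)"
  proof -
    have "gluing_equiv Y `` (?g ` c) = (\<Union>y\<in>c. gluing_equiv Y `` {?g y})" for c by blast
    then show ?thesis by (simp add: realization_map_def point_def)
  qed
  also have "\<dots> = ?F (n, s, t)"
  proof -
    have "?F y = ?F (n, s, t)" if "y \<in> point X (n, s, t)" for y
      using that inv[OF X0, of y] mem by simp
    moreover have "(n, s, t) \<in> point X (n, s, t)" using mem X0 by simp
    ultimately show ?thesis by blast
  qed
  finally show ?thesis by simp
qed

lemma topspace_realization: "topspace (realization X) = point X ` topspace (presentation X)"
  using quotient_imp_surjective_map[OF quotient_map_point] by metis

lemma continuous_map_realization_map: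
  assumes X: "simplicial_set X" and Y: "simplicial_set Y" and f: "simplicial_map X Y f"
  shows "continuous_map (realization X) (realization Y) (realization_map Y f)"
proof -
  have "continuous_map (prod_topology (presentation X) (discrete_topology {()})) (realization Y)
      (\<lambda>a. realization_map Y f (point X (fst a)))"
  proof (rule continuous_map_presentation_prodI)
    fix n s assume s: "s \<in> simplices X n"
    then have "continuous_map (simplex_space n) (realization Y) (\<lambda>t. point Y (n, f n s, t))"
      using f by (intro continuous_map_point) (auto simp: simplicial_map_def)
    then have "continuous_map (prod_topology (simplex_space n) (discrete_topology {()})) (realization Y)
        ((\<lambda>t. point Y (n, f n s, t)) \<circ> fst)"
      by (intro continuous_map_compose[OF continuous_map_fst])
    then show "continuous_map (prod_topology (simplex_space n) (discrete_topology {()})) (realization Y)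
        (\<lambda>(t, u). realization_map Y f (point X (fst ((n, s, t), u))))"
      by (rule continuous_map_eq) (auto simp: realization_map_point[OF X Y f s] topspace_standard_simplex)
  qed
  note c = this
  have d: "continuous_map (presentation X) (prod_topology (presentation X) (discrete_topology {()}))
      (\<lambda>x. (x, ()))"
    by (intro continuous_map_pairedI) auto
  have "continuous_map (presentation X) (realization Y) (realization_map Y f \<circ> point X)"
    using continuous_map_compose[OF d c] by (simp add: o_def)
  then show ?thesis
    using continuous_compose_quotient_map_eq[OF quotient_map_point] by metis
qed


section \<open>Classifying maps\<close>

lemma functorD:
  assumes "is_functor C D F"
  shows "X \<in> Obj C \<Longrightarrow> obj_map F X \<in> Obj D" "f \<in> Arr C \<Longrightarrow> arr_map F f \<in> Arr D"
    "f \<in> Arr C \<Longrightarrow> Dom D (arr_map F f) = obj_map F (Dom C f)"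
    "f \<in> Arr C \<Longrightarrow> Cod D (arr_map F f) = obj_map F (Cod C f)"
    "X \<in> Obj C \<Longrightarrow> arr_map F (Ide C X) = Ide D (obj_map F X)"
    "g \<in> Arr C \<Longrightarrow> f \<in> Arr C \<Longrightarrow> Dom C g = Cod C f \<Longrightarrow>
      arr_map F (Comp C g f) = Comp D (arr_map F g) (arr_map F f)"
    "obj_map F \<in> extensional (Obj C)" "arr_map F \<in> extensional (Arr C)"
  using assms by (auto simp: is_functor_def PiE_iff)

lemma functor_eqI:
  assumes "is_functor C D F" "is_functor C D G"
    "\<And>X. X \<in> Obj C \<Longrightarrow> obj_map F X = obj_map G X" "\<And>f. f \<in> Arr C \<Longrightarrow> arr_map F f = arr_map G f"
  shows "F = G"
proof -
  have "obj_map F = obj_map G"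
    by (rule extensionalityI[OF functorD(7)[OF assms(1)] functorD(7)[OF assms(2)] assms(3)])
  moreover have "arr_map F = arr_map G"
    by (rule extensionalityI[OF functorD(8)[OF assms(1)] functorD(8)[OF assms(2)] assms(4)])
  ultimately show ?thesis by (cases F, cases G) simp
qed

lemma nerve_simps: "simplices (nerve C) n = {\<sigma>. is_functor (ordinal n) C \<sigma>}"
  "action (nerve C) (m, \<theta>, n) \<sigma> = fcomp (ordinal m) \<sigma> (ordinal_functor (m, \<theta>, n))"
  by (simp_all add: nerve_def Delta_def)

lemma fcomp_apply:
  "X \<in> Obj C \<Longrightarrow> obj_map (fcomp C G F) X = obj_map G (obj_map F X)"
  "f \<in> Arr C \<Longrightarrow> arr_map (fcomp C G F) f = arr_map G (arr_map F f)"
  by (simp_all add: fcomp_def compose_def)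

lemma fcomp_assoc:
  assumes C: "category C" and F: "is_functor C C' F" and G: "is_functor C' C'' G" and H: "is_functor C'' C''' H"
    and C': "category C'"
  shows "fcomp C H (fcomp C G F) = fcomp C (fcomp C' H G) F"
  by (rule functor_eqI[of C C'''])
    (use functorD(1,2)[OF F] in \<open>auto simp: fcomp_apply intro!: is_functor_fcomp C C' F G H
      is_functor_fcomp[OF C is_functor_fcomp[OF C F G] H] is_functor_fcomp[OF C F is_functor_fcomp[OF C' G H]]\<close>)

lemma fcomp_fident:
  assumes "category C" "is_functor C D F"
  shows "fcomp C (fident D) F = F"
  using assms functorD[OF assms(2)]
  by (auto simp: fcomp_def fident_def compose_def extensional_def fun_eq_iff restrict_def
      intro!: ftor.equality)

lemma is_functor_action:
  assumes "(m, \<theta>, n) \<in> Arr Delta"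
  shows "is_functor (ordinal m) (ordinal n) (ordinal_functor (m, \<theta>, n))"
  using is_functor_ordinal_functor[OF assms] by (simp add: Delta_def)

lemma simplicial_map_nerve_map:
  assumes "is_functor C D F"
  shows "simplicial_map (nerve C) (nerve D) (nerve_map F)"
  unfolding simplicial_map_def nerve_simps nerve_map_def
  using is_functor_fcomp[OF category_ordinal _ assms]
    fcomp_assoc[OF category_ordinal is_functor_action _ assms category_ordinal] by auto

lemma classifying_map_point:
  assumes "is_functor C D F" "is_functor (ordinal n) C \<sigma>" "t \<in> standard_simplex n"
  shows "classifying_map D F (point (nerve C) (n, \<sigma>, t)) = point (nerve D) (n, fcomp (ordinal n) F \<sigma>, t)"
  using realization_map_point[OF simplicial_set_nerve simplicial_set_nerve
      simplicial_map_nerve_map[OF assms(1)], of \<sigma> n t] assms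
  by (simp add: classifying_map_def nerve_simps nerve_map_def)

lemma continuous_map_classifying_map:
  assumes "is_functor C D F"
  shows "continuous_map (classifying_space C) (classifying_space D) (classifying_map D F)"
  unfolding classifying_space_def classifying_map_def
  by (intro continuous_map_realization_map simplicial_set_nerve simplicial_map_nerve_map assms)

lemma classifying_space_cases:
  assumes "x \<in> topspace (classifying_space C)"
  obtains n \<sigma> t where "is_functor (ordinal n) C \<sigma>" "t \<in> standard_simplex n" "x = point (nerve C) (n, \<sigma>, t)"
  using assms by (auto simp: classifying_space_def topspace_realization topspace_presentation nerve_simps)

lemma classifying_map_fcomp:
  assumes C: "category C" and F: "is_functor C D F" and D: "category D" and G: "is_functor D E G"
    and x: "x \<in> topspace (classifying_space C)"
  shows "classifying_map E (fcomp C G F) x = classifying_map E G (classifying_map D F x)"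
  using x
proof (cases rule: classifying_space_cases)
  case (1 n \<sigma> t)
  then show ?thesis
    using is_functor_fcomp[OF C F G] is_functor_fcomp[OF category_ordinal 1(1) F] F G
    by (simp add: classifying_map_point fcomp_assoc[OF category_ordinal 1(1) F G C])
qed

lemma classifying_map_fident:
  assumes C: "category C" and x: "x \<in> topspace (classifying_space C)"
  shows "classifying_map C (fident C) x = x"
  using x
proof (cases rule: classifying_space_cases)
  case (1 n \<sigma> t)
  have "is_functor C C (fident C)"
    using category.Ide_Arr[OF C] category.Comp_Arr[OF C] category.Dom_Obj[OF C] category.Cod_Obj[OF C]
    by (auto simp: is_functor_def fident_def)
  then show ?thesis
    using 1 by (simp add: classifying_map_point fcomp_fident[OF category_ordinal])
qed


section \<open>Weights on a finite poset\<close>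

definition poset_cat :: "'a set \<Rightarrow> ('a \<times> 'a) set \<Rightarrow> ('a, 'a \<times> 'a) cat" where
  "poset_cat Q R = \<lparr>Obj = Q, Arr = R, Dom = fst, Cod = snd, Ide = (\<lambda>x. (x, x)),
     Comp = (\<lambda>(y, z) (x, y'). (x, z))\<rparr>"

lemma poset_cat_simps [simp]:
  "Obj (poset_cat Q R) = Q" "Arr (poset_cat Q R) = R" "Dom (poset_cat Q R) = fst"
  "Cod (poset_cat Q R) = snd" "Ide (poset_cat Q R) = (\<lambda>x. (x, x))"
  "Comp (poset_cat Q R) (y, z) (x, y') = (x, z)"
  by (simp_all add: poset_cat_def)

lemma ordinal_simps [simp]:
  "Obj (ordinal n) = {..n}" "Arr (ordinal n) = {(i, j). i \<le> j \<and> j \<le> n}" "Dom (ordinal n) = fst"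
  "Cod (ordinal n) = snd" "Ide (ordinal n) = (\<lambda>i. (i, i))" "Comp (ordinal n) (j, k) (i, j') = (i, k)"
  by (simp_all add: ordinal_def)

definition vertex_simplex :: "nat \<Rightarrow> (nat \<Rightarrow> 'a) \<Rightarrow> ('a, 'a \<times> 'a) nerve_simplex" where
  "vertex_simplex n e = \<lparr>obj_map = (\<lambda>i\<in>{..n}. e i), arr_map = (\<lambda>(i, j)\<in>Arr (ordinal n). (e i, e j))\<rparr>"

text \<open>The weights on a set that arise when the coordinate \<open>t i\<close> is placed on the element \<open>e i\<close>.
  The formula is that of \<open>simplex_push\<close>, without the restriction to maps of ordinals.\<close>

definition push_weights :: "nat \<Rightarrow> (nat \<Rightarrow> 'a) \<Rightarrow> (nat \<Rightarrow> real) \<Rightarrow> 'a \<Rightarrow> real" where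
  "push_weights n e t q = (\<Sum>i\<in>{i. i \<le> n \<and> e i = q}. t i)"

text \<open>A point of the classifying space of a poset is determined by the weights that its
  barycentric coordinates place on the elements; these are supported on a chain. Conversely, weights on a
  finite poset whose support is a chain define a point, namely in the simplex spanned by the support.
  Working with weights makes the gluing relation invisible: a continuous family of weights is a continuous
  family of points, even where the support changes.\<close>

locale finite_poset =
  fixes Q :: "'a set" and R :: "('a \<times> 'a) set"
  assumes finite: "finite Q" and field: "R \<subseteq> Q \<times> Q"
    and refl: "x \<in> Q \<Longrightarrow> (x, x) \<in> R"
    and trans: "(x, y) \<in> R \<Longrightarrow> (y, z) \<in> R \<Longrightarrow> (x, z) \<in> R"
    and antisym: "(x, y) \<in> R \<Longrightarrow> (y, x) \<in> R \<Longrightarrow> x = y"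
begin

abbreviation "N \<equiv> nerve (poset_cat Q R)"

definition ascending :: "nat \<Rightarrow> (nat \<Rightarrow> 'a) \<Rightarrow> bool" where
  "ascending n e \<longleftrightarrow> (\<forall>i j. i \<le> j \<longrightarrow> j \<le> n \<longrightarrow> (e i, e j) \<in> R)"

definition chain :: "'a set \<Rightarrow> bool" where
  "chain S \<longleftrightarrow> S \<subseteq> Q \<and> S \<noteq> {} \<and> (\<forall>x\<in>S. \<forall>y\<in>S. (x, y) \<in> R \<or> (y, x) \<in> R)"

text \<open>In a chain, this is the position of an element, counted from \<open>0\<close>.\<close>

definition rank :: "'a set \<Rightarrow> 'a \<Rightarrow> nat" where
  "rank S q = card {x \<in> S. (x, q) \<in> R \<and> x \<noteq> q}"

definition enum :: "'a set \<Rightarrow> nat \<Rightarrow> 'a" where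
  "enum S = inv_into S (rank S)"

definition chain_point where
  "chain_point S w = point N (card S - 1, vertex_simplex (card S - 1) (enum S),
     \<lambda>k. if k < card S then w (enum S k) else 0)"

definition weights :: "('a \<Rightarrow> real) set" where
  "weights = {w. (\<forall>q. 0 \<le> w q) \<and> (\<forall>q. w q \<noteq> 0 \<longrightarrow> q \<in> Q) \<and> sum w Q = 1 \<and>
     (\<forall>x y. w x \<noteq> 0 \<longrightarrow> w y \<noteq> 0 \<longrightarrow> (x, y) \<in> R \<or> (y, x) \<in> R)}"

definition weight_point where
  "weight_point w = chain_point {q. w q \<noteq> 0} w"

lemma is_functor_vertex_simplex:
  assumes "ascending n e"
  shows "is_functor (ordinal n) (poset_cat Q R) (vertex_simplex n e)"
  using assms field by (auto simp: is_functor_def vertex_simplex_def ascending_def)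

lemma chain_finite: "chain S \<Longrightarrow> finite S"
  using finite by (auto simp: chain_def intro: finite_subset)

lemma rank_less:
  assumes S: "chain S" and x: "x \<in> S" "y \<in> S" "(x, y) \<in> R" "x \<noteq> y"
  shows "rank S x < rank S y"
proof -
  have "{z \<in> S. (z, x) \<in> R \<and> z \<noteq> x} \<subset> {z \<in> S. (z, y) \<in> R \<and> z \<noteq> y}"
    using x trans antisym by blast
  then show ?thesis
    unfolding rank_def using chain_finite[OF S] by (intro psubset_card_mono) auto
qed

lemma rank_mono:
  assumes S: "chain S" and x: "x \<in> S" "y \<in> S"
  shows "rank S x \<le> rank S y \<longleftrightarrow> (x, y) \<in> R"
proof (cases "x = y")
  case True
  then show ?thesis using S x refl by (auto simp: chain_def)
next
  case False
  have "(x, y) \<in> R \<or> (y, x) \<in> R" using S x by (auto simp: chain_def)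
  then show ?thesis
    using rank_less[OF S x] rank_less[OF S x(2) x(1)] False antisym by fastforce
qed

lemma bij_betw_rank:
  assumes S: "chain S"
  shows "bij_betw (rank S) S {..<card S}"
proof -
  have inj: "inj_on (rank S) S"
    using rank_mono[OF S] antisym by (auto simp: inj_on_def) (metis order_refl)
  have "rank S ` S \<subseteq> {..<card S}"
  proof clarsimp
    fix x assume "x \<in> S"
    then have "{z \<in> S. (z, x) \<in> R \<and> z \<noteq> x} \<subset> S" by auto
    then show "rank S x < card S"
      unfolding rank_def using chain_finite[OF S] by (intro psubset_card_mono) auto
  qed
  moreover have "card (rank S ` S) = card {..<card S}" using card_image[OF inj] by simp
  ultimately have "rank S ` S = {..<card S}" by (intro card_subset_eq) auto
  with inj show ?thesis by (simp add: bij_betw_def)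
qed

lemma enum_rank: "chain S \<Longrightarrow> x \<in> S \<Longrightarrow> enum S (rank S x) = x"
  unfolding enum_def using bij_betw_rank by (auto simp: bij_betw_def)

lemma enum_in: "chain S \<Longrightarrow> k < card S \<Longrightarrow> enum S k \<in> S"
  unfolding enum_def using bij_betw_rank by (metis bij_betw_def inv_into_into lessThan_iff)

lemma rank_enum: "chain S \<Longrightarrow> k < card S \<Longrightarrow> rank S (enum S k) = k"
  unfolding enum_def using bij_betw_rank by (metis bij_betw_inv_into_right lessThan_iff)

lemma rank_lt_card: "chain S \<Longrightarrow> x \<in> S \<Longrightarrow> rank S x < card S"
  using bij_betw_rank[of S] by (auto simp: bij_betw_def)

lemma card_chain: "chain S \<Longrightarrow> 0 < card S"
  using chain_finite[of S] by (auto simp: chain_def card_gt_0_iff)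

lemma ascending_enum: "chain S \<Longrightarrow> ascending (card S - 1) (enum S)"
  unfolding ascending_def
proof (intro allI impI)
  fix i j :: nat assume S: "chain S" and ij: "i \<le> j" "j \<le> card S - 1"
  then have "i < card S" "j < card S" using card_chain[OF S] by auto
  then show "(enum S i, enum S j) \<in> R"
    using rank_mono[OF S enum_in[OF S, of i] enum_in[OF S, of j]] rank_enum[OF S] ij by simp
qed

lemma ascending_in: "ascending n e \<Longrightarrow> i \<le> n \<Longrightarrow> e i \<in> Q"
  using field by (auto simp: ascending_def)

text \<open>The ranks of the vertices form a map of ordinals through which the simplex factors, so that
  the gluing relation identifies its points with points of the simplex spanned by \<open>S\<close>. Both degenerate
  simplices and faces are covered.\<close>

lemma point_vertex_simplex:
  assumes S: "chain S" and e: "ascending n e" "e ` {..n} \<subseteq> S" and t: "t \<in> standard_simplex n"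
  shows "point N (n, vertex_simplex n e, t) = chain_point S (push_weights n e t)"
proof -
  let ?c = "card S - 1"
  define \<theta> where "\<theta> = (\<lambda>i\<in>{..n}. rank S (e i))"
  have eS: "e i \<in> S" if "i \<le> n" for i using e that by auto
  have lt: "rank S (e i) < card S" if "i \<le> n" for i using rank_lt_card[OF S eS[OF that]] .
  have \<theta>: "(n, \<theta>, ?c) \<in> Arr Delta"
    using e(1) rank_mono[OF S eS eS] lt
    by (force simp: Delta_def \<theta>_def mono_on_def ascending_def)
  have 1: "vertex_simplex n e = action N (n, \<theta>, ?c) (vertex_simplex ?c (enum S))"
  proof (rule functor_eqI[of "ordinal n" "poset_cat Q R"])
    show "is_functor (ordinal n) (poset_cat Q R) (action N (n, \<theta>, ?c) (vertex_simplex ?c (enum S)))"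
      unfolding nerve_simps
      by (intro is_functor_fcomp[OF category_ordinal is_functor_action[OF \<theta>]] is_functor_vertex_simplex
          ascending_enum S)
    have "\<theta> i \<le> ?c" "enum S (\<theta> i) = e i" if "i \<le> n" for i
      using lt[OF that] enum_rank[OF S eS[OF that]] that by (auto simp: \<theta>_def)
    moreover have "\<theta> i \<le> \<theta> j" if "i \<le> j" "j \<le> n" for i j
      using \<theta> that by (auto simp: Delta_def mono_on_def)
    ultimately have
      "\<forall>X\<in>Obj (ordinal n). obj_map (vertex_simplex n e) X =
        obj_map (action N (n, \<theta>, ?c) (vertex_simplex ?c (enum S))) X"
      "\<forall>f\<in>Arr (ordinal n). arr_map (vertex_simplex n e) f =
        arr_map (action N (n, \<theta>, ?c) (vertex_simplex ?c (enum S))) f"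
      by (auto simp: nerve_simps fcomp_apply ordinal_functor_def vertex_simplex_def)
    then show
      "\<And>X. X \<in> Obj (ordinal n) \<Longrightarrow> obj_map (vertex_simplex n e) X =
        obj_map (action N (n, \<theta>, ?c) (vertex_simplex ?c (enum S))) X"
      "\<And>f. f \<in> Arr (ordinal n) \<Longrightarrow> arr_map (vertex_simplex n e) f =
        arr_map (action N (n, \<theta>, ?c) (vertex_simplex ?c (enum S))) f"
      by blast+
  qed (rule is_functor_vertex_simplex[OF e(1)])
  have 2: "simplex_push (n, \<theta>, ?c) t = (\<lambda>k. if k < card S then push_weights n e t (enum S k) else 0)"
  proof
    fix k
    have "{i. i \<le> n \<and> \<theta> i = k} = (if k < card S then {i. i \<le> n \<and> e i = enum S k} else {})"
      using lt enum_rank[OF S eS] rank_enum[OF S] by (auto simp: \<theta>_def)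
    then show "simplex_push (n, \<theta>, ?c) t k = (if k < card S then push_weights n e t (enum S k) else 0)"
      by (simp add: simplex_push_def push_weights_def)
  qed
  show ?thesis
    unfolding 1 chain_point_def 2[symmetric]
    using is_functor_vertex_simplex[OF ascending_enum[OF S]]
    by (intro point_gluing simplicial_set_nerve \<theta> t) (simp add: nerve_simps)
qed

lemma weights_simplex:
  assumes w: "w \<in> weights" and S: "chain S" "\<And>q. w q \<noteq> 0 \<Longrightarrow> q \<in> S"
  shows "(\<lambda>k. if k < card S then w (enum S k) else 0) \<in> standard_simplex (card S - 1)"
    and "push_weights (card S - 1) (enum S) (\<lambda>k. if k < card S then w (enum S k) else 0) = w"
proof -
  have le: "k \<le> card S - 1 \<longleftrightarrow> k < card S" for k using card_chain[OF S(1)] by auto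
  have fin: "finite S" by (rule chain_finite[OF S(1)])
  have pos: "0 \<le> w q" for q using w by (simp add: weights_def)
  have "(\<Sum>k<card S. w (enum S k)) = sum w S"
    using bij_betw_inv_into[OF bij_betw_rank[OF S(1)]] unfolding enum_def
    by (rule sum.reindex_bij_betw)
  also have "\<dots> = sum w Q"
    using S finite by (intro sum.mono_neutral_left) (auto simp: chain_def)
  finally have sum1: "(\<Sum>k<card S. w (enum S k)) = 1" using w by (simp add: weights_def)
  have "w q \<le> 1" for q
  proof (cases "q \<in> Q")
    case True
    then have "w q \<le> sum w Q" using pos finite by (intro member_le_sum) auto
    then show ?thesis using w by (simp add: weights_def)
  next
    case False
    then have "w q = 0" using w by (auto simp: weights_def)
    then show ?thesis by simp
  qed
  moreover have "{..card S - 1} = {..<card S}" using le by auto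
  then have "(\<Sum>k\<le>card S - 1. if k < card S then w (enum S k) else 0) = 1"
    using sum1 by simp
  moreover have "\<not> k < card S" if "card S - 1 < k" for k using that by linarith
  ultimately show "(\<lambda>k. if k < card S then w (enum S k) else 0) \<in> standard_simplex (card S - 1)"
    using pos by (simp add: standard_simplex_def)
  show "push_weights (card S - 1) (enum S) (\<lambda>k. if k < card S then w (enum S k) else 0) = w"
  proof
    fix q
    show "push_weights (card S - 1) (enum S) (\<lambda>k. if k < card S then w (enum S k) else 0) q = w q"
    proof (cases "q \<in> S")
      case True
      then have "{i. i \<le> card S - 1 \<and> enum S i = q} = {rank S q}"
        using rank_lt_card[OF S(1)] enum_rank[OF S(1)] rank_enum[OF S(1)] by (auto simp: le[unfolded One_nat_def])
      then show ?thesis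
        using True enum_rank[OF S(1)] rank_lt_card[OF S(1)] by (simp add: push_weights_def)
    next
      case False
      then have "{i. i \<le> card S - 1 \<and> enum S i = q} = {}"
        using enum_in[OF S(1)] by (auto simp: le[unfolded One_nat_def])
      moreover have "w q = 0" using False S(2) by blast
      ultimately show ?thesis unfolding push_weights_def by (simp only: sum.empty)
    qed
  qed
qed

lemma chain_support: "w \<in> weights \<Longrightarrow> chain {q. w q \<noteq> 0}"
  by (auto simp: weights_def chain_def subset_iff) (metis sum.neutral zero_neq_one)

text \<open>Enlarging the support to a larger chain \<open>S\<close> only adds coordinates that vanish.\<close>

lemma weight_point_eq_chain_point:
  assumes w: "w \<in> weights" and S: "chain S" "\<And>q. w q \<noteq> 0 \<Longrightarrow> q \<in> S"
  shows "weight_point w = chain_point S w"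
proof -
  let ?T = "{q. w q \<noteq> 0}"
  note T = chain_support[OF w]
  have "enum ?T ` {..card ?T - 1} \<subseteq> S"
  proof clarify
    fix i assume "i \<le> card ?T - 1"
    then have "enum ?T i \<in> ?T" using card_chain[OF T] by (intro enum_in T) auto
    then show "enum ?T i \<in> S" using S(2) by blast
  qed
  from point_vertex_simplex[OF S(1) ascending_enum[OF T] this] weights_simplex[OF w T]
  show ?thesis by (simp add: weight_point_def chain_point_def[of ?T])
qed

lemma push_weights_in_weights:
  assumes e: "ascending n e" and t: "t \<in> standard_simplex n"
  shows "push_weights n e t \<in> weights"
proof -
  have pos: "0 \<le> t i" for i using t by (auto simp: standard_simplex_def)
  have ex: "\<exists>i\<le>n. e i = q" if "push_weights n e t q \<noteq> 0" for q
    using that by (rule contrapos_np) (auto simp: push_weights_def intro!: sum.neutral)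
  have "sum (push_weights n e t) Q = (\<Sum>i\<le>n. t i)"
    unfolding push_weights_def using sum.group[of "{..n}" Q e t] finite ascending_in[OF e] by auto
  then have "sum (push_weights n e t) Q = 1" using t by (simp add: standard_simplex_def)
  moreover have "q \<in> Q" if "push_weights n e t q \<noteq> 0" for q
    using ex[OF that] ascending_in[OF e] by auto
  moreover have "(x, y) \<in> R \<or> (y, x) \<in> R" if "push_weights n e t x \<noteq> 0" "push_weights n e t y \<noteq> 0" for x y
    using ex[OF that(1)] ex[OF that(2)] e unfolding ascending_def by (metis nle_le)
  ultimately show ?thesis
    using pos by (auto simp: weights_def push_weights_def sum_nonneg)
qed

text \<open>Every simplex that carries the given weights represents the same point. This is what makes
  \<open>weight_point\<close> compatible with maps of posets, because weights are simply pushed forward.\<close>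

lemma weight_point_push_weights:
  assumes e: "ascending n e" and t: "t \<in> standard_simplex n"
  shows "weight_point (push_weights n e t) = point N (n, vertex_simplex n e, t)"
proof -
  have S: "chain (e ` {..n})"
    using e ascending_in[OF e] by (auto simp: chain_def ascending_def) (metis nle_le)
  have "q \<in> e ` {..n}" if "push_weights n e t q \<noteq> 0" for q
    using that by (rule contrapos_np) (auto simp: push_weights_def intro!: sum.neutral)
  then show ?thesis
    using weight_point_eq_chain_point[OF push_weights_in_weights[OF e t] S]
      point_vertex_simplex[OF S e subset_refl t] by metis
qed

lemma weight_point_cases:
  assumes "w \<in> weights"
  obtains n e t where "ascending n e" "t \<in> standard_simplex n" "w = push_weights n e t"
    "weight_point w = point N (n, vertex_simplex n e, t)"
proof -
  note S = chain_support[OF assms]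
  let ?S = "{q. w q \<noteq> 0}"
  let ?t = "\<lambda>k. if k < card ?S then w (enum ?S k) else 0"
  have t: "?t \<in> standard_simplex (card ?S - 1)" "push_weights (card ?S - 1) (enum ?S) ?t = w"
    using weights_simplex[OF assms S] by blast+
  show thesis
    using that[OF ascending_enum[OF S] t(1) t(2)[symmetric]]
      weight_point_push_weights[OF ascending_enum[OF S] t(1)] t(2) by simp
qed

text \<open>The parameters for which the support lies in a fixed chain form a closed set. There, the point
  moves in a single simplex. Finitely many chains suffice.\<close>

lemma continuous_map_weight_point:
  assumes W: "\<And>x. x \<in> topspace T \<Longrightarrow> W x \<in> weights"
    and cont: "\<And>q. continuous_map T euclideanreal (\<lambda>x. W x q)"
  shows "continuous_map T (classifying_space (poset_cat Q R)) (\<lambda>x. weight_point (W x))"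
proof (rule pasting_lemma_closed[where I = "{S. chain S}" and f = "\<lambda>S x. chain_point S (W x)" and
      T = "\<lambda>S. {x \<in> topspace T. \<forall>q\<in>Q - S. W x q \<in> {0}}"])
  show "finite {S. chain S}"
    by (rule finite_subset[of _ "Pow Q"]) (auto simp: chain_def finite)
next
  fix S assume "S \<in> {S. chain S}"
  then have S: "chain S" by simp
  have "{x \<in> topspace T. \<forall>q\<in>Q - S. W x q \<in> {0}}
    = topspace T \<inter> (\<Inter>q\<in>Q - S. {x \<in> topspace T. W x q \<in> {0}})" by auto
  also have "closedin T \<dots>"
  proof (cases "Q - S = {}")
    case True
    show ?thesis unfolding True by simp
  next
    case False
    then show ?thesis
      by (intro closedin_Int closedin_topspace closedin_INT closedin_continuous_map_preimage[OF cont]) auto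
  qed
  finally show "closedin T {x \<in> topspace T. \<forall>q\<in>Q - S. W x q \<in> {0}}" .
  let ?T = "subtopology T {x \<in> topspace T. \<forall>q\<in>Q - S. W x q \<in> {0}}"
  let ?c = "\<lambda>x k. if k < card S then W x (enum S k) else 0"
  have "?c x \<in> standard_simplex (card S - 1)" if "x \<in> topspace ?T" for x
    using that W[of x] by (intro weights_simplex S) (auto simp: weights_def)
  moreover have "continuous_map ?T (powertop_real UNIV) ?c"
  proof (subst continuous_map_componentwise_UNIV, intro allI)
    fix k
    show "continuous_map ?T euclideanreal (\<lambda>x. ?c x k)"
      using continuous_map_from_subtopology[OF cont[of "enum S k"]] by (cases "k < card S") auto
  qed
  ultimately have c: "continuous_map ?T (simplex_space (card S - 1)) ?c"
    by (auto simp: continuous_map_in_subtopology)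
  have v: "vertex_simplex (card S - 1) (enum S) \<in> simplices N (card S - 1)"
    using is_functor_vertex_simplex[OF ascending_enum[OF S]] by (simp add: nerve_simps)
  show "continuous_map ?T (classifying_space (poset_cat Q R)) (\<lambda>x. chain_point S (W x))"
    unfolding classifying_space_def chain_point_def
    using continuous_map_compose[OF c continuous_map_point[OF v]] by (simp only: o_def)
next
  have eq: "chain_point S (W x) = weight_point (W x)"
    if "chain S" "x \<in> topspace T" "\<forall>q\<in>Q - S. W x q \<in> {0}" for S x
    using that W[of x] by (intro weight_point_eq_chain_point[symmetric]) (auto simp: weights_def)
  then show "chain_point S (W x) = chain_point S' (W x)" if "S \<in> {S. chain S}" "S' \<in> {S. chain S}"
    "x \<in> topspace T \<inter> {x \<in> topspace T. \<forall>q\<in>Q - S. W x q \<in> {0}}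
       \<inter> {x \<in> topspace T. \<forall>q\<in>Q - S'. W x q \<in> {0}}" for S S' x
    using eq[of S x] eq[of S' x] that by (metis (no_types, lifting) IntD1 IntD2 mem_Collect_eq)
  show "\<exists>S. S \<in> {S. chain S} \<and> x \<in> {x \<in> topspace T. \<forall>q\<in>Q - S. W x q \<in> {0}} \<and>
      weight_point (W x) = chain_point S (W x)" if x: "x \<in> topspace T" for x
  proof (intro exI conjI)
    show "{q. W x q \<noteq> 0} \<in> {S. chain S}" using chain_support[OF W[OF x]] by simp
    show "x \<in> {x' \<in> topspace T. \<forall>q\<in>Q - {q. W x q \<noteq> 0}. W x' q \<in> {0}}" using x by simp
  qed (simp add: weight_point_def)
qed

end


section \<open>The zig-zag order\<close>

text \<open>The poset \<open>0 < 1 > 2 < 3 > \<dots>\<close> of the entries of a zig-zag: the number \<open>2 * j\<close> stands for the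
  barred entry in position \<open>j\<close>, the number \<open>2 * j - 1\<close> for the unbarred one.\<close>

definition zigzag_le :: "nat \<Rightarrow> nat \<Rightarrow> bool" where
  "zigzag_le x y \<longleftrightarrow> x = y \<or> (even x \<and> (y = x + 1 \<or> x = y + 1))"

lemma zigzag_le_refl [simp]: "zigzag_le x x"
  by (simp add: zigzag_le_def)

lemma zigzag_le_trans: "zigzag_le x y \<Longrightarrow> zigzag_le y z \<Longrightarrow> zigzag_le x z"
  by (auto simp: zigzag_le_def)

lemma zigzag_le_antisym: "zigzag_le x y \<Longrightarrow> zigzag_le y x \<Longrightarrow> x = y"
  by (auto simp: zigzag_le_def)

text \<open>Middle entries are moved back to the barred entry at which their step begins.\<close>

definition round_down :: "nat \<Rightarrow> nat" where
  "round_down e = 2 * (e div 2)"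

lemma round_down_mono: "x \<le> y \<Longrightarrow> round_down x \<le> round_down y"
  by (simp add: round_down_def div_le_mono)

lemma round_down_cases: "(even e \<and> round_down e = e) \<or> (odd e \<and> e = Suc (round_down e) \<and> even (round_down e))"
  unfolding round_down_def by presburger

text \<open>Inserting steps into a zig-zag moves barred entries to barred entries and unbarred entries to unbarred
  entries. In the opposite direction, \<open>last_index m \<phi>\<close> collapses the inserted steps.\<close>

definition parity_embedding :: "nat \<Rightarrow> (nat \<Rightarrow> nat) \<Rightarrow> bool" where
  "parity_embedding m \<phi> \<longleftrightarrow> strict_mono_on {..m} \<phi> \<and> (\<forall>e\<le>m. even (\<phi> e) \<longleftrightarrow> even e)"

lemma le_last_index_iff:
  assumes "strict_mono_on {..m} \<phi>" "1 \<le> e" "e \<le> m"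
  shows "e \<le> last_index m \<phi> x \<longleftrightarrow> \<phi> e \<le> x"
proof
  assume "e \<le> last_index m \<phi> x"
  then have "\<phi> e \<le> \<phi> (last_index m \<phi> x)" "last_index m \<phi> x \<noteq> 0"
    using assms strict_mono_on_leD[OF assms(1), of e "last_index m \<phi> x"] last_index_le[of m \<phi> x] by auto
  then show "\<phi> e \<le> x" using last_index_cases[of m \<phi> x] by linarith
next
  assume "\<phi> e \<le> x"
  then show "e \<le> last_index m \<phi> x" using last_index_ge[OF assms(3)] by blast
qed

text \<open>Both sides count the positive arguments at which \<open>\<psi> \<circ> \<phi>\<close> does not exceed \<open>x\<close>.\<close>

lemma last_index_trans:
  assumes \<phi>: "strict_mono_on {..m} \<phi>" "\<And>e. e \<le> m \<Longrightarrow> \<phi> e \<le> n" and \<psi>: "strict_mono_on {..n} \<psi>"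
    and \<omega>: "\<And>e. e \<le> m \<Longrightarrow> \<omega> e = \<psi> (\<phi> e)"
  shows "last_index m \<phi> (last_index n \<psi> x) = last_index m \<omega> x"
proof -
  have sm: "strict_mono_on {..m} \<omega>"
    using \<phi> \<omega> strict_mono_onD[OF \<phi>(1)] strict_mono_onD[OF \<psi>] by (auto simp: strict_mono_on_def)
  have *: "e \<le> last_index m \<phi> (last_index n \<psi> x) \<longleftrightarrow> e \<le> last_index m \<omega> x" if e: "1 \<le> e" "e \<le> m" for e
  proof -
    have "1 \<le> \<phi> e" using strict_mono_onD[OF \<phi>(1), of 0 e] e by auto
    then show ?thesis
      using le_last_index_iff[OF \<phi>(1) e] le_last_index_iff[OF \<psi>, of "\<phi> e"] le_last_index_iff[OF sm e]
        \<phi>(2)[OF e(2)] \<omega>[OF e(2)] by simp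
  qed
  show ?thesis
    using *[of "last_index m \<phi> (last_index n \<psi> x)"] *[of "last_index m \<omega> x"] last_index_le[of m \<omega> x]
      last_index_le[of m \<phi> "last_index n \<psi> x"]
    by (cases "last_index m \<phi> (last_index n \<psi> x) = 0"; cases "last_index m \<omega> x = 0") auto
qed

text \<open>The value of \<open>last_index m \<phi>\<close> jumps only upon reaching a value of \<open>\<phi>\<close>, and
  then to an argument of the same parity.\<close>

lemma zigzag_le_last_index_aux:
  assumes \<phi>: "parity_embedding m \<phi>" and ab: "last_index m \<phi> x < last_index m \<phi> (Suc x)"
  shows "last_index m \<phi> (Suc x) = Suc (last_index m \<phi> x)"
    and "even (last_index m \<phi> x) \<longleftrightarrow> even x"
proof -
  let ?a = "last_index m \<phi> x" and ?b = "last_index m \<phi> (Suc x)"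
  have sm: "strict_mono_on {..m} \<phi>" using \<phi> by (simp add: parity_embedding_def)
  have b: "?b \<le> m" by (rule last_index_le)
  have hit: "\<phi> e = Suc x" if "?a < e" "e \<le> ?b" for e
    using le_last_index_iff[OF sm, of e x] le_last_index_iff[OF sm, of e "Suc x"] that b by simp
  show *: "?b = Suc ?a"
  proof (rule ccontr)
    assume "?b \<noteq> Suc ?a"
    then have "\<phi> (Suc ?a) = \<phi> ?b" "Suc ?a < ?b" using hit ab by auto
    then show False using strict_mono_onD[OF sm, of "Suc ?a" ?b] b by auto
  qed
  have "even (\<phi> ?b) \<longleftrightarrow> even ?b" using \<phi> b by (simp add: parity_embedding_def)
  then show "even ?a \<longleftrightarrow> even x" using hit[of ?b] ab * by simp
qed

text \<open>Adjacent positions are either collapsed to the same position or, by the previous lemma, keep their parities, and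
  then the even one of them remains below the other one.\<close>

lemma zigzag_le_last_index:
  assumes \<phi>: "parity_embedding m \<phi>" and xy: "zigzag_le x y"
  shows "zigzag_le (last_index m \<phi> x) (last_index m \<phi> y)"
proof -
  have *: "last_index m \<phi> z = last_index m \<phi> (Suc z) \<or> last_index m \<phi> (Suc z) = Suc (last_index m \<phi> z)
      \<and> (even (last_index m \<phi> z) \<longleftrightarrow> even z)" for z
    using zigzag_le_last_index_aux[OF \<phi>, of z] last_index_mono[of z "Suc z" m \<phi>] by fastforce
  show ?thesis
    using xy *[of x] *[of y] unfolding zigzag_le_def by auto
qed

lemma last_index_round_down:
  assumes \<phi>: "parity_embedding m \<phi>" and y: "y \<le> m"
  shows "last_index m \<phi> (round_down (\<phi> y)) = round_down y"
proof -
  have sm: "strict_mono_on {..m} \<phi>" and par: "even (\<phi> y) \<longleftrightarrow> even y"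
    using \<phi> y by (auto simp: parity_embedding_def)
  show ?thesis
  proof (cases "even y")
    case True
    then show ?thesis
      using last_index_hit[OF sm y] round_down_cases[of y] round_down_cases[of "\<phi> y"] par by auto
  next
    case False
    then have "1 \<le> y" "1 \<le> \<phi> y" using par by (auto intro: ccontr simp: not_less_eq_eq)
    then have "last_index m \<phi> (\<phi> y - 1) = y - 1"
      using last_index_pred[OF sm, of "\<phi> y"] last_index_hit[OF sm y] y by auto
    moreover have "round_down y = y - 1" "round_down (\<phi> y) = \<phi> y - 1"
      using False round_down_cases[of y] round_down_cases[of "\<phi> y"] par by auto
    ultimately show ?thesis by simp
  qed
qed


section \<open>The schedule at a single vertex\<close>

text \<open>At a vertex whose zig-zag has \<open>n div 2\<close> steps, the cut passes \<open>n\<close> events: event \<open>z\<close> is the arrival in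
  position \<open>z\<close>. A particle of mass is identified by the amount \<open>d\<close> of mass above it, and the time
  at which it undergoes event \<open>z\<close> is \<open>\<tau> z + d\<close> for odd \<open>z\<close>, and \<open>\<tau> z - d\<close> for even \<open>z\<close>. At time \<open>A\<close>, the
  mass in \<open>{lo..hi}\<close> that has undergone event \<open>z\<close> therefore has \<open>d < A - \<tau> z\<close> or \<open>d > \<tau> z - A\<close>, respectively, and
  its amount is the difference of the values of \<open>cutoff n A \<tau> z\<close> at \<open>hi\<close> and at \<open>lo\<close>. Event \<open>0\<close> has always happened, and
  event \<open>n + 1\<close> never happens.\<close>

definition cutoff :: "nat \<Rightarrow> real \<Rightarrow> (nat \<Rightarrow> real) \<Rightarrow> nat \<Rightarrow> real \<Rightarrow> real" where
  "cutoff n A \<tau> z x = (if z = 0 then x else if n < z then 0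
     else if odd z then min x (A - \<tau> z) else max x (\<tau> z - A))"

definition passed :: "real \<Rightarrow> (nat \<Rightarrow> real) \<Rightarrow> nat \<Rightarrow> real \<Rightarrow> bool" where
  "passed A \<tau> e d \<longleftrightarrow> (if odd e then d < A - \<tau> e else \<tau> e - A < d)"

definition reached_mass :: "nat \<Rightarrow> real \<Rightarrow> (nat \<Rightarrow> real) \<Rightarrow> real \<Rightarrow> real \<Rightarrow> nat \<Rightarrow> real" where
  "reached_mass n A \<tau> lo hi z = cutoff n A \<tau> z hi - cutoff n A \<tau> z lo"

definition state_mass :: "nat \<Rightarrow> real \<Rightarrow> (nat \<Rightarrow> real) \<Rightarrow> real \<Rightarrow> real \<Rightarrow> nat \<Rightarrow> real" where
  "state_mass n A \<tau> lo hi z = reached_mass n A \<tau> lo hi z - reached_mass n A \<tau> lo hi (Suc z)"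

text \<open>A vertex occupies the interval \<open>{lo..hi}\<close> of mass. The two events of a step, with numbers \<open>e\<close> and \<open>e + 1\<close> for odd \<open>e\<close>,
  need at least \<open>2 * hi\<close> units of time: \<open>hi\<close> units for reaching all the mass down to this vertex, and as many for the way back.
  Under this condition every particle undergoes its events in the right order.\<close>

locale vertex_schedule =
  fixes n :: nat and A :: real and \<tau> :: "nat \<Rightarrow> real" and lo hi :: real
  assumes even_n: "even n" and lo: "0 \<le> lo" and lohi: "lo \<le> hi"
    and odd_step: "\<And>e. odd e \<Longrightarrow> e < n \<Longrightarrow> \<tau> e + 2 * hi \<le> \<tau> (Suc e)"
    and even_step: "\<And>e. even e \<Longrightarrow> 1 \<le> e \<Longrightarrow> e < n \<Longrightarrow> \<tau> e \<le> \<tau> (Suc e)"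
begin

abbreviation "reached \<equiv> reached_mass n A \<tau> lo hi"
abbreviation "share \<equiv> state_mass n A \<tau> lo hi"

lemma reached_0: "reached 0 = hi - lo"
  by (simp add: reached_mass_def cutoff_def)

lemma reached_bounds: "0 \<le> reached z" "reached z \<le> hi - lo"
  using lohi by (auto simp: reached_mass_def cutoff_def min_def max_def)

lemma reached_Suc: "reached (Suc z) \<le> reached z"
proof (cases "z = 0 \<or> n \<le> z")
  case True
  moreover have "reached (Suc z) = 0" if "n \<le> z" using that by (simp add: reached_mass_def cutoff_def)
  ultimately show ?thesis using reached_0 reached_bounds(1)[of z] reached_bounds(2)[of "Suc z"] by auto
next
  case False
  show ?thesis
  proof (cases "odd z")
    case True
    then show ?thesis
      using False odd_step[of z] lo lohi
      by (simp add: reached_mass_def cutoff_def min_def max_def split: if_splits)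
  next
    case z: False
    then show ?thesis
      using False even_step[of z] lo lohi
      by (simp add: reached_mass_def cutoff_def min_def max_def split: if_splits)
  qed
qed

lemma share_nonneg: "0 \<le> share z"
  using reached_Suc[of z] by (simp add: state_mass_def)

lemma sum_share: "(\<Sum>z\<le>n. share z) = hi - lo"
proof -
  have "(\<Sum>z\<le>n. share z) = reached 0 - reached (Suc n)"
    unfolding state_mass_def by (rule sum_telescope)
  then show ?thesis by (simp add: reached_0) (simp add: reached_mass_def cutoff_def)
qed

lemma passed_pred:
  assumes d: "0 \<le> d" "d \<le> hi" and e: "1 \<le> e" "e < n" and p: "passed A \<tau> (Suc e) d"
  shows "passed A \<tau> e d"
  using odd_step[of e] even_step[of e] d e p by (cases "odd e") (auto simp: passed_def)

lemma passed_antimono: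
  assumes d: "0 \<le> d" "d \<le> hi" and e: "1 \<le> e" "e \<le> e'" "e' \<le> n" and p: "passed A \<tau> e' d"
  shows "passed A \<tau> e d"
  using e(2) e(3) p
proof (induction rule: dec_induct)
  case (step k)
  then show ?case using passed_pred[OF d, of k] e by simp
qed

text \<open>The mass that undergoes odd events is filled up from the top, where \<open>d\<close> is small, and the
  mass that undergoes even events from the bottom. If there is mass in state \<open>z\<close> at all, then the end of the interval at which the
  filling for event \<open>z\<close> starts is therefore in this state, since it is last to be reached by event \<open>z + 1\<close>, which
  has the opposite parity.\<close>

lemma share_pos_passed:
  assumes z: "share z \<noteq> 0" "z \<le> n" and e: "1 \<le> e" "e \<le> n"
  shows "passed A \<tau> e (if even z then hi else lo) \<longleftrightarrow> e \<le> z"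
proof -
  let ?d = "if even z then hi else lo"
  have pos: "reached z > reached (Suc z)" using z(1) share_nonneg[of z] by (simp add: state_mass_def)
  have 1: "passed A \<tau> z ?d" if "1 \<le> z"
    using pos reached_bounds(1)[of "Suc z"] that z(2) lohi
    by (auto simp: passed_def reached_mass_def cutoff_def min_def max_def split: if_splits)
  have 2: "\<not> passed A \<tau> (Suc z) ?d" if "Suc z \<le> n"
  proof
    assume "passed A \<tau> (Suc z) ?d"
    then have "reached (Suc z) = hi - lo"
      using that lohi by (auto simp: passed_def reached_mass_def cutoff_def min_def max_def split: if_splits)
    then show False using pos reached_bounds(2)[of z] by simp
  qed
  have d: "0 \<le> ?d" "?d \<le> hi" using lo lohi by auto
  show ?thesis
  proof
    assume "e \<le> z"
    then show "passed A \<tau> e ?d" using passed_antimono[OF d e(1) _ z(2)] 1 e by simp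
  next
    assume p: "passed A \<tau> e ?d"
    show "e \<le> z"
    proof (rule ccontr)
      assume "\<not> e \<le> z"
      then have "passed A \<tau> (Suc z) ?d" "Suc z \<le> n"
        using passed_antimono[OF d _ _ e(2) p, of "Suc z"] e by auto
      then show False using 2 by simp
    qed
  qed
qed

lemma reached_antimono: "z \<le> z' \<Longrightarrow> reached z' \<le> reached z"
  by (induction rule: dec_induct) (use reached_Suc in \<open>auto intro: order_trans\<close>)

lemma share_start:
  assumes "A \<le> \<tau> 1"
  shows "share z = (if z = 0 then hi - lo else 0)"
proof -
  have "reached 1 = 0"
    using assms lo lohi by (auto simp: reached_mass_def cutoff_def min_def)
  then have "reached z' = 0" if "1 \<le> z'" for z'
    using reached_antimono[OF that] reached_bounds(1)[of z'] by simp
  then show ?thesis by (auto simp: state_mass_def reached_0)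
qed

lemma share_end:
  assumes "n \<noteq> 0 \<Longrightarrow> \<tau> n \<le> A" and z: "z \<le> n"
  shows "share z = (if z = n then hi - lo else 0)"
proof -
  have "reached n = hi - lo"
    using assms lo lohi even_n by (auto simp: reached_mass_def cutoff_def max_def)
  then have "reached z' = hi - lo" if "z' \<le> n" for z'
    using reached_antimono[OF that] reached_bounds(2)[of z'] by simp
  moreover have "reached (Suc n) = 0" by (simp add: reached_mass_def cutoff_def)
  ultimately show ?thesis using z by (auto simp: state_mass_def)
qed

end

text \<open>Events happen in the order of their numbers, and their parities alternate. If only odd events may have happened for \<open>y\<close> alone,
  and only even events for \<open>z\<close> alone, there is at most one such event, and \<open>y\<close> is odd if there is one.\<close>

lemma zigzag_le_of_passed:
  assumes passed: "\<And>e. 1 \<le> e \<Longrightarrow> e \<le> m \<Longrightarrow> P e \<longleftrightarrow> e \<le> z" "\<And>e. 1 \<le> e \<Longrightarrow> e \<le> m \<Longrightarrow> P' e \<longleftrightarrow> e \<le> y"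
    and le: "z \<le> m" "y \<le> m"
    and odd: "\<And>e. 1 \<le> e \<Longrightarrow> e \<le> m \<Longrightarrow> odd e \<Longrightarrow> P e \<Longrightarrow> P' e"
    and even: "\<And>e. 1 \<le> e \<Longrightarrow> e \<le> m \<Longrightarrow> even e \<Longrightarrow> P' e \<Longrightarrow> P e"
  shows "zigzag_le z y"
proof -
  have o: "e \<le> y" if "e \<le> z" "odd e" for e
    using that odd[of e] passed[of e] le odd_pos[of e] by force
  have e: "e \<le> z" if "e \<le> y" "even e" for e
    using that even[of e] passed[of e] le by (cases "e = 0") auto
  show ?thesis
  proof (cases z y rule: linorder_cases)
    case less
    have "odd (Suc z)" using e[of "Suc z"] less by auto
    moreover have "y \<le> Suc z" using e[of "Suc (Suc z)"] less \<open>odd (Suc z)\<close> by (auto simp: not_less_eq_eq[symmetric])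
    ultimately show ?thesis using less by (auto simp: zigzag_le_def)
  next
    case greater
    have "even (Suc y)" using o[of "Suc y"] greater by auto
    moreover have "z \<le> Suc y" using o[of "Suc (Suc y)"] greater \<open>even (Suc y)\<close> by (auto simp: not_less_eq_eq[symmetric])
    ultimately have "z = Suc y" using greater by simp
    then show ?thesis using \<open>even (Suc y)\<close> by (simp add: zigzag_le_def)
  qed simp
qed


section \<open>The schedule on a simplex\<close>

definition mass_from :: "nat \<Rightarrow> (nat \<Rightarrow> real) \<Rightarrow> nat \<Rightarrow> real" where
  "mass_from p t i = (\<Sum>k\<in>{i..p}. t k)"

text \<open>The shape of a simplex of zig-zags: the zig-zag at the vertex \<open>i\<close> has the positions \<open>{..N i}\<close>,
  and \<open>\<Phi> i k\<close> tells where they are found in the zig-zag at the vertex \<open>k\<close>.\<close>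

locale levels =
  fixes p :: nat and N :: "nat \<Rightarrow> nat" and \<Phi> :: "nat \<Rightarrow> nat \<Rightarrow> nat \<Rightarrow> nat"
  assumes even_N: "i \<le> p \<Longrightarrow> even (N i)"
    and embedding: "i \<le> k \<Longrightarrow> k \<le> p \<Longrightarrow> parity_embedding (N i) (\<Phi> i k)"
    and bounded: "i \<le> k \<Longrightarrow> k \<le> p \<Longrightarrow> e \<le> N i \<Longrightarrow> \<Phi> i k e \<le> N k"
    and ident: "i \<le> p \<Longrightarrow> e \<le> N i \<Longrightarrow> \<Phi> i i e = e"
    and compos: "i \<le> k \<Longrightarrow> k \<le> l \<Longrightarrow> l \<le> p \<Longrightarrow> e \<le> N i \<Longrightarrow> \<Phi> k l (\<Phi> i k e) = \<Phi> i l e"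
begin

definition collapse :: "nat \<Rightarrow> nat \<Rightarrow> nat \<Rightarrow> nat" where
  "collapse i k = last_index (N i) (\<Phi> i k)"

text \<open>The number of events of the vertex \<open>k\<close> that belong to steps before event \<open>e\<close> of the vertex \<open>i\<close>. If \<open>e\<close> is
  even, hence the second event of its step, both events of this step are included, provided that the step is present at \<open>k\<close>. For \<open>k < i\<close>, the
  steps of \<open>k\<close> are found among those of \<open>i\<close> by collapsing the others.\<close>

definition preceding :: "nat \<Rightarrow> nat \<Rightarrow> nat \<Rightarrow> nat" where
  "preceding i k e = (if i \<le> k then round_down (\<Phi> i k e) else collapse k i (round_down e))"

text \<open>The total duration of all steps that precede event \<open>e\<close>, where a step takes
  twice the mass at which it is present.\<close>

definition arrival :: "(nat \<Rightarrow> real) \<Rightarrow> nat \<Rightarrow> nat \<Rightarrow> real" where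
  "arrival t i e = (\<Sum>k\<le>p. t k * real (preceding i k e))"

definition clock :: "(nat \<Rightarrow> real) \<Rightarrow> real \<Rightarrow> real" where
  "clock t s = s * (\<Sum>k\<le>p. t k * real (N k))"

definition places :: "(nat \<times> nat) set" where
  "places = {(i, z). i \<le> p \<and> z \<le> N i}"

text \<open>A map between the cut of the zig-zag at \<open>i\<close> in position \<open>z\<close> and the cut of the one at \<open>k\<close> in position \<open>y\<close> exists if
  \<open>z\<close> lies below the position that corresponds to \<open>y\<close>.\<close>

definition place_order :: "((nat \<times> nat) \<times> (nat \<times> nat)) set" where
  "place_order = {((i, z), (k, y)). i \<le> k \<and> k \<le> p \<and> z \<le> N i \<and> y \<le> N k \<and> zigzag_le z (collapse i k y)}"

text \<open>The mass above the vertex \<open>i\<close> is that of the vertices \<open>k > i\<close>; this is where the interval of mass that belongs to \<open>i\<close> begins.\<close>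

definition schedule :: "(nat \<Rightarrow> real) \<Rightarrow> real \<Rightarrow> nat \<times> nat \<Rightarrow> real" where
  "schedule t s = (\<lambda>(i, z). if (i, z) \<in> places
     then state_mass (N i) (clock t s) (arrival t i) (mass_from p t (Suc i)) (mass_from p t i) z
     else 0)"

lemma strict: "i \<le> k \<Longrightarrow> k \<le> p \<Longrightarrow> strict_mono_on {..N i} (\<Phi> i k)"
  and parity: "i \<le> k \<Longrightarrow> k \<le> p \<Longrightarrow> e \<le> N i \<Longrightarrow> even (\<Phi> i k e) \<longleftrightarrow> even e"
  using embedding by (auto simp: parity_embedding_def)

lemma collapse_le: "collapse i k y \<le> N i"
  unfolding collapse_def by (rule last_index_le)

lemma le_collapse_iff:
  "i \<le> k \<Longrightarrow> k \<le> p \<Longrightarrow> 1 \<le> e \<Longrightarrow> e \<le> N i \<Longrightarrow> e \<le> collapse i k y \<longleftrightarrow> \<Phi> i k e \<le> y"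
  unfolding collapse_def by (rule le_last_index_iff[OF strict])

lemma collapse_ident: "i \<le> p \<Longrightarrow> y \<le> N i \<Longrightarrow> collapse i i y = y"
  unfolding collapse_def by (rule last_index_eqI) (auto simp: ident)

lemma positive: "i \<le> k \<Longrightarrow> k \<le> p \<Longrightarrow> 1 \<le> e \<Longrightarrow> e \<le> N i \<Longrightarrow> 1 \<le> \<Phi> i k e"
  using strict_mono_onD[OF strict, of i k 0 e] by auto

lemma collapse_collapse:
  assumes "i \<le> k" "k \<le> l" "l \<le> p"
  shows "collapse i k (collapse k l y) = collapse i l y"
  unfolding collapse_def using assms strict bounded compos by (intro last_index_trans) auto

lemma collapse_mono: "y \<le> y' \<Longrightarrow> collapse i k y \<le> collapse i k y'"
  unfolding collapse_def by (rule last_index_mono)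

lemma collapse_round_down:
  "i \<le> k \<Longrightarrow> k \<le> p \<Longrightarrow> y \<le> N i \<Longrightarrow> collapse i k (round_down (\<Phi> i k y)) = round_down y"
  unfolding collapse_def by (rule last_index_round_down[OF embedding])

lemma finite_poset_places: "finite_poset places place_order"
proof
  have "places = Sigma {..p} (\<lambda>i. {..N i})" by (auto simp: places_def)
  then show "finite places" by simp
  show "place_order \<subseteq> places \<times> places" by (auto simp: places_def place_order_def)
  show "(x, x) \<in> place_order" if "x \<in> places" for x
    using that collapse_ident by (auto simp: places_def place_order_def)
  show "(x, z) \<in> place_order" if xy: "(x, y) \<in> place_order" and yz: "(y, z) \<in> place_order" for x y z
  proof -
    obtain i a j b k c where [simp]: "x = (i, a)" "y = (j, b)" "z = (k, c)" by (cases x, cases y, cases z)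
    have "zigzag_le (collapse i j b) (collapse i j (collapse j k c))"
      using xy yz zigzag_le_last_index[OF embedding, folded collapse_def] by (auto simp: place_order_def)
    moreover have "collapse i j (collapse j k c) = collapse i k c"
      using xy yz by (intro collapse_collapse) (auto simp: place_order_def)
    ultimately show ?thesis using xy yz zigzag_le_trans by (auto simp: place_order_def)
  qed
  show "x = y" if "(x, y) \<in> place_order" "(y, x) \<in> place_order" for x y
    using that collapse_ident zigzag_le_antisym unfolding place_order_def by auto
qed

lemma preceding_odd_step:
  assumes i: "i \<le> p" "k \<le> p" "odd e" "e < N i"
  shows "preceding i k e + (if i \<le> k then 2 else 0) \<le> preceding i k (Suc e)"
proof (cases "i \<le> k")
  case True
  have "\<Phi> i k e < \<Phi> i k (Suc e)" using strict_mono_onD[OF strict[OF True i(2)], of e "Suc e"] i by auto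
  moreover have "odd (\<Phi> i k e)" "even (\<Phi> i k (Suc e))" using parity[OF True i(2)] i by auto
  ultimately show ?thesis
    using True round_down_cases[of "\<Phi> i k e"] round_down_cases[of "\<Phi> i k (Suc e)"]
    by (auto simp: preceding_def)
qed (auto simp: preceding_def intro!: collapse_mono round_down_mono)

lemma preceding_even_step:
  assumes i: "i \<le> p" "k \<le> p" "even e" "e < N i"
  shows "preceding i k e \<le> preceding i k (Suc e)"
proof (cases "i \<le> k")
  case True
  have "\<Phi> i k e < \<Phi> i k (Suc e)" using strict_mono_onD[OF strict[OF True i(2)], of e "Suc e"] i by auto
  then show ?thesis using True by (auto simp: preceding_def intro: round_down_mono)
qed (auto simp: preceding_def intro!: collapse_mono round_down_mono)

lemma preceding_le:
  assumes i: "i \<le> p" "k \<le> p" "e \<le> N i"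
  shows "preceding i k e \<le> N k"
proof (cases "i \<le> k")
  case True
  then show ?thesis
    using bounded[OF True i(2,3)] round_down_cases[of "\<Phi> i k e"] by (auto simp: preceding_def)
qed (auto simp: preceding_def collapse_le)

text \<open>An event of \<open>i\<close> and the corresponding event of a later vertex belong to the same step.
  Hence all vertices that have a step agree on its time.\<close>

lemma preceding_invariant:
  assumes i: "i \<le> i'" "i' \<le> p" and k: "k \<le> p" and e: "e \<le> N i"
  shows "preceding i' k (\<Phi> i i' e) = preceding i k e"
proof -
  consider "i' \<le> k" | "i \<le> k" "k < i'" | "k < i" by linarith
  then show ?thesis
  proof cases
    case 1
    then show ?thesis using i k e compos[of i i' k e] by (simp add: preceding_def)
  next
    case 2
    have "collapse k i' (round_down (\<Phi> k i' (\<Phi> i k e))) = round_down (\<Phi> i k e)"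
      using 2 i k e bounded by (intro collapse_round_down) auto
    then show ?thesis using 2 i k e compos[of i k i' e] by (simp add: preceding_def)
  next
    case 3
    have "collapse k i (collapse i i' (round_down (\<Phi> i i' e))) = collapse k i (round_down e)"
      using i e by (simp add: collapse_round_down)
    then show ?thesis using 3 i k e collapse_collapse[of k i i'] by (simp add: preceding_def)
  qed
qed

lemma arrival_invariant:
  "i \<le> i' \<Longrightarrow> i' \<le> p \<Longrightarrow> e \<le> N i \<Longrightarrow> arrival t i' (\<Phi> i i' e) = arrival t i e"
  unfolding arrival_def using preceding_invariant by (intro sum.cong) auto

context
  fixes t assumes t: "t \<in> standard_simplex p"
begin

lemma t_nonneg: "0 \<le> t k"
  using t by (auto simp: standard_simplex_def)

lemma mass_from_nonneg: "0 \<le> mass_from p t i"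
  unfolding mass_from_def by (intro sum_nonneg t_nonneg)

lemma mass_from_antimono: "i \<le> k \<Longrightarrow> mass_from p t k \<le> mass_from p t i"
  unfolding mass_from_def using t_nonneg by (intro sum_mono2) auto

lemma mass_from_Suc: "i \<le> p \<Longrightarrow> mass_from p t i = t i + mass_from p t (Suc i)"
  unfolding mass_from_def by (simp add: sum.atLeast_Suc_atMost)

lemma arrival_mono:
  assumes "\<And>k. k \<le> p \<Longrightarrow> preceding i k e \<le> preceding i k e'"
  shows "arrival t i e \<le> arrival t i e'"
  unfolding arrival_def using assms t_nonneg by (intro sum_mono mult_left_mono) auto

lemma vertex_schedule:
  assumes i: "i \<le> p"
  shows "vertex_schedule (N i) (arrival t i) (mass_from p t (Suc i)) (mass_from p t i)"
proof
  show "even (N i)" using even_N[OF i] .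
  show "0 \<le> mass_from p t (Suc i)" by (rule mass_from_nonneg)
  show "mass_from p t (Suc i) \<le> mass_from p t i" by (rule mass_from_antimono) simp
  show "arrival t i e \<le> arrival t i (Suc e)" if "even e" "1 \<le> e" "e < N i" for e
    using preceding_even_step[OF i] that by (intro arrival_mono) auto
  show "arrival t i e + 2 * mass_from p t i \<le> arrival t i (Suc e)" if e: "odd e" "e < N i" for e
  proof -
    have "{i..p} = {k \<in> {..p}. i \<le> k}" by auto
    then have "2 * mass_from p t i = (\<Sum>k\<le>p. t k * real (if i \<le> k then 2 else 0))"
      unfolding mass_from_def by (simp add: sum.inter_filter[symmetric] sum_distrib_left if_distrib mult.commute cong: if_cong)
    then have "arrival t i e + 2 * mass_from p t i
        = (\<Sum>k\<le>p. t k * real (preceding i k e + (if i \<le> k then 2 else 0)))"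
      by (simp add: arrival_def sum.distrib distrib_left)
    also have "\<dots> \<le> arrival t i (Suc e)"
      unfolding arrival_def using preceding_odd_step[OF i _ e] t_nonneg
      by (intro sum_mono mult_left_mono) (auto simp del: of_nat_add)
    finally show ?thesis .
  qed
qed

lemma schedule_eq:
  "i \<le> p \<Longrightarrow> z \<le> N i \<Longrightarrow> schedule t s (i, z) =
    state_mass (N i) (clock t s) (arrival t i) (mass_from p t (Suc i)) (mass_from p t i) z"
  by (simp add: schedule_def places_def)

text \<open>Compare two particles of mass, the first one at a vertex not above that of the second one, so that it has the larger amount \<open>d\<close>
  of mass above it. An odd event happens later for larger \<open>d\<close>, an even event earlier. So the second particle can only be
  ahead by odd events, and the first one only by even events.\<close>

lemma schedule_comparable:
  assumes "schedule t s x \<noteq> 0" "schedule t s y \<noteq> 0"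
  shows "(x, y) \<in> place_order \<or> (y, x) \<in> place_order"
proof -
  \<comment> \<open>the mass above a particle that is in state \<open>z\<close> by \<open>share_pos_passed\<close>\<close>
  define d :: "nat \<times> nat \<Rightarrow> real" where "d = (\<lambda>(i, z). if even z then mass_from p t i else mass_from p t (Suc i))"
  have below: "((i, z), (k, y)) \<in> place_order"
    if nz: "schedule t s (i, z) \<noteq> 0" "schedule t s (k, y) \<noteq> 0" and ik: "i \<le> k"
      and dd: "d (k, y) \<le> d (i, z)" for i z k y
  proof -
    have b: "i \<le> p" "z \<le> N i" "k \<le> p" "y \<le> N k"
      using nz by (auto simp: schedule_def places_def split: if_splits)
    interpret I: vertex_schedule "N i" "clock t s" "arrival t i" "mass_from p t (Suc i)" "mass_from p t i"
      by (rule vertex_schedule[OF b(1)])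
    interpret K: vertex_schedule "N k" "clock t s" "arrival t k" "mass_from p t (Suc k)" "mass_from p t k"
      by (rule vertex_schedule[OF b(3)])
    have 1: "passed (clock t s) (arrival t i) e (d (i, z)) \<longleftrightarrow> e \<le> z" if "1 \<le> e" "e \<le> N i" for e
      using I.share_pos_passed[OF _ b(2) that] nz(1) b by (simp add: d_def schedule_eq)
    have 2: "passed (clock t s) (arrival t i) e (d (k, y)) \<longleftrightarrow> e \<le> collapse i k y"
      if "1 \<le> e" "e \<le> N i" for e
    proof -
      have "passed (clock t s) (arrival t k) (\<Phi> i k e) (d (k, y)) \<longleftrightarrow> \<Phi> i k e \<le> y"
        using K.share_pos_passed[OF _ b(4), of "\<Phi> i k e"] nz(2) b
          positive[OF ik b(3) that] bounded[OF ik b(3) that(2)] by (simp add: d_def schedule_eq)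
      then show ?thesis
        unfolding le_collapse_iff[OF ik b(3) that]
        by (simp only: passed_def arrival_invariant[OF ik b(3) that(2)] parity[OF ik b(3) that(2)])
    qed
    have "zigzag_le z (collapse i k y)"
      using dd by (intro zigzag_le_of_passed[OF 1 2 b(2) collapse_le]) (auto simp: passed_def)
    then show ?thesis using b ik by (simp add: place_order_def)
  qed
  obtain i z k y' where [simp]: "x = (i, z)" "y = (k, y')" by (cases x, cases y)
  have lt: "d (k', z'') \<le> d (i', z')" if "i' < k'" for i' k' z' z''
    using mass_from_antimono[of "Suc i'" k'] mass_from_antimono[of i' k'] mass_from_antimono[of "Suc i'" "Suc k'"]
      mass_from_antimono[of i' "Suc k'"] that by (auto simp: d_def)
  consider "i < k" | "k < i" | "i = k" "d (k, y') \<le> d (i, z)" | "i = k" "d (i, z) \<le> d (k, y')"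
    by linarith
  then show ?thesis
    using below[of i z k y'] below[of k y' i z] assms lt by cases auto
qed

lemma schedule_weights: "schedule t s \<in> finite_poset.weights places place_order"
proof -
  interpret finite_poset places place_order by (rule finite_poset_places)
  have "0 \<le> schedule t s x" for x
    using vertex_schedule.share_nonneg[OF vertex_schedule, of "fst x" "clock t s" "snd x"]
    by (cases x) (auto simp: schedule_def places_def)
  moreover have "sum (schedule t s) places = 1"
  proof -
    have P: "places = Sigma {..p} (\<lambda>i. {..N i})" by (auto simp: places_def)
    have "sum (schedule t s) places = (\<Sum>i\<le>p. \<Sum>z\<le>N i. schedule t s (i, z))"
      unfolding P by (subst sum.Sigma) auto
    also have "\<dots> = (\<Sum>i\<le>p. t i)"
      using vertex_schedule.sum_share[OF vertex_schedule] mass_from_Suc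
      by (intro sum.cong) (auto simp: schedule_eq)
    finally show ?thesis using t by (simp add: standard_simplex_def)
  qed
  moreover have "x \<in> places" if "schedule t s x \<noteq> 0" for x
    using that by (cases x) (auto simp: schedule_def split: if_splits)
  ultimately show ?thesis
    using schedule_comparable unfolding weights_def by blast
qed

text \<open>No step begins before time \<open>0\<close>, so all mass is in position \<open>0\<close>.\<close>

lemma schedule_start: "schedule t 0 = push_weights p (\<lambda>i. (i, 0)) t"
proof
  fix x :: "nat \<times> nat"
  obtain i z where [simp]: "x = (i, z)" by (cases x)
  have push: "push_weights p (\<lambda>i. (i, 0 :: nat)) t (i, z) = (if i \<le> p \<and> z = 0 then t i else 0)"
  proof -
    have "{k. k \<le> p \<and> (k, 0 :: nat) = (i, z)} = (if i \<le> p \<and> z = 0 then {i} else {})" by auto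
    then show ?thesis by (simp add: push_weights_def)
  qed
  show "schedule t 0 x = push_weights p (\<lambda>i. (i, 0)) t x"
  proof (cases "i \<le> p \<and> z \<le> N i")
    case True
    then interpret vertex_schedule "N i" "clock t 0" "arrival t i" "mass_from p t (Suc i)" "mass_from p t i"
      using vertex_schedule by simp
    have "clock t 0 \<le> arrival t i 1"
      unfolding clock_def arrival_def by (auto intro!: sum_nonneg mult_nonneg_nonneg t_nonneg)
    from share_start[OF this] show ?thesis
      using True mass_from_Suc[of i] by (simp add: schedule_eq push)
  qed (auto simp: schedule_def places_def push)
qed

text \<open>At time \<open>2 \<Sum> t\<^sub>k n\<^sub>k\<close>, all steps are over.\<close>

lemma schedule_end: "schedule t 1 = push_weights p (\<lambda>i. (i, N i)) t"
proof
  fix x :: "nat \<times> nat"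
  obtain i z where [simp]: "x = (i, z)" by (cases x)
  have push: "push_weights p (\<lambda>i. (i, N i)) t (i, z) = (if i \<le> p \<and> z = N i then t i else 0)"
  proof -
    have "{k. k \<le> p \<and> (k, N k) = (i, z)} = (if i \<le> p \<and> z = N i then {i} else {})" by auto
    then show ?thesis by (simp add: push_weights_def)
  qed
  show "schedule t 1 x = push_weights p (\<lambda>i. (i, N i)) t x"
  proof (cases "i \<le> p \<and> z \<le> N i")
    case True
    then interpret vertex_schedule "N i" "clock t 1" "arrival t i" "mass_from p t (Suc i)" "mass_from p t i"
      using vertex_schedule by simp
    have "arrival t i (N i) \<le> clock t 1"
      unfolding clock_def arrival_def using preceding_le True t_nonneg
      by (auto intro!: sum_mono mult_left_mono)
    from share_end[OF this, of z] show ?thesis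
      using True mass_from_Suc[of i] by (simp add: schedule_eq push)
  qed (auto simp: schedule_def places_def push)
qed

end

lemma continuous_map_schedule:
  "continuous_map (prod_topology (simplex_space p) (top_of_set {0..1})) euclideanreal
    (\<lambda>(t, s). schedule t s q)"
proof -
  let ?T = "prod_topology (simplex_space p) (top_of_set {0..1 :: real})"
  have t: "continuous_map ?T euclideanreal (\<lambda>x. fst x k)" for k
  proof -
    have "continuous_map (simplex_space p) euclideanreal (\<lambda>t. t k)"
      by (intro continuous_map_from_subtopology continuous_map_product_projection) simp
    from continuous_map_compose[OF continuous_map_fst this] show ?thesis by (simp add: o_def)
  qed
  have s: "continuous_map ?T euclideanreal (\<lambda>x. snd x)"
    using continuous_map_into_fulltopology[OF continuous_map_snd] by blast
  have m: "continuous_map ?T euclideanreal (\<lambda>x. mass_from p (fst x) i)" for i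
    unfolding mass_from_def by (intro continuous_map_sum t) auto
  have a: "continuous_map ?T euclideanreal (\<lambda>x. arrival (fst x) i e)" for i e
    unfolding arrival_def by (intro continuous_map_sum continuous_map_real_mult t continuous_map_const[THEN iffD2]) auto
  have c: "continuous_map ?T euclideanreal (\<lambda>x. clock (fst x) (snd x))"
    unfolding clock_def
    by (intro continuous_map_sum continuous_map_real_mult t s continuous_map_const[THEN iffD2]) auto
  have cut: "continuous_map ?T euclideanreal
      (\<lambda>x. cutoff n (clock (fst x) (snd x)) (arrival (fst x) i) z (mass_from p (fst x) k))" for n i z k
    unfolding cutoff_def
    by (cases "z = 0"; cases "n < z"; cases "odd z")
      (auto intro!: continuous_map_real_min continuous_map_real_max continuous_map_diff m a c)
  obtain i z where [simp]: "q = (i, z)" by (cases q)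
  show ?thesis
  proof (cases "(i, z) \<in> places")
    case True
    have "continuous_map ?T euclideanreal (\<lambda>x. state_mass (N i) (clock (fst x) (snd x))
        (arrival (fst x) i) (mass_from p (fst x) (Suc i)) (mass_from p (fst x) i) z)"
      unfolding state_mass_def reached_mass_def by (intro continuous_map_diff cut)
    then show ?thesis using True by (simp add: schedule_def split_def)
  next
    case False
    then show ?thesis by (simp add: schedule_def split_def)
  qed
qed

end


lemma sum_simplex_push:
  assumes \<theta>: "(m, \<theta>, p) \<in> Arr Delta"
  shows "(\<Sum>k\<le>p. simplex_push (m, \<theta>, p) t k * g k) = (\<Sum>k\<le>m. t k * g (\<theta> k))"
proof -
  have "(\<Sum>k\<le>p. simplex_push (m, \<theta>, p) t k * g k) = (\<Sum>k\<le>p. \<Sum>i\<in>{i \<in> {..m}. \<theta> i = k}. t i * g (\<theta> i))"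
    by (auto simp: simplex_push_def sum_distrib_right intro!: sum.cong)
  also have "\<dots> = (\<Sum>i\<le>m. t i * g (\<theta> i))"
    using \<theta> by (intro sum.group) (auto simp: Delta_def PiE_iff)
  finally show ?thesis .
qed

text \<open>The preimage of an initial segment under a monotone map is an initial segment.\<close>

lemma mono_threshold:
  assumes "mono_on {..m} \<theta>"
  obtains a :: nat where "a \<le> Suc m" "\<And>k. k \<le> m \<Longrightarrow> (\<theta> k < (j :: nat)) \<longleftrightarrow> k < a"
proof (cases "\<exists>k\<le>m. j \<le> \<theta> k")
  case True
  define a where "a = (LEAST k. k \<le> m \<and> j \<le> \<theta> k)"
  have a: "a \<le> m" "j \<le> \<theta> a" using LeastI_ex[OF True] by (auto simp: a_def)
  have "\<theta> k < j \<longleftrightarrow> k < a" if "k \<le> m" for k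
  proof
    show "k < a" if "\<theta> k < j"
    proof (rule ccontr)
      assume "\<not> k < a"
      then have "\<theta> a \<le> \<theta> k" using mono_onD[OF assms, of a k] a \<open>k \<le> m\<close> by simp
      then show False using a that by simp
    qed
    show "\<theta> k < j" if "k < a"
      using not_less_Least[of k "\<lambda>k. k \<le> m \<and> j \<le> \<theta> k"] that \<open>k \<le> m\<close> by (auto simp: a_def)
  qed
  then show thesis using that[of a] a by simp
next
  case False
  have "\<theta> k < j \<longleftrightarrow> k < Suc m" if "k \<le> m" for k
    using False that by (metis less_Suc_eq_le not_le)
  then show thesis by (rule that[OF order_refl])
qed

lemma mass_from_push:
  assumes \<theta>: "(m, \<theta>, p) \<in> Arr Delta" and a: "a \<le> Suc m" "\<And>k. k \<le> m \<Longrightarrow> \<theta> k < j \<longleftrightarrow> k < a"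
  shows "mass_from p (simplex_push (m, \<theta>, p) t) j = mass_from m t a"
proof -
  have *: "mass_from n u i = (\<Sum>k\<le>n. u k * (if i \<le> k then 1 else 0))" for n u i
  proof -
    have "{i..n} = {k \<in> {..n}. i \<le> k}" by auto
    then show ?thesis by (simp add: mass_from_def sum.inter_filter[symmetric] if_distrib cong: if_cong)
  qed
  have "(\<Sum>k\<le>m. t k * (if j \<le> \<theta> k then 1 else 0)) = (\<Sum>k\<le>m. t k * (if a \<le> k then 1 else 0))"
    using a(2) by (intro sum.cong) (auto simp: not_less[symmetric])
  then show ?thesis unfolding * sum_simplex_push[OF \<theta>] .
qed

text \<open>The times of all events are averages over the mass, so they can be computed on either side. The vertices \<open>i\<close> of the first simplex
  with \<open>\<theta> i = j\<close> occupy adjacent intervals of mass whose union is the interval of \<open>j\<close>, and the amounts of mass in position \<open>z\<close> in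
  these intervals add up as a telescoping sum.\<close>

lemma (in levels) schedule_push:
  assumes \<theta>: "(m, \<theta>, p) \<in> Arr Delta"
    and L': "levels m N' \<Phi>'"
    and N': "\<And>i. i \<le> m \<Longrightarrow> N' i = N (\<theta> i)"
    and \<Phi>': "\<And>i k. i \<le> k \<Longrightarrow> k \<le> m \<Longrightarrow> \<Phi>' i k = \<Phi> (\<theta> i) (\<theta> k)"
  shows "schedule (simplex_push (m, \<theta>, p) t) s (j, z)
    = (\<Sum>i\<in>{i. i \<le> m \<and> \<theta> i = j}. levels.schedule m N' \<Phi>' t s (i, z))"
proof -
  interpret L': levels m N' \<Phi>' by fact
  have mono: "\<theta> i \<le> \<theta> k" if "i \<le> k" "k \<le> m" for i k
    using \<theta> that by (auto simp: Delta_def mono_on_def)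
  have le: "\<theta> i \<le> p" if "i \<le> m" for i
    using \<theta> that by (auto simp: Delta_def PiE_iff)
  have clock: "clock (simplex_push (m, \<theta>, p) t) s = L'.clock t s"
    unfolding clock_def L'.clock_def sum_simplex_push[OF \<theta>] using N' by simp
  have prec: "L'.preceding i k e = preceding (\<theta> i) (\<theta> k) e" if "i \<le> m" "k \<le> m" "e \<le> N (\<theta> i)" for i k e
  proof (cases "i \<le> k")
    case True
    then show ?thesis using that mono[of i k] by (simp add: preceding_def L'.preceding_def \<Phi>')
  next
    case False
    then have "\<theta> k \<le> \<theta> i" using mono[of k i] that by simp
    then consider "\<theta> k < \<theta> i" | "\<theta> k = \<theta> i" by linarith
    then show ?thesis
    proof cases
      case 2
      have "round_down e \<le> N (\<theta> i)" using that(3) round_down_cases[of e] by auto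
      then show ?thesis
        using False that 2 le[of i]
        by (simp add: preceding_def L'.preceding_def collapse_def L'.collapse_def \<Phi>' N' ident
          collapse_ident[unfolded collapse_def])
    qed (use False that in \<open>simp add: preceding_def L'.preceding_def collapse_def L'.collapse_def \<Phi>' N'\<close>)
  qed
  have arr: "arrival (simplex_push (m, \<theta>, p) t) (\<theta> i) e = L'.arrival t i e"
    if "i \<le> m" "e \<le> N (\<theta> i)" for i e
    unfolding arrival_def L'.arrival_def sum_simplex_push[OF \<theta>] using prec that by simp
  show ?thesis
  proof (cases "j \<le> p \<and> z \<le> N j")
    case True
    have "mono_on {..m} \<theta>" using \<theta> by (simp add: Delta_def)
    from mono_threshold[OF this, of j] obtain a
      where a: "a \<le> Suc m" "\<And>k. k \<le> m \<Longrightarrow> \<theta> k < j \<longleftrightarrow> k < a" by blast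
    from mono_threshold[OF \<open>mono_on {..m} \<theta>\<close>, of "Suc j"] obtain b
      where b: "b \<le> Suc m" "\<And>k. k \<le> m \<Longrightarrow> \<theta> k < Suc j \<longleftrightarrow> k < b" by blast
    have fib: "{i. i \<le> m \<and> \<theta> i = j} = {a..<b}"
    proof -
      have "\<theta> i = j \<longleftrightarrow> a \<le> i \<and> i < b" if "i \<le> m" for i
        using a(2)[OF that] b(2)[OF that] by linarith
      then have "i \<in> {i. i \<le> m \<and> \<theta> i = j} \<longleftrightarrow> i \<in> {a..<b}" for i
        using b(1) by (cases "i \<le> m") auto
      then show ?thesis by blast
    qed
    have ab: "a \<le> b"
    proof (rule ccontr)
      assume "\<not> a \<le> b"
      then show False using a(1) b(2)[of b] a(2)[of b] by simp
    qed
    \<comment> \<open>the mass in position \<open>z\<close>, as the increment of a single function along the interval\<close>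
    define G where "G x = cutoff (N j) (clock (simplex_push (m, \<theta>, p) t) s) (arrival (simplex_push (m, \<theta>, p) t) j) z x
       - cutoff (N j) (clock (simplex_push (m, \<theta>, p) t) s) (arrival (simplex_push (m, \<theta>, p) t) j) (Suc z) x" for x
    have "L'.schedule t s (i, z) = G (mass_from m t i) - G (mass_from m t (Suc i))" if i: "i \<in> {a..<b}" for i
    proof -
      have "i \<in> {i. i \<le> m \<and> \<theta> i = j}" using i unfolding fib .
      then have im: "i \<le> m" "\<theta> i = j" by blast+
      have arr_j: "L'.arrival t i y = arrival (simplex_push (m, \<theta>, p) t) j y" if "y \<le> N j" for y
        using arr[OF im(1), of y] im(2) that by simp
      have cut: "cutoff (N j) A (L'.arrival t i) y x = cutoff (N j) A (arrival (simplex_push (m, \<theta>, p) t) j) y x"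
        for A y x
        by (simp add: cutoff_def arr_j)
      have "L'.schedule t s (i, z) =
          state_mass (N j) (L'.clock t s) (L'.arrival t i) (mass_from m t (Suc i)) (mass_from m t i) z"
        using N'[OF im(1)] im True by (simp add: L'.schedule_def L'.places_def)
      then show ?thesis
        unfolding state_mass_def reached_mass_def cut G_def clock by simp
    qed
    then have "(\<Sum>i\<in>{i. i \<le> m \<and> \<theta> i = j}. L'.schedule t s (i, z))
        = (\<Sum>i\<in>{a..<b}. G (mass_from m t i) - G (mass_from m t (Suc i)))"
      unfolding fib by (intro sum.cong) auto
    also have "\<dots> = - (\<Sum>i\<in>{a..<b}. G (mass_from m t (Suc i)) - G (mass_from m t i))"
      by (simp add: sum_negf[symmetric])
    also have "\<dots> = G (mass_from m t a) - G (mass_from m t b)"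
      using sum_Suc_diff'[OF ab, of "\<lambda>i. G (mass_from m t i)"] by simp
    also have "\<dots> = schedule (simplex_push (m, \<theta>, p) t) s (j, z)"
      using True mass_from_push[OF \<theta> a] mass_from_push[OF \<theta> b]
      by (simp add: schedule_def places_def state_mass_def reached_mass_def G_def)
    finally show ?thesis by simp
  next
    case False
    then show ?thesis using le N' by (auto simp: schedule_def places_def L'.schedule_def L'.places_def intro!: sum.neutral)
  qed
qed


section \<open>The category of cut positions\<close>

text \<open>From maps of steps to maps of positions: the step \<open>i\<close> consists of the positions \<open>2 * i - 1\<close> and \<open>2 * i\<close>.\<close>

definition double :: "(nat \<Rightarrow> nat) \<Rightarrow> nat \<Rightarrow> nat" where
  "double \<phi> e = (if even e then 2 * \<phi> (e div 2) else 2 * \<phi> ((e + 1) div 2) - 1)"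

lemma double_even [simp]: "double \<phi> (2 * j) = 2 * \<phi> j"
  and double_odd [simp]: "double \<phi> (Suc (2 * j)) = 2 * \<phi> (Suc j) - 1"
  by (simp_all add: double_def)

lemma half_cases: obtains j where "e = 2 * j" | j where "e = Suc (2 * j)"
  by (metis oddE evenE Suc_eq_plus1)

lemma parity_embedding_double:
  assumes "strict_mono_on {..m} \<phi>"
  shows "parity_embedding (2 * m) (double \<phi>)"
proof -
  have pos: "0 < \<phi> (Suc j)" if "Suc j \<le> m" for j
    using strict_mono_onD[OF assms, of 0 "Suc j"] that by auto
  have step: "double \<phi> e < double \<phi> (Suc e)" if "Suc e \<le> 2 * m" for e
  proof (cases e rule: half_cases)
    case (1 j)
    then show ?thesis using strict_mono_onD[OF assms, of j "Suc j"] that by simp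
  next
    case (2 j)
    have "Suc (Suc (2 * j)) = 2 * Suc j" by simp
    then show ?thesis using that pos[of j] 2 by (simp only: double_even double_odd) simp
  qed
  have lt: "double \<phi> e < double \<phi> e'" if "e < e'" "e' \<le> 2 * m" for e e'
    using that
  proof (induction e')
    case (Suc k)
    then show ?case using step[of k]
      by (cases "e = k") (auto intro: less_trans)
  qed simp
  have "even (double \<phi> e) \<longleftrightarrow> even e" if "e \<le> 2 * m" for e
  proof (cases e rule: half_cases)
    case (2 j)
    then show ?thesis using pos[of j] that by simp
  qed simp
  then show ?thesis
    using lt by (auto simp: parity_embedding_def strict_mono_on_def)
qed

lemma double_le:
  assumes "\<And>i. i \<le> m \<Longrightarrow> \<phi> i \<le> n" "e \<le> 2 * m"
  shows "double \<phi> e \<le> 2 * n"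
proof (cases e rule: half_cases)
  case (1 j)
  then show ?thesis using assms by simp
next
  case (2 j)
  then have "\<phi> (Suc j) \<le> n" using assms by (intro assms(1)) simp
  then show ?thesis using 2 by simp
qed

lemma double_ident:
  assumes "\<And>i. i \<le> m \<Longrightarrow> \<phi> i = i" "e \<le> 2 * m"
  shows "double \<phi> e = e"
  using assms by (cases e rule: half_cases) auto

lemma double_compose:
  assumes "strict_mono_on {..m} \<phi>" "\<And>i. i \<le> m \<Longrightarrow> \<omega> i = \<psi> (\<phi> i)" "e \<le> 2 * m"
  shows "double \<omega> e = double \<psi> (double \<phi> e)"
proof (cases e rule: half_cases)
  case (1 j)
  then show ?thesis using assms by simp
next
  case (2 j)
  then have j: "Suc j \<le> m" using assms by simp
  then have "0 < \<phi> (Suc j)" using strict_mono_onD[OF assms(1), of 0 "Suc j"] by auto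
  then obtain k where "\<phi> (Suc j) = Suc k" using gr0_implies_Suc by blast
  then show ?thesis using 2 j assms(2)[OF j] by simp
qed

definition height :: "('o, 'm, nat, ord_map) ftor \<Rightarrow> 'o \<Rightarrow> nat" where
  "height P X = 2 * obj_map P X"

definition embed :: "('o, 'm, nat, ord_map) ftor \<Rightarrow> 'm \<Rightarrow> nat \<Rightarrow> nat" where
  "embed P f = double (fst (snd (arr_map P f)))"

definition retract :: "('o, 'm, nat, ord_map) ftor \<Rightarrow> 'm \<Rightarrow> nat \<Rightarrow> nat" where
  "retract P f = last_index (2 * fst (arr_map P f)) (embed P f)"

text \<open>The universal example of a family of cuts. The functor \<open>P\<close> provides each object with a number of steps.
  An arrow consists of an arrow \<open>f\<close> of \<open>C\<close> together with cut positions of its domain and its codomain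
  that are comparable after collapsing the steps inserted by \<open>P f\<close>.\<close>

definition cut_cat :: "('o, 'm) cat \<Rightarrow> ('o, 'm, nat, ord_map) ftor
    \<Rightarrow> ('o \<times> nat, nat \<times> 'm \<times> nat) cat" where
  "cut_cat C P = \<lparr>Obj = {(X, z). X \<in> Obj C \<and> z \<le> height P X},
     Arr = {(z, f, y). f \<in> Arr C \<and> z \<le> height P (Dom C f) \<and> y \<le> height P (Cod C f) \<and>
       zigzag_le z (retract P f y)},
     Dom = (\<lambda>(z, f, y). (Dom C f, z)), Cod = (\<lambda>(z, f, y). (Cod C f, y)),
     Ide = (\<lambda>(X, z). (z, Ide C X, z)), Comp = (\<lambda>(y', g, x) (z, f, y). (z, Comp C g f, x))\<rparr>"

definition bottom_cut :: "('o, 'm) cat \<Rightarrow> ('o, 'm, 'o \<times> nat, nat \<times> 'm \<times> nat) ftor" where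
  "bottom_cut C = \<lparr>obj_map = (\<lambda>X\<in>Obj C. (X, 0)), arr_map = (\<lambda>f\<in>Arr C. (0, f, 0))\<rparr>"

definition top_cut :: "('o, 'm) cat \<Rightarrow> ('o, 'm, nat, ord_map) ftor
    \<Rightarrow> ('o, 'm, 'o \<times> nat, nat \<times> 'm \<times> nat) ftor" where
  "top_cut C P = \<lparr>obj_map = (\<lambda>X\<in>Obj C. (X, height P X)),
     arr_map = (\<lambda>f\<in>Arr C. (height P (Dom C f), f, height P (Cod C f)))\<rparr>"

lemma cut_cat_simps [simp]:
  "(X, z) \<in> Obj (cut_cat C P) \<longleftrightarrow> X \<in> Obj C \<and> z \<le> height P X"
  "(z, f, y) \<in> Arr (cut_cat C P) \<longleftrightarrow> f \<in> Arr C \<and> z \<le> height P (Dom C f) \<and> y \<le> height P (Cod C f) \<and>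
       zigzag_le z (retract P f y)"
  "Dom (cut_cat C P) (z, f, y) = (Dom C f, z)" "Cod (cut_cat C P) (z, f, y) = (Cod C f, y)"
  "Ide (cut_cat C P) (X, z) = (z, Ide C X, z)"
  "Comp (cut_cat C P) (y', g, x) (z, f, y) = (z, Comp C g f, x)"
  by (simp_all add: cut_cat_def)

lemma Delta_inj_simps [simp]:
  "Dom Delta_inj (m, \<phi>, n) = m" "Cod Delta_inj (m, \<phi>, n) = n" "Ide Delta_inj n = (n, (\<lambda>i\<in>{..n}. i), n)"
  "Comp Delta_inj (n', \<psi>, l) (m, \<phi>, n) = (m, compose {..m} \<psi> \<phi>, l)"
  "(m, \<phi>, n) \<in> Arr Delta_inj \<longleftrightarrow> \<phi> \<in> {..m} \<rightarrow>\<^sub>E {..n} \<and> strict_mono_on {..m} \<phi>"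
  by (simp_all add: Delta_inj_def Delta_def)

locale stepped_category = category C for C :: "('o, 'm) cat" +
  fixes P :: "('o, 'm, nat, ord_map) ftor"
  assumes P: "is_functor C Delta_inj P"
begin

lemma arr_map_P:
  assumes f: "f \<in> Arr C"
  obtains \<phi> where "arr_map P f = (obj_map P (Dom C f), \<phi>, obj_map P (Cod C f))"
    "strict_mono_on {..obj_map P (Dom C f)} \<phi>" "\<And>i. i \<le> obj_map P (Dom C f) \<Longrightarrow> \<phi> i \<le> obj_map P (Cod C f)"
proof -
  obtain m \<phi> n where e: "arr_map P f = (m, \<phi>, n)" by (cases "arr_map P f")
  have "m = obj_map P (Dom C f)" "n = obj_map P (Cod C f)" "(m, \<phi>, n) \<in> Arr Delta_inj"
    using functorD(2-4)[OF P f] by (auto simp: e)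
  then show thesis using that[of \<phi>] e by (auto simp: PiE_iff)
qed

lemma embedding_embed: "f \<in> Arr C \<Longrightarrow> parity_embedding (height P (Dom C f)) (embed P f)"
  by (rule arr_map_P) (auto simp: height_def embed_def intro: parity_embedding_double)

lemma strict_embed: "f \<in> Arr C \<Longrightarrow> strict_mono_on {..height P (Dom C f)} (embed P f)"
  using embedding_embed by (simp add: parity_embedding_def)

lemma embed_le: "f \<in> Arr C \<Longrightarrow> e \<le> height P (Dom C f) \<Longrightarrow> embed P f e \<le> height P (Cod C f)"
proof (rule arr_map_P)
  fix \<phi> assume "e \<le> height P (Dom C f)" "arr_map P f = (obj_map P (Dom C f), \<phi>, obj_map P (Cod C f))"
    "\<And>i. i \<le> obj_map P (Dom C f) \<Longrightarrow> \<phi> i \<le> obj_map P (Cod C f)"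
  then show "embed P f e \<le> height P (Cod C f)"
    using double_le[of "obj_map P (Dom C f)" \<phi> "obj_map P (Cod C f)" e] by (simp add: height_def embed_def)
qed

lemma embed_Ide: "X \<in> Obj C \<Longrightarrow> e \<le> height P X \<Longrightarrow> embed P (Ide C X) e = e"
  using functorD(5)[OF P, of X] by (auto simp: height_def embed_def intro: double_ident)

lemma embed_Comp:
  assumes "g \<in> Arr C" "f \<in> Arr C" "Dom C g = Cod C f" "e \<le> height P (Dom C f)"
  shows "embed P (Comp C g f) e = embed P g (embed P f e)"
proof -
  obtain \<phi> where \<phi>: "arr_map P f = (obj_map P (Dom C f), \<phi>, obj_map P (Cod C f))"
    "strict_mono_on {..obj_map P (Dom C f)} \<phi>" using arr_map_P[OF assms(2)] by blast
  obtain \<psi> where \<psi>: "arr_map P g = (obj_map P (Dom C g), \<psi>, obj_map P (Cod C g))"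
    using arr_map_P[OF assms(1)] by blast
  show ?thesis
    using functorD(6)[OF P assms(1,2,3)] assms(4)
    by (auto simp: embed_def \<phi>(1) \<psi> height_def compose_def intro!: double_compose[OF \<phi>(2)])
qed

lemma retract_eq: "f \<in> Arr C \<Longrightarrow> retract P f = last_index (height P (Dom C f)) (embed P f)"
  by (rule arr_map_P) (auto simp: retract_def height_def)

lemma retract_Ide: "X \<in> Obj C \<Longrightarrow> y \<le> height P X \<Longrightarrow> retract P (Ide C X) y = y"
  by (simp add: retract_eq Ide_Arr Dom_Ide) (rule last_index_eqI, auto simp: embed_Ide)

lemma retract_Comp:
  assumes "g \<in> Arr C" "f \<in> Arr C" "Dom C g = Cod C f"
  shows "retract P (Comp C g f) y = retract P f (retract P g y)"
  using assms last_index_trans[OF strict_embed[OF assms(2)] embed_le[OF assms(2)]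
      strict_embed[OF assms(1), unfolded assms(3)] embed_Comp[OF assms], symmetric]
  by (simp add: retract_eq Comp_Arr Dom_Comp)

lemma zigzag_le_retract: "f \<in> Arr C \<Longrightarrow> zigzag_le x y \<Longrightarrow> zigzag_le (retract P f x) (retract P f y)"
  by (simp add: retract_eq zigzag_le_last_index[OF embedding_embed])

lemma retract_0: "f \<in> Arr C \<Longrightarrow> retract P f 0 = 0"
  using last_index_zero[OF strict_embed] by (simp add: retract_eq)

lemma retract_height: "f \<in> Arr C \<Longrightarrow> retract P f (height P (Cod C f)) = height P (Dom C f)"
proof -
  assume f: "f \<in> Arr C"
  have "height P (Dom C f) \<le> last_index (height P (Dom C f)) (embed P f) (height P (Cod C f))"
    by (rule last_index_ge[OF order_refl]) (rule embed_le[OF f order_refl])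
  then show ?thesis using f by (simp add: retract_eq last_index_le le_antisym)
qed

lemma category_cut_cat: "category (cut_cat C P)"
proof
  show "Comp (cut_cat C P) g f \<in> Arr (cut_cat C P)"
    if "g \<in> Arr (cut_cat C P)" "f \<in> Arr (cut_cat C P)" "Dom (cut_cat C P) g = Cod (cut_cat C P) f" for g f
  proof -
    obtain y g' x z f' y' where [simp]: "g = (y, g', x)" "f = (z, f', y')" by (cases g, cases f)
    show ?thesis
      using that zigzag_le_retract[of f' y "retract P g' x"] zigzag_le_trans retract_Comp[of g' f']
      by (auto simp: Comp_Arr Dom_Comp Cod_Comp)
  qed
qed (auto simp: Dom_Obj Cod_Obj Ide_Arr Dom_Ide Cod_Ide Comp_Arr Dom_Comp Cod_Comp Comp_Ide Ide_Comp Comp_assoc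
    retract_Ide)

lemma is_functor_bottom_cut: "is_functor C (cut_cat C P) (bottom_cut C)"
  by (auto simp: is_functor_def bottom_cut_def Dom_Obj Cod_Obj Ide_Arr Comp_Arr retract_0)

lemma is_functor_top_cut: "is_functor C (cut_cat C P) (top_cut C P)"
  by (auto simp: is_functor_def top_cut_def Dom_Obj Cod_Obj Ide_Arr Comp_Arr retract_height Dom_Ide Cod_Ide
    Dom_Comp Cod_Comp)

end


section \<open>The homotopy between the extreme cuts\<close>

context stepped_category
begin

definition vertex_height where
  "vertex_height \<sigma> i = height P (obj_map \<sigma> i)"

definition edge_embed where
  "edge_embed \<sigma> i k = embed P (arr_map \<sigma> (i, k))"

abbreviation "simplex_places p \<sigma> \<equiv> levels.places p (vertex_height \<sigma>)"
abbreviation "simplex_order p \<sigma> \<equiv> levels.place_order p (vertex_height \<sigma>) (edge_embed \<sigma>)"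
abbreviation "simplex_schedule p \<sigma> \<equiv> levels.schedule p (vertex_height \<sigma>) (edge_embed \<sigma>)"

text \<open>A simplex of the nerve of \<open>C\<close> extends to all cuts of its vertices. Points in the
  realization of the poset of places are mapped to the classifying space of \<open>cut_cat C P\<close> along this functor.\<close>

definition place_functor where
  "place_functor p \<sigma> = \<lparr>obj_map = (\<lambda>(i, z)\<in>simplex_places p \<sigma>. (obj_map \<sigma> i, z)),
     arr_map = (\<lambda>((i, z), (k, y))\<in>simplex_order p \<sigma>. (z, arr_map \<sigma> (i, k), y))\<rparr>"

text \<open>The path that a point of the simplex describes while the cut moves from the first to the last position.\<close>

definition track where
  "track p \<sigma> t s = classifying_map (cut_cat C P) (place_functor p \<sigma>)
     (finite_poset.weight_point (simplex_places p \<sigma>) (simplex_order p \<sigma>) (simplex_schedule p \<sigma> t s))"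

context
  fixes p \<sigma> assumes \<sigma>: "is_functor (ordinal p) C \<sigma>"
begin

lemma simplex_arr:
  assumes "i \<le> k" "k \<le> p"
  shows "arr_map \<sigma> (i, k) \<in> Arr C" "Dom C (arr_map \<sigma> (i, k)) = obj_map \<sigma> i"
    "Cod C (arr_map \<sigma> (i, k)) = obj_map \<sigma> k"
  using functorD(2-4)[OF \<sigma>, of "(i, k)"] assms by auto

lemma simplex_ide: "i \<le> p \<Longrightarrow> arr_map \<sigma> (i, i) = Ide C (obj_map \<sigma> i)"
  using functorD(5)[OF \<sigma>, of i] by simp

lemma simplex_comp:
  "i \<le> k \<Longrightarrow> k \<le> l \<Longrightarrow> l \<le> p \<Longrightarrow> arr_map \<sigma> (i, l) = Comp C (arr_map \<sigma> (k, l)) (arr_map \<sigma> (i, k))"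
  using functorD(6)[OF \<sigma>, of "(k, l)" "(i, k)"] by simp

lemma simplex_obj: "i \<le> p \<Longrightarrow> obj_map \<sigma> i \<in> Obj C"
  using functorD(1)[OF \<sigma>, of i] by simp

lemma levels_simplex: "levels p (vertex_height \<sigma>) (edge_embed \<sigma>)"
proof
  show "even (vertex_height \<sigma> i)" for i by (simp add: vertex_height_def height_def)
  show "parity_embedding (vertex_height \<sigma> i) (edge_embed \<sigma> i k)" if "i \<le> k" "k \<le> p" for i k
    using embedding_embed[OF simplex_arr(1)[OF that]] simplex_arr[OF that]
    by (simp add: vertex_height_def edge_embed_def)
  show "edge_embed \<sigma> i k e \<le> vertex_height \<sigma> k" if "i \<le> k" "k \<le> p" "e \<le> vertex_height \<sigma> i" for i k e
    using embed_le[OF simplex_arr(1)[OF that(1,2)]] simplex_arr[OF that(1,2)] that(3)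
    by (simp add: vertex_height_def edge_embed_def)
  show "edge_embed \<sigma> i i e = e" if "i \<le> p" "e \<le> vertex_height \<sigma> i" for i e
    using that simplex_obj by (simp add: vertex_height_def edge_embed_def simplex_ide embed_Ide)
  show "edge_embed \<sigma> k l (edge_embed \<sigma> i k e) = edge_embed \<sigma> i l e"
    if "i \<le> k" "k \<le> l" "l \<le> p" "e \<le> vertex_height \<sigma> i" for i k l e
    using that simplex_arr[of i k] simplex_arr[of k l]
    by (simp add: vertex_height_def edge_embed_def simplex_comp[of i k l] embed_Comp)
qed

interpretation levels p "vertex_height \<sigma>" "edge_embed \<sigma>"
  by (rule levels_simplex)

interpretation finite_poset "simplex_places p \<sigma>" "simplex_order p \<sigma>"
  by (rule finite_poset_places)

lemma collapse_simplex:
  "i \<le> k \<Longrightarrow> k \<le> p \<Longrightarrow> collapse i k = retract P (arr_map \<sigma> (i, k))"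
  using simplex_arr[of i k] by (simp add: collapse_def retract_eq vertex_height_def edge_embed_def)

lemma is_functor_place_functor:
  "is_functor (poset_cat (simplex_places p \<sigma>) (simplex_order p \<sigma>)) (cut_cat C P) (place_functor p \<sigma>)"
proof -
  let ?S = "poset_cat (simplex_places p \<sigma>) (simplex_order p \<sigma>)"
  have o: "obj_map (place_functor p \<sigma>) x \<in> Obj (cut_cat C P)" if "x \<in> simplex_places p \<sigma>" for x
    using that simplex_obj by (auto simp: place_functor_def) (auto simp: places_def vertex_height_def)
  have a: "arr_map (place_functor p \<sigma>) u \<in> Arr (cut_cat C P) \<and>
      Dom (cut_cat C P) (arr_map (place_functor p \<sigma>) u) = obj_map (place_functor p \<sigma>) (fst u) \<and>
      Cod (cut_cat C P) (arr_map (place_functor p \<sigma>) u) = obj_map (place_functor p \<sigma>) (snd u)"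
    if u: "u \<in> simplex_order p \<sigma>" for u
  proof -
    obtain i z k y where [simp]: "u = ((i, z), (k, y))" by (metis surj_pair)
    have *: "i \<le> k" "k \<le> p" "z \<le> vertex_height \<sigma> i" "y \<le> vertex_height \<sigma> k" "zigzag_le z (collapse i k y)"
      using u by (auto simp: place_order_def)
    then show ?thesis
      using u simplex_arr[OF *(1,2)] collapse_simplex[OF *(1,2)]
      by (simp add: place_functor_def places_def vertex_height_def)
  qed
  have i: "arr_map (place_functor p \<sigma>) (x, x) = Ide (cut_cat C P) (obj_map (place_functor p \<sigma>) x)"
    if x: "x \<in> simplex_places p \<sigma>" for x
    using x refl[OF x] simplex_ide by (cases x) (auto simp: place_functor_def, auto simp: places_def)
  have c: "arr_map (place_functor p \<sigma>) (Comp ?S v u)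
      = Comp (cut_cat C P) (arr_map (place_functor p \<sigma>) v) (arr_map (place_functor p \<sigma>) u)"
    if vu: "v \<in> simplex_order p \<sigma>" "u \<in> simplex_order p \<sigma>" "fst v = snd u" for u v
  proof -
    obtain x y y' z where [simp]: "u = (x, y)" "v = (y', z)" by (cases u, cases v)
    obtain i a j b k c where [simp]: "x = (i, a)" "y = (j, b)" "z = (k, c)" by (cases x, cases y, cases z)
    have "(x, z) \<in> simplex_order p \<sigma>" using trans[of x y z] vu by simp
    moreover have "i \<le> j" "j \<le> k" "k \<le> p" using vu by (auto simp: place_order_def)
    ultimately show ?thesis using vu simplex_comp[of i j k] by (simp add: place_functor_def)
  qed
  have e: "obj_map (place_functor p \<sigma>) \<in> extensional (simplex_places p \<sigma>)"
    "arr_map (place_functor p \<sigma>) \<in> extensional (simplex_order p \<sigma>)"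
    by (auto simp: place_functor_def)
  show ?thesis
    unfolding is_functor_def PiE_iff poset_cat_simps using o a i c e by blast
qed

lemma classifying_map_place_functor:
  assumes "ascending n e" "u \<in> standard_simplex n"
  shows "classifying_map (cut_cat C P) (place_functor p \<sigma>) (weight_point (push_weights n e u))
    = point (nerve (cut_cat C P)) (n, fcomp (ordinal n) (place_functor p \<sigma>) (vertex_simplex n e), u)"
  using assms
  by (simp add: weight_point_push_weights classifying_map_point[OF is_functor_place_functor is_functor_vertex_simplex])

lemma fcomp_place_functor:
  assumes "ascending n e"
  shows "i \<le> n \<Longrightarrow> obj_map (fcomp (ordinal n) (place_functor p \<sigma>) (vertex_simplex n e)) i
      = (obj_map \<sigma> (fst (e i)), snd (e i))"
    and "i \<le> k \<Longrightarrow> k \<le> n \<Longrightarrow> arr_map (fcomp (ordinal n) (place_functor p \<sigma>) (vertex_simplex n e)) (i, k)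
      = (snd (e i), arr_map \<sigma> (fst (e i), fst (e k)), snd (e k))"
    and "is_functor (ordinal n) (cut_cat C P) (fcomp (ordinal n) (place_functor p \<sigma>) (vertex_simplex n e))"
proof -
  show "obj_map (fcomp (ordinal n) (place_functor p \<sigma>) (vertex_simplex n e)) i = (obj_map \<sigma> (fst (e i)), snd (e i))"
    if "i \<le> n"
    using that ascending_in[OF assms that]
    by (simp add: fcomp_apply vertex_simplex_def place_functor_def split_def)
  show "arr_map (fcomp (ordinal n) (place_functor p \<sigma>) (vertex_simplex n e)) (i, k)
      = (snd (e i), arr_map \<sigma> (fst (e i), fst (e k)), snd (e k))" if "i \<le> k" "k \<le> n"
    using that assms
    by (simp add: fcomp_apply vertex_simplex_def place_functor_def split_def ascending_def)
qed (rule is_functor_fcomp[OF category_ordinal is_functor_vertex_simplex[OF assms] is_functor_place_functor])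

lemma continuous_map_track:
  "continuous_map (prod_topology (simplex_space p) (top_of_set {0..1})) (classifying_space (cut_cat C P))
    (\<lambda>(t, s). track p \<sigma> t s)"
proof -
  have "continuous_map (prod_topology (simplex_space p) (top_of_set {0..1 :: real}))
      (classifying_space (poset_cat (simplex_places p \<sigma>) (simplex_order p \<sigma>)))
      (\<lambda>x. weight_point (case x of (t, s) \<Rightarrow> schedule t s))"
    using continuous_map_schedule schedule_weights
    by (intro continuous_map_weight_point) (auto simp: split_def)
  from continuous_map_compose[OF this continuous_map_classifying_map[OF is_functor_place_functor]]
  show ?thesis by (simp add: o_def split_def track_def)
qed

lemma track_start:
  assumes t: "t \<in> standard_simplex p"
  shows "track p \<sigma> t 0 = classifying_map (cut_cat C P) (bottom_cut C) (point (nerve C) (p, \<sigma>, t))"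
proof -
  have asc: "ascending p (\<lambda>i. (i, 0))"
    using retract_0 unfolding ascending_def by (auto simp: place_order_def collapse_simplex simplex_arr)
  have "fcomp (ordinal p) (place_functor p \<sigma>) (vertex_simplex p (\<lambda>i. (i, 0))) = fcomp (ordinal p) (bottom_cut C) \<sigma>"
    using is_functor_fcomp[OF category_ordinal \<sigma> is_functor_bottom_cut] fcomp_place_functor[OF asc]
    by (intro functor_eqI[of "ordinal p" "cut_cat C P"])
      (auto simp: fcomp_apply bottom_cut_def simplex_obj simplex_arr)
  then show ?thesis
    by (simp add: track_def schedule_start[OF t] classifying_map_place_functor[OF asc t]
      classifying_map_point[OF is_functor_bottom_cut \<sigma> t])
qed

lemma track_end:
  assumes t: "t \<in> standard_simplex p"
  shows "track p \<sigma> t 1 = classifying_map (cut_cat C P) (top_cut C P) (point (nerve C) (p, \<sigma>, t))"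
proof -
  have asc: "ascending p (\<lambda>i. (i, vertex_height \<sigma> i))"
    using retract_height[OF simplex_arr(1)]
    unfolding ascending_def by (auto simp: place_order_def collapse_simplex simplex_arr vertex_height_def)
  have "fcomp (ordinal p) (place_functor p \<sigma>) (vertex_simplex p (\<lambda>i. (i, vertex_height \<sigma> i)))
      = fcomp (ordinal p) (top_cut C P) \<sigma>"
    using is_functor_fcomp[OF category_ordinal \<sigma> is_functor_top_cut] fcomp_place_functor[OF asc]
    by (intro functor_eqI[of "ordinal p" "cut_cat C P"])
      (auto simp: fcomp_apply top_cut_def simplex_obj simplex_arr vertex_height_def)
  then show ?thesis
    by (simp add: track_def schedule_end[OF t] classifying_map_place_functor[OF asc t]
      classifying_map_point[OF is_functor_top_cut \<sigma> t])
qed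

end

text \<open>Relabelling vertices along \<open>\<theta>\<close> maps places to places, and the schedules correspond by \<open>schedule_push\<close>. Thus the same
  weights are pushed to the classifying space, and the paths are compatible with gluing.\<close>

lemma track_action:
  assumes \<theta>: "(m, \<theta>, p) \<in> Arr Delta" and \<sigma>: "is_functor (ordinal p) C \<sigma>" and t: "t \<in> standard_simplex m"
  shows "track m (action (nerve C) (m, \<theta>, p) \<sigma>) t s = track p \<sigma> (simplex_push (m, \<theta>, p) t) s"
proof -
  let ?\<sigma>' = "action (nerve C) (m, \<theta>, p) \<sigma>"
  have \<sigma>': "is_functor (ordinal m) C ?\<sigma>'"
    unfolding nerve_simps by (rule is_functor_fcomp[OF category_ordinal is_functor_action[OF \<theta>] \<sigma>])
  have mono: "\<theta> i \<le> \<theta> k" if "i \<le> k" "k \<le> m" for i k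
    using \<theta> that by (auto simp: Delta_def mono_on_def)
  have le: "\<theta> i \<le> p" if "i \<le> m" for i
    using \<theta> that by (auto simp: Delta_def PiE_iff)
  have so: "obj_map ?\<sigma>' i = obj_map \<sigma> (\<theta> i)" if "i \<le> m" for i
    using that by (simp add: nerve_simps fcomp_apply ordinal_functor_def)
  have sa: "arr_map ?\<sigma>' (i, k) = arr_map \<sigma> (\<theta> i, \<theta> k)" if "i \<le> k" "k \<le> m" for i k
    using that by (simp add: nerve_simps fcomp_apply ordinal_functor_def)
  interpret L: levels p "vertex_height \<sigma>" "edge_embed \<sigma>" by (rule levels_simplex[OF \<sigma>])
  interpret L': levels m "vertex_height ?\<sigma>'" "edge_embed ?\<sigma>'" by (rule levels_simplex[OF \<sigma>'])
  interpret F: finite_poset "simplex_places p \<sigma>" "simplex_order p \<sigma>" by (rule L.finite_poset_places)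
  interpret F': finite_poset "simplex_places m ?\<sigma>'" "simplex_order m ?\<sigma>'" by (rule L'.finite_poset_places)
  define g :: "nat \<times> nat \<Rightarrow> nat \<times> nat" where "g = (\<lambda>(i, z). (\<theta> i, z))"
  obtain n e u where e: "F'.ascending n e" and u: "u \<in> standard_simplex n"
    and w: "L'.schedule t s = push_weights n e u"
    by (rule F'.weight_point_cases[OF L'.schedule_weights[OF t]])
  have g: "(g x, g y) \<in> simplex_order p \<sigma>" if xy: "(x, y) \<in> simplex_order m ?\<sigma>'" for x y
  proof -
    obtain i z k y' where [simp]: "x = (i, z)" "y = (k, y')" by (cases x, cases y)
    have ik: "i \<le> k" "k \<le> m" using xy by (auto simp: L'.place_order_def)
    have "L'.collapse i k = L.collapse (\<theta> i) (\<theta> k)"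
      using ik mono le by (simp add: collapse_simplex[OF \<sigma>'] collapse_simplex[OF \<sigma>] sa)
    then show ?thesis
      using xy ik mono le so by (simp add: L.place_order_def L'.place_order_def g_def vertex_height_def)
  qed
  have ge: "F.ascending n (g \<circ> e)"
    using e g by (auto simp: F.ascending_def F'.ascending_def)
  have "push_weights n (g \<circ> e) u = L.schedule (simplex_push (m, \<theta>, p) t) s"
  proof
    fix x :: "nat \<times> nat"
    obtain j z where [simp]: "x = (j, z)" by (cases x)
    have "push_weights n (g \<circ> e) u (j, z) = (\<Sum>i\<in>{i. i \<le> m \<and> \<theta> i = j}. push_weights n e u (i, z))"
    proof -
      have em: "fst (e a) \<le> m" if "a \<le> n" for a
        using F'.ascending_in[OF e that] by (auto simp: L'.places_def)
      let ?A = "{a. a \<le> n \<and> (g \<circ> e) a = (j, z)}"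
      have "sum u ?A = (\<Sum>i\<in>{i. i \<le> m \<and> \<theta> i = j}. \<Sum>a\<in>{a \<in> ?A. fst (e a) = i}. u a)"
        using em by (intro sum.group[symmetric]) (auto simp: g_def split_def)
      also have "\<dots> = (\<Sum>i\<in>{i. i \<le> m \<and> \<theta> i = j}. \<Sum>a\<in>{a. a \<le> n \<and> e a = (i, z)}. u a)"
        by (intro sum.cong refl) (auto simp: g_def split_def prod_eq_iff)
      finally show ?thesis by (simp add: push_weights_def)
    qed
    also have "\<dots> = L.schedule (simplex_push (m, \<theta>, p) t) s (j, z)"
      unfolding w[symmetric]
      by (rule L.schedule_push[OF \<theta> L'.levels_axioms, symmetric])
        (auto simp: vertex_height_def edge_embed_def so sa)
    finally show "push_weights n (g \<circ> e) u x = L.schedule (simplex_push (m, \<theta>, p) t) s x" by simp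
  qed
  then have w2: "L.schedule (simplex_push (m, \<theta>, p) t) s = push_weights n (g \<circ> e) u" ..
  have "fcomp (ordinal n) (place_functor m ?\<sigma>') (vertex_simplex n e)
      = fcomp (ordinal n) (place_functor p \<sigma>) (vertex_simplex n (g \<circ> e))"
  proof (rule functor_eqI[OF fcomp_place_functor(3)[OF \<sigma>' e] fcomp_place_functor(3)[OF \<sigma> ge]])
    have gv: "fst (g x) = \<theta> (fst x)" "snd (g x) = snd x" for x by (simp_all add: g_def split_def)
    have em: "fst (e i) \<le> fst (e k)" "fst (e k) \<le> m" if "i \<le> k" "k \<le> n" for i k
      using e that unfolding F'.ascending_def by (auto simp: L'.place_order_def split_def)
    show "obj_map (fcomp (ordinal n) (place_functor m ?\<sigma>') (vertex_simplex n e)) X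
      = obj_map (fcomp (ordinal n) (place_functor p \<sigma>) (vertex_simplex n (g \<circ> e))) X"
      if "X \<in> Obj (ordinal n)" for X
      using that em[of X X]
      by (simp add: fcomp_place_functor(1)[OF \<sigma>' e] fcomp_place_functor(1)[OF \<sigma> ge] so gv)
    show "arr_map (fcomp (ordinal n) (place_functor m ?\<sigma>') (vertex_simplex n e)) f
      = arr_map (fcomp (ordinal n) (place_functor p \<sigma>) (vertex_simplex n (g \<circ> e))) f"
      if "f \<in> Arr (ordinal n)" for f
      using that em(1) em(2)[OF order_refl]
      by (cases f) (simp add: fcomp_place_functor(2)[OF \<sigma>' e] fcomp_place_functor(2)[OF \<sigma> ge] sa gv)
  qed
  then show ?thesis
    unfolding track_def w w2
    by (simp add: classifying_map_place_functor[OF \<sigma>' e u] classifying_map_place_functor[OF \<sigma> ge u])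
qed

theorem homotopic_bottom_top_cut:
  "homotopic_with (\<lambda>_. True) (classifying_space C) (classifying_space (cut_cat C P))
     (classifying_map (cut_cat C P) (bottom_cut C)) (classifying_map (cut_cat C P) (top_cut C P))"
proof -
  have "Hausdorff_space (top_of_set {0..1 :: real})" "locally_compact_space (top_of_set {0..1 :: real})"
    by (auto intro!: Hausdorff_space_subtopology compact_imp_locally_compact_space
      simp: compact_space_subtopology)
  note I = this
  obtain h where h: "continuous_map (prod_topology (realization (nerve C)) (top_of_set {0..1 :: real}))
      (classifying_space (cut_cat C P)) h"
    and eq: "\<And>x s. x \<in> topspace (presentation (nerve C)) \<Longrightarrow> s \<in> topspace (top_of_set {0..1 :: real}) \<Longrightarrow>
      h (point (nerve C) x, s) = (case x of (p, \<sigma>, t) \<Rightarrow> track p \<sigma> t s)"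
  proof (rule realization_prod_map_exists[of "nerve C" "top_of_set {0..1 :: real}"
        "classifying_space (cut_cat C P)" "\<lambda>s (p, \<sigma>, t). track p \<sigma> t s"])
    show "continuous_map (prod_topology (simplex_space n) (top_of_set {0..1})) (classifying_space (cut_cat C P))
        (\<lambda>(t, u). case (n, s, t) of (p, \<sigma>, t) \<Rightarrow> track p \<sigma> t u)"
      if "s \<in> simplices (nerve C) n" for n s
      using continuous_map_track that by (simp add: nerve_simps)
    show "(case (m, action (nerve C) (m, \<theta>, n) s, t) of (p, \<sigma>, t) \<Rightarrow> track p \<sigma> t u)
        = (case (n, s, simplex_push (m, \<theta>, n) t) of (p, \<sigma>, t) \<Rightarrow> track p \<sigma> t u)"
      if "(m, \<theta>, n) \<in> Arr Delta" "s \<in> simplices (nerve C) n" "t \<in> standard_simplex m" for u m \<theta> n s t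
      using track_action that by (simp add: nerve_simps(1))
  qed (use I simplicial_set_nerve in blast)+
  have "continuous_map (prod_topology (top_of_set {0..1 :: real}) (realization (nerve C)))
      (prod_topology (realization (nerve C)) (top_of_set {0..1})) prod.swap"
    unfolding prod.swap_def by (intro continuous_map_pairedI continuous_map_fst continuous_map_snd)
  from continuous_map_compose[OF this h]
  have swap: "continuous_map (prod_topology (top_of_set {0..1 :: real}) (realization (nerve C)))
      (classifying_space (cut_cat C P)) (h \<circ> prod.swap)" .
  show ?thesis
    unfolding classifying_space_def
  proof (subst homotopic_with, simp, intro exI conjI ballI)
    show "continuous_map (prod_topology (top_of_set {0..1 :: real}) (realization (nerve C)))
      (realization (nerve (cut_cat C P))) (h \<circ> prod.swap)"
      using swap by (simp add: classifying_space_def)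
    fix x assume "x \<in> topspace (realization (nerve C))"
    then have "x \<in> topspace (classifying_space C)" by (simp add: classifying_space_def)
    then obtain p \<sigma> t where *: "is_functor (ordinal p) C \<sigma>" "t \<in> standard_simplex p" "x = point (nerve C) (p, \<sigma>, t)"
      by (rule classifying_space_cases)
    then have "(p, \<sigma>, t) \<in> topspace (presentation (nerve C))"
      by (simp add: topspace_presentation nerve_simps)
    then show "(h \<circ> prod.swap) (0, x) = classifying_map (cut_cat C P) (bottom_cut C) x"
      "(h \<circ> prod.swap) (1, x) = classifying_map (cut_cat C P) (top_cut C P) x"
      using * by (simp_all add: eq track_start track_end)
  qed auto
qed

end


section \<open>Zig-zags as diagrams over the zig-zag order\<close>

definition entry :: "('o, 'm) zigzag \<Rightarrow> nat \<Rightarrow> 'o" where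
  "entry Y x = (if even x then bar Y (x div 2) else mid Y (Suc (x div 2)))"

text \<open>The arrow between entries whose positions are related by \<open>zigzag_le\<close>.\<close>

definition link :: "('o, 'm) cat \<Rightarrow> ('o, 'm) zigzag \<Rightarrow> nat \<Rightarrow> nat \<Rightarrow> 'm" where
  "link D Y x y = (if x = y then Ide D (entry Y x)
     else if x < y then fwd Y (Suc (x div 2)) else bwd Y (x div 2))"

definition component :: "('o, 'm) zigzag_map \<Rightarrow> nat \<Rightarrow> 'm" where
  "component f x = (if even x then bar_map f (x div 2) else mid_map f (Suc (x div 2)))"

text \<open>The diagram \<open>Y\<close> precomposed with a map \<open>\<rho>\<close> of positions. Both padding and cutting are of this form, so that their
  properties reduce to properties of maps of positions.\<close>

definition pull :: "('o, 'm) cat \<Rightarrow> nat \<Rightarrow> (nat \<Rightarrow> nat) \<Rightarrow> ('o, 'm) zigzag \<Rightarrow> ('o, 'm) zigzag" where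
  "pull D n \<rho> Y = \<lparr>bar = (\<lambda>j\<in>{..n}. entry Y (\<rho> (2 * j))), mid = (\<lambda>j\<in>{1..n}. entry Y (\<rho> (2 * j - 1))),
     fwd = (\<lambda>j\<in>{1..n}. link D Y (\<rho> (2 * j - 2)) (\<rho> (2 * j - 1))),
     bwd = (\<lambda>j\<in>{1..n}. link D Y (\<rho> (2 * j)) (\<rho> (2 * j - 1)))\<rparr>"

definition assemble :: "nat \<Rightarrow> ('o, 'm) zigzag \<Rightarrow> ('o, 'm) zigzag \<Rightarrow> (nat \<Rightarrow> 'm) \<Rightarrow> ('o, 'm) zigzag_map" where
  "assemble n Y Z c = \<lparr>zz_dom = Y, zz_cod = Z, bar_map = (\<lambda>j\<in>{..n}. c (2 * j)),
     mid_map = (\<lambda>j\<in>{1..n}. c (2 * j - 1))\<rparr>"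

text \<open>Maps from the positions of a zig-zag with \<open>n\<close> steps to those of a zig-zag with \<open>m\<close> steps.\<close>

definition zigzag_mono :: "nat \<Rightarrow> nat \<Rightarrow> (nat \<Rightarrow> nat) \<Rightarrow> bool" where
  "zigzag_mono n m \<rho> \<longleftrightarrow> (\<forall>x\<le>2 * n. \<rho> x \<le> 2 * m) \<and>
     (\<forall>x\<le>2 * n. \<forall>y\<le>2 * n. zigzag_le x y \<longrightarrow> zigzag_le (\<rho> x) (\<rho> y))"

lemma half_simps [simp]:
  "entry Y (2 * j) = bar Y j" "entry Y (Suc (2 * j)) = mid Y (Suc j)"
  "component f (2 * j) = bar_map f j" "component f (Suc (2 * j)) = mid_map f (Suc j)"
  "link D Y x x = Ide D (entry Y x)"
  "link D Y (2 * j) (Suc (2 * j)) = fwd Y (Suc j)"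
  by (simp_all add: entry_def component_def link_def)

lemma link_down [simp]: "link D Y (2 * Suc j) (Suc (2 * j)) = bwd Y (Suc j)"
  by (simp add: link_def)

lemma zigzag_le_cases:
  assumes "zigzag_le x y"
  obtains "x = y" | j where "x = 2 * j" "y = Suc (2 * j)" | j where "x = 2 * Suc j" "y = Suc (2 * j)"
proof -
  consider "x = y" | "even x" "y = Suc x" | "even x" "x = Suc y" using assms by (auto simp: zigzag_le_def)
  then show thesis
  proof cases
    case 2
    then show thesis using that(2)[of "x div 2"] by auto
  next
    case 3
    then have "odd y" by auto
    then show thesis using that(3)[of "y div 2"] 3 by (auto elim!: oddE)
  qed (use that in blast)
qed

lemma zigzag_le_steps [simp]: "zigzag_le (2 * j) (Suc (2 * j))" "zigzag_le (Suc (Suc (2 * j))) (Suc (2 * j))"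
  by (simp_all add: zigzag_le_def)

lemma Ball_positive: "(\<forall>j\<in>{1..n}. Q j) \<longleftrightarrow> (\<forall>j<n. Q (Suc j))"
  by (metis One_nat_def Suc_leI atLeastAtMost_iff le_add1 less_eq_Suc_le not0_implies_Suc not_one_le_zero plus_1_eq_Suc)

lemma restrict_positive_cong:
  assumes "\<And>j. j < n \<Longrightarrow> f (Suc j) = g (Suc j)"
  shows "restrict f {1..n} = restrict g {1..n}"
proof (rule restrict_ext)
  fix j assume "j \<in> {1..n}"
  then obtain k where "j = Suc k" "k < n" by (cases j) auto
  then show "f j = g j" using assms by simp
qed

lemma zigzag_eqI:
  assumes "\<And>j. j \<le> n \<Longrightarrow> b j = b' j" "\<And>j. j < n \<Longrightarrow> c (Suc j) = c' (Suc j)"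
    "\<And>j. j < n \<Longrightarrow> f (Suc j) = f' (Suc j)" "\<And>j. j < n \<Longrightarrow> g (Suc j) = g' (Suc j)"
  shows "\<lparr>bar = (\<lambda>j\<in>{..n}. b j), mid = (\<lambda>j\<in>{1..n}. c j), fwd = (\<lambda>j\<in>{1..n}. f j), bwd = (\<lambda>j\<in>{1..n}. g j)\<rparr>
    = \<lparr>bar = (\<lambda>j\<in>{..n}. b' j), mid = (\<lambda>j\<in>{1..n}. c' j), fwd = (\<lambda>j\<in>{1..n}. f' j), bwd = (\<lambda>j\<in>{1..n}. g' j)\<rparr>"
  using restrict_positive_cong[of n c c'] restrict_positive_cong[of n f f'] restrict_positive_cong[of n g g']
    restrict_ext[of "{..n}" b b'] assms by simp

lemma entry_pull: "x \<le> 2 * n \<Longrightarrow> entry (pull D n \<rho> Y) x = entry Y (\<rho> x)"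
  by (cases x rule: half_cases) (auto simp: pull_def)

lemma link_pull:
  assumes "zigzag_le x y" "x \<le> 2 * n" "y \<le> 2 * n"
  shows "link D (pull D n \<rho> Y) x y = link D Y (\<rho> x) (\<rho> y)"
  using assms(1)
proof (cases rule: zigzag_le_cases)
  case 1
  then show ?thesis using assms by (simp add: entry_pull)
next
  case (2 j)
  then show ?thesis using assms by (simp add: pull_def)
next
  case (3 j)
  then show ?thesis using assms unfolding 3 link_down by (simp add: pull_def)
qed

lemma pull_cong:
  assumes "\<And>x. x \<le> 2 * n \<Longrightarrow> \<rho> x = \<rho>' x"
  shows "pull D n \<rho> Y = pull D n \<rho>' Y"
  unfolding pull_def using assms by (intro zigzag_eqI) simp_all

lemma pull_pull:
  assumes "zigzag_mono n m \<rho>"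
  shows "pull D n \<rho> (pull D m \<rho>' Y) = pull D n (\<lambda>x. \<rho>' (\<rho> x)) Y"
proof -
  have le: "\<rho> x \<le> 2 * m" if "x \<le> 2 * n" for x using assms that by (simp add: zigzag_mono_def)
  have zle: "zigzag_le (\<rho> (2 * j)) (\<rho> (Suc (2 * j)))" "zigzag_le (\<rho> (Suc (Suc (2 * j)))) (\<rho> (Suc (2 * j)))" if "j < n" for j
    using assms that zigzag_le_steps[of j] by (auto simp: zigzag_mono_def)
  show ?thesis
    unfolding pull_def[of D n]
    by (intro zigzag_eqI) (simp_all add: entry_pull link_pull le zle)
qed

lemma pull_ident:
  assumes "Y \<in> zigzags D n" "\<And>x. x \<le> 2 * n \<Longrightarrow> \<rho> x = x"
  shows "pull D n \<rho> Y = Y"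
proof -
  have e: "bar Y \<in> extensional {..n}" "mid Y \<in> extensional {1..n}" "fwd Y \<in> extensional {1..n}"
    "bwd Y \<in> extensional {1..n}" using assms(1) by (auto simp: zigzags_def PiE_iff)
  have s: "link D Y (Suc (Suc (2 * j))) (Suc (2 * j)) = bwd Y (Suc j)" for j using link_down[of D Y j] by simp
  have "restrict (\<lambda>j. entry Y (2 * j)) {..n} = bar Y"
    "restrict (\<lambda>j. entry Y (2 * j - 1)) {1..n} = mid Y"
    "restrict (\<lambda>j. link D Y (2 * j - 2) (2 * j - 1)) {1..n} = fwd Y"
    "restrict (\<lambda>j. link D Y (2 * j) (2 * j - 1)) {1..n} = bwd Y"
    using extensional_restrict[OF e(1)] extensional_restrict[OF e(2)] extensional_restrict[OF e(3)]
      extensional_restrict[OF e(4)]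
      restrict_positive_cong[of n "\<lambda>j. entry Y (2 * j - 1)" "mid Y"]
      restrict_positive_cong[of n "\<lambda>j. link D Y (2 * j - 2) (2 * j - 1)" "fwd Y"]
      restrict_positive_cong[of n "\<lambda>j. link D Y (2 * j) (2 * j - 1)" "bwd Y"]
    by (simp_all add: s)
  moreover have "pull D n \<rho> Y = pull D n (\<lambda>x. x) Y" by (rule pull_cong) (rule assms(2))
  ultimately show ?thesis by (simp add: pull_def)
qed

lemma component_assemble: "x \<le> 2 * n \<Longrightarrow> component (assemble n Y Z c) x = c x"
  by (cases x rule: half_cases) (auto simp: assemble_def)

lemma zigzag_map_eq_component:
  assumes "f \<in> zigzag_maps D n" "g \<in> zigzag_maps D n" "zz_dom f = zz_dom g" "zz_cod f = zz_cod g"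
    "\<And>x. x \<le> 2 * n \<Longrightarrow> component f x = component g x"
  shows "f = g"
proof (rule zigzag_map_eqI[OF assms(1-4)])
  show "bar_map f i = bar_map g i" if "i \<le> n" for i using assms(5)[of "2 * i"] that by simp
  show "mid_map f i = mid_map g i" if "1 \<le> i" "i \<le> n" for i
    using assms(5)[of "Suc (2 * (i - 1))"] that by simp
qed

lemma component_Comp:
  "x \<le> 2 * n \<Longrightarrow> component (Comp (Lambda D n) g f) x = Comp D (component g x) (component f x)"
  by (cases x rule: half_cases) (auto simp: Lambda_def)

lemma component_Ide:
  "x \<le> 2 * n \<Longrightarrow> component (Ide (Lambda D n) Y) x = Ide D (entry Y x)"
  by (cases x rule: half_cases) (auto simp: Lambda_def)

text \<open>The map of positions that defines padding: \<open>pull\<close> along it is the action of \<open>\<phi>\<close> on zig-zags, and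
  it collapses the steps that \<open>\<phi>\<close> inserts.\<close>

definition pad_index :: "nat \<Rightarrow> (nat \<Rightarrow> nat) \<Rightarrow> nat \<Rightarrow> nat" where
  "pad_index m \<phi> = last_index (2 * m) (double \<phi>)"

lemma pad_index_even:
  assumes "strict_mono_on {..m} \<phi>"
  shows "pad_index m \<phi> (2 * j) = 2 * last_index m \<phi> j"
  unfolding pad_index_def
proof (rule last_index_eqI)
  show "2 * last_index m \<phi> j = 0 \<or> 2 * last_index m \<phi> j \<le> 2 * m \<and> double \<phi> (2 * last_index m \<phi> j) \<le> 2 * j"
    using last_index_cases[of m \<phi> j] last_index_le[of m \<phi> j] by auto
  fix e assume e: "e \<le> 2 * m" "double \<phi> e \<le> 2 * j"
  show "e \<le> 2 * last_index m \<phi> j"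
  proof (cases e rule: half_cases)
    case (1 i)
    then show ?thesis using e last_index_ge[of i m \<phi> j] by simp
  next
    case (2 i)
    then have "\<phi> (Suc i) \<le> j" using e by simp
    then show ?thesis using 2 e last_index_ge[of "Suc i" m \<phi> j] by simp
  qed
qed

lemma pad_index_odd:
  assumes sm: "strict_mono_on {..m} \<phi>"
  shows "pad_index m \<phi> (Suc (2 * j)) = (if Suc j \<in> \<phi> ` {1..m}
    then 2 * last_index m \<phi> (Suc j) - 1 else 2 * last_index m \<phi> (Suc j))"
proof (cases "Suc j \<in> \<phi> ` {1..m}")
  case True
  then obtain i where "i \<in> {1..m}" "\<phi> i = Suc j" by auto
  then have i: "Suc (i - 1) = i" "i \<le> m" "\<phi> (Suc (i - 1)) = Suc j" by auto
  have "strict_mono_on {..2 * m} (double \<phi>)"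
    using parity_embedding_double[OF sm] by (simp add: parity_embedding_def)
  then have "pad_index m \<phi> (double \<phi> (Suc (2 * (i - 1)))) = Suc (2 * (i - 1))"
    unfolding pad_index_def using i by (intro last_index_hit) auto
  moreover have "last_index m \<phi> (Suc j) = i" using last_index_hit[OF sm i(2)] i by simp
  ultimately show ?thesis using True i by (simp add: )
next
  case False
  have "last_index m \<phi> (Suc j) = last_index m \<phi> j" using last_index_pred[OF sm, of "Suc j"] False by simp
  moreover have "pad_index m \<phi> (Suc (2 * j)) = 2 * last_index m \<phi> j"
    unfolding pad_index_def
  proof (rule last_index_eqI)
    show "2 * last_index m \<phi> j = 0 \<or> 2 * last_index m \<phi> j \<le> 2 * m \<and> double \<phi> (2 * last_index m \<phi> j) \<le> Suc (2 * j)"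
      using last_index_cases[of m \<phi> j] last_index_le[of m \<phi> j] by auto
    fix e assume e: "e \<le> 2 * m" "double \<phi> e \<le> Suc (2 * j)"
    show "e \<le> 2 * last_index m \<phi> j"
    proof (cases e rule: half_cases)
      case (1 i)
      then show ?thesis using e last_index_ge[of i m \<phi> j] by simp
    next
      case (2 i)
      then have "\<phi> (Suc i) \<in> \<phi> ` {1..m}" using e by (intro imageI) simp
      then have "\<phi> (Suc i) \<noteq> Suc j" using False by metis
      then have "\<phi> (Suc i) \<le> j" using e 2 by simp
      then show ?thesis using 2 e last_index_ge[of "Suc i" m \<phi> j] by simp
    qed
  qed
  ultimately show ?thesis using False by simp
qed

lemma zigzag_mono_pad_index:
  "strict_mono_on {..m} \<phi> \<Longrightarrow> zigzag_mono n m (pad_index m \<phi>)"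
  unfolding zigzag_mono_def pad_index_def
  using zigzag_le_last_index[OF parity_embedding_double] last_index_le by blast

lemma Lambda_obj_eq_pull:
  assumes sm: "strict_mono_on {..m} \<phi>"
  shows "Lambda_obj D (m, \<phi>, n) Y = pull D n (pad_index m \<phi>) Y"
proof -
  note pe = pad_index_even[OF sm] and po = pad_index_odd[OF sm]
  have ge: "\<exists>l. last_index m \<phi> (Suc j) = Suc l" if "Suc j \<in> \<phi> ` {1..m}" for j
    using last_index_hit'(1)[OF sm that] by (cases "last_index m \<phi> (Suc j)") auto
  have pe2: "pad_index m \<phi> (Suc (Suc (2 * j))) = 2 * last_index m \<phi> (Suc j)" for j
    using pe[of "Suc j"] by simp
  have lp: "last_index m \<phi> j = (if Suc j \<in> \<phi> ` {1..m} then last_index m \<phi> (Suc j) - 1 else last_index m \<phi> (Suc j))" for j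
    using last_index_pred[OF sm, of "Suc j"] by simp
  have 1: "(if Suc j \<in> \<phi> ` {1..m} then mid Y (last_index m \<phi> (Suc j)) else bar Y (last_index m \<phi> (Suc j)))
      = entry Y (pad_index m \<phi> (Suc (2 * j)))" for j
    using ge[of j] po[of j] by auto
  have 2: "(if Suc j \<in> \<phi> ` {1..m} then fwd Y (last_index m \<phi> (Suc j)) else Ide D (bar Y (last_index m \<phi> (Suc j))))
      = link D Y (pad_index m \<phi> (2 * j)) (pad_index m \<phi> (Suc (2 * j)))" for j
    using ge[of j] po[of j] lp[of j] pe[of j] by auto
  have 3: "(if Suc j \<in> \<phi> ` {1..m} then bwd Y (last_index m \<phi> (Suc j)) else Ide D (bar Y (last_index m \<phi> (Suc j))))
      = link D Y (pad_index m \<phi> (Suc (Suc (2 * j)))) (pad_index m \<phi> (Suc (2 * j)))" for j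
    using ge[of j] po[of j] pe2[of j] link_down[of D Y] by (auto simp del: link_down)
  show ?thesis
    unfolding Lambda_obj_def pull_def Let_def prod.case
  proof (rule zigzag_eqI)
    show "bar Y (last_index m \<phi> j) = entry Y (pad_index m \<phi> (2 * j))" for j by (simp add: pe)
    show "(if Suc j \<in> \<phi> ` {1..m} then mid Y (last_index m \<phi> (Suc j)) else bar Y (last_index m \<phi> (Suc j)))
        = entry Y (pad_index m \<phi> (2 * Suc j - 1))" for j
      using 1[of j] by simp
    show "(if Suc j \<in> \<phi> ` {1..m} then fwd Y (last_index m \<phi> (Suc j)) else Ide D (bar Y (last_index m \<phi> (Suc j))))
        = link D Y (pad_index m \<phi> (2 * Suc j - 2)) (pad_index m \<phi> (2 * Suc j - 1))" for j
      using 2[of j] by simp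
    show "(if Suc j \<in> \<phi> ` {1..m} then bwd Y (last_index m \<phi> (Suc j)) else Ide D (bar Y (last_index m \<phi> (Suc j))))
        = link D Y (pad_index m \<phi> (2 * Suc j)) (pad_index m \<phi> (2 * Suc j - 1))" for j
      using 3[of j] by simp
  qed
qed

lemma component_Lambda_arr:
  assumes sm: "strict_mono_on {..m} \<phi>" and x: "x \<le> 2 * n"
  shows "component (Lambda_arr D (m, \<phi>, n) f) x = component f (pad_index m \<phi> x)"
proof (cases x rule: half_cases)
  case (1 j)
  then show ?thesis using x pad_index_even[OF sm, of j] by (simp add: Lambda_arr_def Let_def)
next
  case (2 j)
  have ge: "\<exists>l. last_index m \<phi> (Suc j) = Suc l" if "Suc j \<in> \<phi> ` {1..m}" for j
    using last_index_hit'(1)[OF sm that] by (cases "last_index m \<phi> (Suc j)") auto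
  show ?thesis
  proof (cases "Suc j \<in> \<phi> ` {1..m}")
    case True
    then obtain l where "last_index m \<phi> (Suc j) = Suc l" using ge by blast
    then show ?thesis using True 2 x pad_index_odd[OF sm, of j] by (simp add: Lambda_arr_def Let_def)
  next
    case False
    then show ?thesis using 2 x pad_index_odd[OF sm, of j] by (simp add: Lambda_arr_def Let_def)
  qed
qed

context category
begin

lemma entry_Obj: "Y \<in> zigzags C m \<Longrightarrow> x \<le> 2 * m \<Longrightarrow> entry Y x \<in> Obj C"
  using zigzagsD(1)[of Y C m "x div 2"] zigzagsD(2)[of Y C m "Suc (x div 2)"]
  by (cases x rule: half_cases) auto

lemma link_arrow:
  assumes Y: "Y \<in> zigzags C m" and xy: "zigzag_le x y" "x \<le> 2 * m" "y \<le> 2 * m"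
  shows "link C Y x y \<in> Arr C" "Dom C (link C Y x y) = entry Y x" "Cod C (link C Y x y) = entry Y y"
proof -
  have "link C Y x y \<in> Arr C \<and> Dom C (link C Y x y) = entry Y x \<and> Cod C (link C Y x y) = entry Y y"
    using xy(1)
  proof (cases rule: zigzag_le_cases)
    case 1
    then show ?thesis using entry_Obj[OF Y xy(2)] by (simp add: Ide_Arr Dom_Ide Cod_Ide)
  next
    case (2 j)
    then show ?thesis using zigzagsD(2)[OF Y, of "Suc j"] xy by auto
  next
    case (3 j)
    have "entry Y (2 * Suc j) = bar Y (Suc j)" by (rule half_simps)
    then show ?thesis using zigzagsD(2)[OF Y, of "Suc j"] xy unfolding 3 link_down by auto
  qed
  then show "link C Y x y \<in> Arr C" "Dom C (link C Y x y) = entry Y x" "Cod C (link C Y x y) = entry Y y"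
    by auto
qed

text \<open>One of the two arrows is an identity, since the zig-zag order has no chains of three elements.\<close>

lemma link_link:
  assumes Y: "Y \<in> zigzags C m" and "zigzag_le x y" "zigzag_le y z" "x \<le> 2 * m" "y \<le> 2 * m" "z \<le> 2 * m"
  shows "Comp C (link C Y y z) (link C Y x y) = link C Y x z"
proof -
  have "x = y \<or> y = z" using assms by (auto simp: zigzag_le_def)
  then show ?thesis
    using link_arrow[OF Y assms(2,4,5)] link_arrow[OF Y assms(3,5,6)] Comp_Ide Ide_Comp by force
qed

lemma pull_zigzags:
  assumes Y: "Y \<in> zigzags C m" and \<rho>: "zigzag_mono n m \<rho>"
  shows "pull C n \<rho> Y \<in> zigzags C n"
proof -
  have le: "\<rho> x \<le> 2 * m" if "x \<le> 2 * n" for x using \<rho> that by (simp add: zigzag_mono_def)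
  have 1: "zigzag_le (\<rho> (2 * j)) (\<rho> (Suc (2 * j)))" "zigzag_le (\<rho> (Suc (Suc (2 * j)))) (\<rho> (Suc (2 * j)))" if "j < n" for j
    using \<rho> that zigzag_le_steps[of j] by (auto simp: zigzag_mono_def)
  have lk: "link C Y (\<rho> (2 * j)) (\<rho> (Suc (2 * j))) \<in> Arr C \<and> link C Y (\<rho> (Suc (Suc (2 * j)))) (\<rho> (Suc (2 * j))) \<in> Arr C \<and>
     Dom C (link C Y (\<rho> (2 * j)) (\<rho> (Suc (2 * j)))) = entry Y (\<rho> (2 * j)) \<and>
     Cod C (link C Y (\<rho> (2 * j)) (\<rho> (Suc (2 * j)))) = entry Y (\<rho> (Suc (2 * j))) \<and>
     Dom C (link C Y (\<rho> (Suc (Suc (2 * j)))) (\<rho> (Suc (2 * j)))) = entry Y (\<rho> (Suc (Suc (2 * j)))) \<and>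
     Cod C (link C Y (\<rho> (Suc (Suc (2 * j)))) (\<rho> (Suc (2 * j)))) = entry Y (\<rho> (Suc (2 * j)))" if "j < n" for j
    using link_arrow[OF Y 1(1)[OF that]] link_arrow[OF Y 1(2)[OF that]] le that by auto
  have ob: "entry Y (\<rho> x) \<in> Obj C" if "x \<le> 2 * n" for x using entry_Obj[OF Y le[OF that]] .
  show ?thesis
    unfolding zigzags_def pull_def mem_Collect_eq PiE_iff Ball_positive
    using lk ob by auto
qed

lemma component_arrow:
  assumes f: "f \<in> zigzag_maps C n" and x: "x \<le> 2 * n"
  shows "component f x \<in> Arr C" "Dom C (component f x) = entry (zz_dom f) x"
    "Cod C (component f x) = entry (zz_cod f) x"
  using zigzag_mapsD(3,4)[OF f] x by (cases x rule: half_cases; auto)+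

lemma component_natural:
  assumes f: "f \<in> zigzag_maps C n" and xy: "zigzag_le x y" "x \<le> 2 * n" "y \<le> 2 * n"
  shows "Comp C (component f y) (link C (zz_dom f) x y) = Comp C (link C (zz_cod f) x y) (component f x)"
  using xy(1)
proof (cases rule: zigzag_le_cases)
  case 1
  then show ?thesis using component_arrow[OF f xy(2)] Comp_Ide Ide_Comp by (metis half_simps(5))
next
  case (2 j)
  then show ?thesis using zigzag_mapsD(4)[OF f, of "Suc j"] xy by auto
next
  case (3 j)
  have "component f (2 * Suc j) = bar_map f (Suc j)" by (rule half_simps)
  then show ?thesis using zigzag_mapsD(4)[OF f, of "Suc j"] xy unfolding 3 link_down by auto
qed

lemma assemble_zigzag_maps:
  assumes YZ: "Y \<in> zigzags C n" "Z \<in> zigzags C n"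
    and c: "\<And>x. x \<le> 2 * n \<Longrightarrow> c x \<in> Arr C \<and> Dom C (c x) = entry Y x \<and> Cod C (c x) = entry Z x"
    and nat: "\<And>x y. zigzag_le x y \<Longrightarrow> x \<le> 2 * n \<Longrightarrow> y \<le> 2 * n \<Longrightarrow>
      Comp C (c y) (link C Y x y) = Comp C (link C Z x y) (c x)"
  shows "assemble n Y Z c \<in> zigzag_maps C n"
proof -
  have s: "link C Y (Suc (Suc (2 * j))) (Suc (2 * j)) = bwd Y (Suc j)" for Y :: "('o, 'm) zigzag" and j
    using link_down[of C Y j] by simp
  have "Comp C (c (Suc (2 * j))) (fwd Y (Suc j)) = Comp C (fwd Z (Suc j)) (c (2 * j)) \<and>
     Comp C (c (Suc (2 * j))) (bwd Y (Suc j)) = Comp C (bwd Z (Suc j)) (c (Suc (Suc (2 * j))))" if "j < n" for j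
    using nat[of "2 * j" "Suc (2 * j)"] nat[of "Suc (Suc (2 * j))" "Suc (2 * j)"] that by (simp add: s)
  moreover have "c (2 * j) \<in> Arr C \<and> Dom C (c (2 * j)) = bar Y j \<and> Cod C (c (2 * j)) = bar Z j" if "j \<le> n" for j
    using c[of "2 * j"] that by simp
  moreover have "c (Suc (2 * j)) \<in> Arr C \<and> Dom C (c (Suc (2 * j))) = mid Y (Suc j) \<and> Cod C (c (Suc (2 * j))) = mid Z (Suc j)"
    if "j < n" for j using c[of "Suc (2 * j)"] that by simp
  ultimately show ?thesis
    unfolding zigzag_maps_def assemble_def mem_Collect_eq PiE_iff Ball_positive
    using YZ by simp
qed

end


section \<open>Cutting zig-zags\<close>

lemma zigzag_le_min_left: "zigzag_le x y \<Longrightarrow> zigzag_le (min z x) (min z y)"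
  and zigzag_le_min_right: "zigzag_le x y \<Longrightarrow> zigzag_le (min x z) (min y z)"
  unfolding zigzag_le_def min_def by presburger+

lemma zigzag_mono_min: "zigzag_mono n n (min z)"
  by (auto simp: zigzag_mono_def zigzag_le_min_left)

lemma Delta_simps [simp]:
  "Dom Delta (m, \<phi>, n) = m" "Cod Delta (m, \<phi>, n) = n" "Ide Delta n = (n, (\<lambda>i\<in>{..n}. i), n)"
  "Comp Delta (n', \<psi>, l) (m, \<phi>, n) = (m, compose {..m} \<psi> \<phi>, l)"
  by (simp_all add: Delta_def)

lemma Lambda_simps [simp]:
  "Obj (Lambda D n) = zigzags D n" "Arr (Lambda D n) = zigzag_maps D n" "Dom (Lambda D n) = zz_dom"
  "Cod (Lambda D n) = zz_cod"
  "zz_dom (Ide (Lambda D n) Y) = Y" "zz_cod (Ide (Lambda D n) Y) = Y"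
  "zz_dom (Comp (Lambda D n) g f) = zz_dom f" "zz_cod (Comp (Lambda D n) g f) = zz_cod g"
  by (simp_all add: Lambda_def)

lemma assemble_simps [simp]: "zz_dom (assemble n Y Z c) = Y" "zz_cod (assemble n Y Z c) = Z"
  by (simp_all add: assemble_def)

lemma Lambda_arr_simps [simp]:
  "zz_dom (Lambda_arr D (m, \<phi>, n) f) = Lambda_obj D (m, \<phi>, n) (zz_dom f)"
  "zz_cod (Lambda_arr D (m, \<phi>, n) f) = Lambda_obj D (m, \<phi>, n) (zz_cod f)"
  by (simp_all add: Lambda_arr_def Let_def)

locale Lambda_setting = category D for D :: "('o, 'm) cat" +
  fixes J :: "(nat, ord_map) cat"
  assumes J: "J \<in> {Delta_inj, Delta_le}"
begin

abbreviation "E \<equiv> Lambda_star J D"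

lemma category_D: "category D" by (rule category_axioms)

lemma category_E: "category E" by (rule category_Lambda_star[OF category_D J])

sublocale J: category J by (rule Delta_star_cases(1)[OF J])

sublocale E: category E by (rule category_E)

lemma J_simps [simp]: "Obj J = UNIV" "Dom J = Dom Delta" "Cod J = Cod Delta" "Ide J = Ide Delta"
    "Comp J = Comp Delta"
  using Delta_star_cases[OF J] by auto

lemma J_inj: "(m, \<phi>, n) \<in> Arr J \<Longrightarrow> (m, \<phi>, n) \<in> Arr Delta_inj"
  using Delta_star_cases(2)[OF J] by blast

lemma J_strict: "(m, \<phi>, n) \<in> Arr J \<Longrightarrow> strict_mono_on {..m} \<phi>"
  using J_inj by simp

lemma E_Obj: "(n, Y) \<in> Obj E \<longleftrightarrow> Y \<in> zigzags D n"
  by (simp add: Lambda_star_def grothendieck_def)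

lemma E_Arr: "(Y, (m, \<phi>, n), f) \<in> Arr E \<longleftrightarrow> (m, \<phi>, n) \<in> Arr J \<and> Y \<in> zigzags D m \<and> f \<in> zigzag_maps D n \<and>
    zz_dom f = pull D n (pad_index m \<phi>) Y"
  using J_strict[of m \<phi> n] by (auto simp: Lambda_star_def grothendieck_def Lambda_functor_def Lambda_obj_eq_pull)

lemma E_simps:
  "Dom E (Y, (m, \<phi>, n), f) = (m, Y)" "Cod E (Y, (m, \<phi>, n), f) = (n, zz_cod f)"
  "Ide E (n, Y) = (Y, Ide J n, Ide (Lambda D n) Y)"
  by (simp_all add: Lambda_star_def grothendieck_def)

lemma E_Comp:
  "f \<in> zigzag_maps D n \<Longrightarrow> Comp E (Z, (n, \<psi>, l), g) (Y, (m, \<phi>, n), f)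
    = (Y, (m, compose {..m} \<psi> \<phi>, l), Comp (Lambda D l) g (Lambda_arr D (n, \<psi>, l) f))"
  by (simp add: Lambda_star_def grothendieck_def Lambda_functor_def)

definition length_functor where
  "length_functor = \<lparr>obj_map = (\<lambda>(n, Y)\<in>Obj E. n), arr_map = (\<lambda>(Y, \<phi>, f)\<in>Arr E. \<phi>)\<rparr>"

lemma is_functor_length: "is_functor E Delta_inj length_functor"
proof -
  have o: "obj_map length_functor X \<in> Obj Delta_inj" for X by (simp add: Delta_inj_def Delta_def)
  have a: "arr_map length_functor u \<in> Arr Delta_inj \<and> Dom Delta_inj (arr_map length_functor u) = obj_map length_functor (Dom E u)
     \<and> Cod Delta_inj (arr_map length_functor u) = obj_map length_functor (Cod E u)" if u: "u \<in> Arr E" for u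
  proof -
    obtain Y m \<phi> n f where [simp]: "u = (Y, (m, \<phi>, n), f)" by (metis surj_pair)
    show ?thesis using u J_inj[of m \<phi> n] E.Dom_Obj[OF u] E.Cod_Obj[OF u]
      by (simp add: length_functor_def E_simps) (simp add: E_Arr)
  qed
  have i: "arr_map length_functor (Ide E X) = Ide Delta_inj (obj_map length_functor X)" if X: "X \<in> Obj E" for X
  proof -
    obtain n Y where [simp]: "X = (n, Y)" by (cases X)
    show ?thesis using E.Ide_Arr[OF X] X by (simp add: length_functor_def E_simps)
  qed
  have c: "arr_map length_functor (Comp E v u) = Comp Delta_inj (arr_map length_functor v) (arr_map length_functor u)"
    if vu: "v \<in> Arr E" "u \<in> Arr E" "Dom E v = Cod E u" for v u
  proof -
    obtain Y m \<phi> n f where [simp]: "u = (Y, (m, \<phi>, n), f)" by (metis surj_pair)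
    obtain Z n' \<psi> l g where [simp]: "v = (Z, (n', \<psi>, l), g)" by (metis surj_pair)
    have [simp]: "n' = n" using vu by (simp add: E_simps)
    have f: "f \<in> zigzag_maps D n" using vu(2) by (simp add: E_Arr)
    show ?thesis using E.Comp_Arr[OF vu] vu by (simp add: length_functor_def E_Comp[OF f])
  qed
  have ext: "obj_map length_functor \<in> extensional (Obj E)" "arr_map length_functor \<in> extensional (Arr E)"
    by (simp_all add: length_functor_def)
  show ?thesis
    unfolding is_functor_def PiE_iff using o a i c ext by blast
qed

sublocale L: stepped_category E length_functor
  by unfold_locales (rule is_functor_length)

lemma height_length [simp]: "Y \<in> zigzags D n \<Longrightarrow> height length_functor (n, Y) = 2 * n"
  by (simp add: height_def length_functor_def E_Obj)

lemma retract_length [simp]: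
  "(Y, (m, \<phi>, n), f) \<in> Arr E \<Longrightarrow> retract length_functor (Y, (m, \<phi>, n), f) = pad_index m \<phi>"
  by (simp add: retract_def length_functor_def embed_def pad_index_def)

text \<open>The zig-zag \<open>Y\<close>, padded along \<open>r\<close> and cut at \<open>z\<close>, has the entry of \<open>Y\<close> in position \<open>min z (r x)\<close>. An
  arrow of \<open>Y\<close> leads from there to position \<open>r (min y x)\<close>, where the component of \<open>g\<close> starts.\<close>

definition cut_component where
  "cut_component Y r z g y x = Comp D (component g (min y x)) (link D Y (min z (r x)) (r (min y x)))"

definition cut_functor where
  "cut_functor = \<lparr>obj_map = (\<lambda>((n, Y), z)\<in>Obj (cut_cat E length_functor). (n, pull D n (min z) Y)),
     arr_map = (\<lambda>(z, (Y, (m, \<phi>, n), g), y)\<in>Arr (cut_cat E length_functor).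
       (pull D m (min z) Y, (m, \<phi>, n),
        assemble n (pull D n (\<lambda>x. min z (pad_index m \<phi> x)) Y) (pull D n (min y) (zz_cod g))
          (cut_component Y (pad_index m \<phi>) z g y)))\<rparr>"

context
  fixes Y m \<phi> n g z y
  assumes u: "(Y, (m, \<phi>, n), g) \<in> Arr E" and z: "z \<le> 2 * m" "y \<le> 2 * n" "zigzag_le z (pad_index m \<phi> y)"
begin

lemma cut_arrD: "(m, \<phi>, n) \<in> Arr J" "Y \<in> zigzags D m" "g \<in> zigzag_maps D n"
    "zz_dom g = pull D n (pad_index m \<phi>) Y" "strict_mono_on {..m} \<phi>" "zz_cod g \<in> zigzags D n"
  using u J_strict zigzag_mapsD(2) by (auto simp: E_Arr)

lemma pad_mono: "zigzag_mono n m (pad_index m \<phi>)"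
  by (rule zigzag_mono_pad_index[OF cut_arrD(5)])

lemma pad_le: "pad_index m \<phi> x \<le> 2 * m"
  unfolding pad_index_def by (rule last_index_le)

lemma pad_min: "pad_index m \<phi> (min x x') = min (pad_index m \<phi> x) (pad_index m \<phi> x')"
  unfolding pad_index_def using last_index_mono by (auto simp: min_def le_antisym)

lemma pad_zigzag_le: "zigzag_le x x' \<Longrightarrow> zigzag_le (pad_index m \<phi> x) (pad_index m \<phi> x')"
  unfolding pad_index_def by (rule zigzag_le_last_index[OF parity_embedding_double[OF cut_arrD(5)]])

lemma cut_step: "zigzag_le (min z (pad_index m \<phi> x)) (pad_index m \<phi> (min y x))"
  unfolding pad_min by (rule zigzag_le_min_right[OF z(3)])

lemma cut_component_arrow:
  assumes x: "x \<le> 2 * n"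
  shows "cut_component Y (pad_index m \<phi>) z g y x \<in> Arr D"
    "Dom D (cut_component Y (pad_index m \<phi>) z g y x) = entry Y (min z (pad_index m \<phi> x))"
    "Cod D (cut_component Y (pad_index m \<phi>) z g y x) = entry (zz_cod g) (min y x)"
proof -
  note l = link_arrow[OF cut_arrD(2) cut_step[of x]]
  have "min z (pad_index m \<phi> x) \<le> 2 * m" using z by simp
  note l = l[OF this pad_le]
  have xy: "min y x \<le> 2 * n" using z by simp
  note c = component_arrow[OF cut_arrD(3) xy]
  have "Dom D (component g (min y x)) = entry Y (pad_index m \<phi> (min y x))"
    using c(2) xy by (simp add: cut_arrD(4) entry_pull)
  then show "cut_component Y (pad_index m \<phi>) z g y x \<in> Arr D"
    "Dom D (cut_component Y (pad_index m \<phi>) z g y x) = entry Y (min z (pad_index m \<phi> x))"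
    "Cod D (cut_component Y (pad_index m \<phi>) z g y x) = entry (zz_cod g) (min y x)"
    using l c by (simp_all add: cut_component_def Comp_Arr Dom_Comp Cod_Comp)
qed

text \<open>The components of a map of cuts are restrictions of composites of \<open>g\<close> with arrows of \<open>Y\<close>. As \<open>g\<close> is natural,
  arrows of the codomain can be moved past \<open>g\<close>, and arrows of \<open>Y\<close> then compose to a single one. Both the
  naturality of the components in \<open>x\<close> and their compatibility with composition are instances.\<close>

lemma cut_component_link:
  assumes zx: "zigzag_le x' (min z (pad_index m \<phi> x))" "x' \<le> 2 * m"
    and xw: "zigzag_le (min y x) w" and x: "x \<le> 2 * n" "w \<le> 2 * n"
  shows "Comp D (link D (zz_cod g) (min y x) w) (Comp D (cut_component Y (pad_index m \<phi>) z g y x) (link D Y x' (min z (pad_index m \<phi> x))))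
    = Comp D (component g w) (link D Y x' (pad_index m \<phi> w))"
proof -
  let ?r = "pad_index m \<phi>"
  have xy: "min y x \<le> 2 * n" using z by simp
  have mz: "min z (?r x) \<le> 2 * m" using z by simp
  note Y = cut_arrD(2)
  note l1 = link_arrow[OF Y zx(1) zx(2) mz]
  note l2 = link_arrow[OF Y cut_step[of x] mz pad_le]
  note l3 = link_arrow[OF Y pad_zigzag_le[OF xw] pad_le pad_le]
  note c1 = component_arrow[OF cut_arrD(3) xy]
  note c2 = component_arrow[OF cut_arrD(3) x(2)]
  note l4 = link_arrow[OF cut_arrD(6) xw xy x(2)]
  have d: "entry (zz_dom g) (min y x) = entry Y (?r (min y x))" "entry (zz_dom g) w = entry Y (?r w)"
    using xy x by (simp_all add: cut_arrD(4) entry_pull)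
  have nat: "Comp D (component g w) (link D Y (?r (min y x)) (?r w))
      = Comp D (link D (zz_cod g) (min y x) w) (component g (min y x))"
    using component_natural[OF cut_arrD(3) xw xy x(2)] by (simp add: cut_arrD(4) link_pull[OF xw xy x(2)])
  have "Comp D (link D (zz_cod g) (min y x) w) (Comp D (cut_component Y ?r z g y x) (link D Y x' (min z (?r x))))
    = Comp D (link D (zz_cod g) (min y x) w) (Comp D (component g (min y x))
        (Comp D (link D Y (min z (?r x)) (?r (min y x))) (link D Y x' (min z (?r x)))))"
    using l1 l2 c1 d by (simp add: cut_component_def Comp_assoc)
  also have "\<dots> = Comp D (link D (zz_cod g) (min y x) w) (Comp D (component g (min y x)) (link D Y x' (?r (min y x))))"
    by (simp add: link_link[OF Y zx(1) cut_step[of x] zx(2) mz pad_le])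
  also have "\<dots> = Comp D (Comp D (link D (zz_cod g) (min y x) w) (component g (min y x))) (link D Y x' (?r (min y x)))"
    using l4 c1 d link_arrow[OF Y zigzag_le_trans[OF zx(1) cut_step[of x]] zx(2) pad_le] by (simp add: Comp_assoc)
  also have "\<dots> = Comp D (component g w) (Comp D (link D Y (?r (min y x)) (?r w)) (link D Y x' (?r (min y x))))"
    using l3 c2 d link_arrow[OF Y zigzag_le_trans[OF zx(1) cut_step[of x]] zx(2) pad_le]
    by (simp add: nat[symmetric] Comp_assoc)
  also have "\<dots> = Comp D (component g w) (link D Y x' (?r w))"
    by (simp add: link_link[OF Y zigzag_le_trans[OF zx(1) cut_step[of x]] pad_zigzag_le[OF xw] zx(2) pad_le pad_le])
  finally show ?thesis .
qed

lemma cut_map: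
  "assemble n (pull D n (\<lambda>x. min z (pad_index m \<phi> x)) Y) (pull D n (min y) (zz_cod g))
     (cut_component Y (pad_index m \<phi>) z g y) \<in> zigzag_maps D n"
proof (rule assemble_zigzag_maps)
  let ?r = "pad_index m \<phi>"
  have mono: "zigzag_mono n m (\<lambda>x. min z (?r x))"
    using pad_mono z by (auto simp: zigzag_mono_def zigzag_le_min_left)
  show "pull D n (\<lambda>x. min z (?r x)) Y \<in> zigzags D n"
    using cut_arrD(2) mono by (rule pull_zigzags)
  show "pull D n (min y) (zz_cod g) \<in> zigzags D n"
    using cut_arrD(6) zigzag_mono_min by (rule pull_zigzags)
  show "cut_component Y ?r z g y x \<in> Arr D \<and>
      Dom D (cut_component Y ?r z g y x) = entry (pull D n (\<lambda>x. min z (?r x)) Y) x \<and>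
      Cod D (cut_component Y ?r z g y x) = entry (pull D n (min y) (zz_cod g)) x" if "x \<le> 2 * n" for x
    using cut_component_arrow[OF that] that by (simp add: entry_pull)
  fix x w assume xw: "zigzag_le x w" "x \<le> 2 * n" "w \<le> 2 * n"
  have mx: "min z (?r x) \<le> 2 * m" "min z (?r w) \<le> 2 * m" "min y w \<le> 2 * n" using z by auto
  note zl = zigzag_le_min_left[OF pad_zigzag_le[OF xw(1)]]
  have "Comp D (cut_component Y ?r z g y w) (link D Y (min z (?r x)) (min z (?r w)))
      = Comp D (component g (min y w)) (Comp D (link D Y (min z (?r w)) (?r (min y w))) (link D Y (min z (?r x)) (min z (?r w))))"
    using component_arrow[OF cut_arrD(3) mx(3)] link_arrow[OF cut_arrD(2) cut_step[of w] mx(2) pad_le]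
      link_arrow[OF cut_arrD(2) zl mx(1,2)] mx(3)
    by (simp add: cut_component_def Comp_assoc cut_arrD(4) entry_pull)
  also have "\<dots> = Comp D (component g (min y w)) (link D Y (min z (?r x)) (?r (min y w)))"
    by (simp add: link_link[OF cut_arrD(2) zl cut_step[of w] mx(1,2) pad_le])
  also have "\<dots> = Comp D (link D (zz_cod g) (min y x) (min y w))
      (Comp D (cut_component Y ?r z g y x) (link D Y (min z (?r x)) (min z (?r x))))"
    by (rule cut_component_link[symmetric]) (use mx xw zigzag_le_min_left in auto)
  also have "Comp D (cut_component Y ?r z g y x) (link D Y (min z (?r x)) (min z (?r x))) = cut_component Y ?r z g y x"
    using cut_component_arrow[OF xw(2)] Comp_Ide by (metis half_simps(5))
  finally show "Comp D (cut_component Y ?r z g y w) (link D (pull D n (\<lambda>x. min z (?r x)) Y) x w)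
      = Comp D (link D (pull D n (min y) (zz_cod g)) x w) (cut_component Y ?r z g y x)"
    using xw by (simp add: link_pull)
qed

lemma cut_arr: "(pull D m (min z) Y, (m, \<phi>, n),
   assemble n (pull D n (\<lambda>x. min z (pad_index m \<phi> x)) Y) (pull D n (min y) (zz_cod g))
     (cut_component Y (pad_index m \<phi>) z g y)) \<in> Arr E"
  using cut_map cut_arrD(1) pull_zigzags[OF cut_arrD(2) zigzag_mono_min]
  by (simp add: E_Arr pull_pull[OF pad_mono])

end

lemma cut_functor_obj:
  "Y \<in> zigzags D n \<Longrightarrow> z \<le> 2 * n \<Longrightarrow> obj_map cut_functor ((n, Y), z) = (n, pull D n (min z) Y)"
  by (simp add: cut_functor_def E_Obj)

lemma cut_functor_arr:
  "(z, (Y, (m, \<phi>, n), g), y) \<in> Arr (cut_cat E length_functor) \<Longrightarrow>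
   arr_map cut_functor (z, (Y, (m, \<phi>, n), g), y) = (pull D m (min z) Y, (m, \<phi>, n),
      assemble n (pull D n (\<lambda>x. min z (pad_index m \<phi> x)) Y) (pull D n (min y) (zz_cod g))
        (cut_component Y (pad_index m \<phi>) z g y))"
  by (simp add: cut_functor_def del: cut_cat_simps)

lemma cut_cat_arrD:
  assumes "(z, (Y, (m, \<phi>, n), g), y) \<in> Arr (cut_cat E length_functor)"
  shows "(Y, (m, \<phi>, n), g) \<in> Arr E" "z \<le> 2 * m" "y \<le> 2 * n" "zigzag_le z (pad_index m \<phi> y)"
  using assms zigzag_mapsD(2)[of g D n] by (auto simp: E_simps E_Arr)

text \<open>Both sides have the component \<open>h \<circ> g \<circ> l\<close> at each position, for suitable components of \<open>h\<close> and \<open>g\<close> and the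
  only arrow \<open>l\<close> of \<open>Y\<close> between the positions in question.\<close>

lemma cut_functor_comp:
  assumes u: "(z, (Y, (m, \<phi>, n), g), y) \<in> Arr (cut_cat E length_functor)"
    and v: "(y, (Z, (n, \<psi>, l), h), w) \<in> Arr (cut_cat E length_functor)" and Z: "Z = zz_cod g"
  shows "arr_map cut_functor (Comp (cut_cat E length_functor) (y, (Z, (n, \<psi>, l), h), w) (z, (Y, (m, \<phi>, n), g), y))
    = Comp E (arr_map cut_functor (y, (Z, (n, \<psi>, l), h), w)) (arr_map cut_functor (z, (Y, (m, \<phi>, n), g), y))"
proof -
  note u' = cut_cat_arrD[OF u] and v' = cut_cat_arrD[OF v]
  note Y = cut_arrD[OF u'] and Zv = cut_arrD[OF v']
  let ?r = "pad_index m \<phi>" and ?q = "pad_index n \<psi>"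
  let ?\<omega> = "compose {..m} \<psi> \<phi>"
  let ?gh = "Comp (Lambda D l) h (Lambda_arr D (n, \<psi>, l) g)"
  let ?Ku = "assemble n (pull D n (\<lambda>x. min z (?r x)) Y) (pull D n (min y) Z) (cut_component Y ?r z g y)"
  let ?Kv = "assemble l (pull D l (\<lambda>x. min y (?q x)) Z) (pull D l (min w) (zz_cod h)) (cut_component Z ?q y h w)"
  have EC: "Comp E (Z, (n, \<psi>, l), h) (Y, (m, \<phi>, n), g) = (Y, (m, ?\<omega>, l), ?gh)"
    by (rule E_Comp[OF Y(3)])
  have "Comp (cut_cat E length_functor) (y, (Z, (n, \<psi>, l), h), w) (z, (Y, (m, \<phi>, n), g), y) \<in> Arr (cut_cat E length_functor)"
    using category.Comp_Arr[OF L.category_cut_cat v u] Z by (simp add: E_simps)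
  then have vu: "(z, (Y, (m, ?\<omega>, l), ?gh), w) \<in> Arr (cut_cat E length_functor)"
    by (simp only: cut_cat_simps(6) EC)
  note vu' = cut_cat_arrD[OF vu]
  have "retract length_functor (Y, (m, ?\<omega>, l), ?gh) x = retract length_functor (Y, (m, \<phi>, n), g) (retract length_functor (Z, (n, \<psi>, l), h) x)" for x
    unfolding EC[symmetric] using u'(1) v'(1) Z by (intro L.retract_Comp) (simp_all add: E_simps)
  then have pad: "pad_index m ?\<omega> x = ?r (?q x)" for x using u'(1) v'(1) vu'(1) by simp
  let ?Kvu = "assemble l (pull D l (\<lambda>x. min z (pad_index m ?\<omega> x)) Y) (pull D l (min w) (zz_cod ?gh))
       (cut_component Y (pad_index m ?\<omega>) z ?gh w)"
  let ?KvKu = "Comp (Lambda D l) ?Kv (Lambda_arr D (n, \<psi>, l) ?Ku)"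
  have Ku: "?Ku \<in> zigzag_maps D n" using cut_map[OF u'] Z by simp
  note Kua = cut_arr[OF u', folded Z] and Kva = cut_arr[OF v']
  have comp: "Comp E (pull D n (min y) Z, (n, \<psi>, l), ?Kv) (pull D m (min z) Y, (m, \<phi>, n), ?Ku)
      = (pull D m (min z) Y, (m, ?\<omega>, l), ?KvKu)"
    by (rule E_Comp[OF Ku])
  have "Comp E (pull D n (min y) Z, (n, \<psi>, l), ?Kv) (pull D m (min z) Y, (m, \<phi>, n), ?Ku) \<in> Arr E"
    using Kua Kva by (intro E.Comp_Arr) (simp_all add: E_simps)
  then have KvKu: "?KvKu \<in> zigzag_maps D l" unfolding comp by (simp add: E_Arr)
  have Kvu: "?Kvu \<in> zigzag_maps D l" by (rule cut_map[OF vu'])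
  have "?Kvu = ?KvKu"
  proof (rule zigzag_map_eq_component[OF Kvu KvKu])
    show "zz_dom ?Kvu = zz_dom ?KvKu"
      by (simp add: pad Lambda_obj_eq_pull[OF Zv(5)] pull_pull[OF pad_mono[OF v']])
    show "zz_cod ?Kvu = zz_cod ?KvKu" by simp
    fix x assume x: "x \<le> 2 * l"
    have q: "?q x \<le> 2 * n" by (rule pad_le[OF v'])
    have wx: "min w x \<le> 2 * l" using x by simp
    have mz: "min z (?r (?q x)) \<le> 2 * m" using u' by simp
    have s: "zigzag_le (min y (?q x)) (?q (min w x))" by (rule cut_step[OF v'])
    have "component ?Kvu x = Comp D (Comp D (component h (min w x)) (component g (?q (min w x))))
        (link D Y (min z (?r (?q x))) (?r (?q (min w x))))"
      using x wx
      by (simp add: component_assemble cut_component_def component_Comp component_Lambda_arr[OF Zv(5) wx] pad)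
    also have "\<dots> = Comp D (component h (min w x)) (Comp D (component g (?q (min w x)))
        (link D Y (min z (?r (?q x))) (?r (?q (min w x)))))"
    proof (rule Comp_assoc)
      show "component h (min w x) \<in> Arr D" "component g (?q (min w x)) \<in> Arr D"
        using component_arrow[OF Zv(3) wx] component_arrow[OF Y(3) pad_le[OF v']] by auto
      show "Dom D (component h (min w x)) = Cod D (component g (?q (min w x)))"
        using component_arrow[OF Zv(3) wx] component_arrow[OF Y(3) pad_le[OF v']] wx
        by (simp add: Zv(4) entry_pull Z)
      have zl: "zigzag_le (min z (?r (?q x))) (?r (?q (min w x)))"
        using cut_step[OF vu', of x] by (simp add: pad)
      note la = link_arrow[OF Y(2) zl mz pad_le[OF u']]
      show "link D Y (min z (?r (?q x))) (?r (?q (min w x))) \<in> Arr D" by (rule la)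
      show "Dom D (component g (?q (min w x))) = Cod D (link D Y (min z (?r (?q x))) (?r (?q (min w x))))"
        using component_arrow[OF Y(3) pad_le[OF v']] la(3) pad_le[OF v'] by (simp add: Y(4) entry_pull)
    qed
    also have "Comp D (component g (?q (min w x))) (link D Y (min z (?r (?q x))) (?r (?q (min w x))))
      = Comp D (link D Z (min y (?q x)) (?q (min w x)))
          (Comp D (cut_component Y ?r z g y (?q x)) (link D Y (min z (?r (?q x))) (min z (?r (?q x)))))"
      unfolding Z by (rule cut_component_link[OF u', symmetric]) (use mz s q pad_le[OF v'] in auto)
    also have "Comp D (cut_component Y ?r z g y (?q x)) (link D Y (min z (?r (?q x))) (min z (?r (?q x))))
      = cut_component Y ?r z g y (?q x)"
      using cut_component_arrow[OF u' q] Comp_Ide by (metis half_simps(5))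
    also have "Comp D (component h (min w x)) (Comp D (link D Z (min y (?q x)) (?q (min w x))) (cut_component Y ?r z g y (?q x)))
      = Comp D (cut_component Z ?q y h w x) (cut_component Y ?r z g y (?q x))"
    proof -
      have my: "min y (?q x) \<le> 2 * n" using q by simp
      note la = link_arrow[OF Zv(2) s my pad_le[OF v']]
      show ?thesis
        using component_arrow[OF Zv(3) wx] la cut_component_arrow[OF u' q] wx
        by (simp add: cut_component_def[of "zz_cod g"] Comp_assoc Zv(4) entry_pull Z)
    qed
    also have "\<dots> = component ?KvKu x"
      using x q by (simp add: component_Comp component_assemble component_Lambda_arr[OF Zv(5) x])
    finally show "component ?Kvu x = component ?KvKu x" .
  qed
  then show ?thesis
    unfolding cut_cat_simps(6) EC cut_functor_arr[OF u, folded Z] cut_functor_arr[OF v] cut_functor_arr[OF vu]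
    by (simp only: comp)
qed

lemma pad_index_ident: "x \<le> 2 * n \<Longrightarrow> pad_index n (\<lambda>i\<in>{..n}. i) x = x"
  unfolding pad_index_def by (rule last_index_eqI) (auto simp: double_ident[of n])

lemma is_functor_cut: "is_functor (cut_cat E length_functor) E cut_functor"
proof -
  let ?C = "cut_cat E length_functor"
  have o: "obj_map cut_functor X \<in> Obj E" if "X \<in> Obj ?C" for X
  proof -
    obtain n Y z where [simp]: "X = ((n, Y), z)" by (metis surj_pair)
    have "Y \<in> zigzags D n" "z \<le> 2 * n" using that by (auto simp: E_Obj)
    then show ?thesis by (simp add: cut_functor_obj E_Obj pull_zigzags[OF _ zigzag_mono_min])
  qed
  have a: "arr_map cut_functor u \<in> Arr E \<and> Dom E (arr_map cut_functor u) = obj_map cut_functor (Dom ?C u) \<and>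
     Cod E (arr_map cut_functor u) = obj_map cut_functor (Cod ?C u)" if u: "u \<in> Arr ?C" for u
  proof -
    obtain z Y m \<phi> n g y where ueq: "u = (z, (Y, (m, \<phi>, n), g), y)" by (metis surj_pair)
    note u = u[unfolded ueq]
    note u' = cut_cat_arrD[OF u]
    show ?thesis
      using cut_arr[OF u'] u' cut_arrD[OF u'] unfolding ueq cut_functor_arr[OF u]
      by (simp add: E_simps cut_functor_obj)
  qed
  have i: "arr_map cut_functor (Ide ?C X) = Ide E (obj_map cut_functor X)" if X: "X \<in> Obj ?C" for X
  proof -
    obtain n Y z where [simp]: "X = ((n, Y), z)" by (metis surj_pair)
    have Y: "Y \<in> zigzags D n" "z \<le> 2 * n" using X by (auto simp: E_Obj)
    let ?i = "\<lambda>i\<in>{..n}. i"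
    have "Ide ?C X = (z, (Y, (n, ?i, n), Ide (Lambda D n) Y), z)" by (simp add: E_simps)
    then have u: "(z, (Y, (n, ?i, n), Ide (Lambda D n) Y), z) \<in> Arr ?C"
      using category.Ide_Arr[OF L.category_cut_cat X] by (simp only:)
    note u' = cut_cat_arrD[OF u]
    have p: "pull D n (min z) Y \<in> zigzags D n" by (rule pull_zigzags[OF Y(1) zigzag_mono_min])
    have pc: "pull D n (\<lambda>x. min z (pad_index n ?i x)) Y = pull D n (min z) Y"
      by (rule pull_cong) (simp add: pad_index_ident)
    have "assemble n (pull D n (\<lambda>x. min z (pad_index n ?i x)) Y) (pull D n (min z) Y)
       (cut_component Y (pad_index n ?i) z (Ide (Lambda D n) Y) z) = Ide (Lambda D n) (pull D n (min z) Y)" (is "?f = _")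
    proof (rule zigzag_map_eq_component)
      show "?f \<in> zigzag_maps D n" using cut_map[OF u'] by simp
      show "Ide (Lambda D n) (pull D n (min z) Y) \<in> zigzag_maps D n"
        using category.Ide_Arr[OF category_Lambda[OF category_D, of n]] p by simp
      show "component ?f x = component (Ide (Lambda D n) (pull D n (min z) Y)) x" if x: "x \<le> 2 * n" for x
      proof -
        have "entry Y (min z x) \<in> Obj D" using entry_Obj[OF Y(1)] x by simp
        then have "Comp D (Ide D (entry Y (min z x))) (Ide D (entry Y (min z x))) = Ide D (entry Y (min z x))"
          using Comp_Ide[OF Ide_Arr] Dom_Ide by metis
        then show ?thesis
          using x by (simp add: component_assemble component_Ide entry_pull cut_component_def pad_index_ident)
      qed
    qed (simp_all add: pc)
    then show ?thesis using cut_functor_arr[OF u] Y by (simp add: E_simps cut_functor_obj)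
  qed
  have c: "arr_map cut_functor (Comp ?C v u) = Comp E (arr_map cut_functor v) (arr_map cut_functor u)"
    if vu: "v \<in> Arr ?C" "u \<in> Arr ?C" "Dom ?C v = Cod ?C u" for v u
  proof -
    obtain z Y m \<phi> n g y where u: "u = (z, (Y, (m, \<phi>, n), g), y)" by (metis surj_pair)
    obtain y' Z n' \<psi> l h w where v: "v = (y', (Z, (n', \<psi>, l), h), w)" by (metis surj_pair)
    have e: "y' = y" "n' = n" "Z = zz_cod g" using vu(3) by (auto simp: u v E_simps)
    show ?thesis
      using vu unfolding u v e by (intro cut_functor_comp) auto
  qed
  have ext: "obj_map cut_functor \<in> extensional (Obj ?C)" "arr_map cut_functor \<in> extensional (Arr ?C)"
    by (simp_all add: cut_functor_def)
  show ?thesis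
    unfolding is_functor_def PiE_iff using o a i c ext by blast
qed

lemma cut_functor_top: "fcomp E cut_functor (top_cut E length_functor) = fident E"
proof (rule functor_eqI[of E E])
  show "is_functor E E (fcomp E cut_functor (top_cut E length_functor))"
    by (rule is_functor_fcomp[OF category_E L.is_functor_top_cut is_functor_cut])
  show "is_functor E E (fident E)"
    by (auto simp: is_functor_def fident_def E.Ide_Arr E.Comp_Arr E.Dom_Obj E.Cod_Obj)
  show "obj_map (fcomp E cut_functor (top_cut E length_functor)) X = obj_map (fident E) X" if X: "X \<in> Obj E" for X
  proof -
    obtain n Y where [simp]: "X = (n, Y)" by (cases X)
    have Y: "Y \<in> zigzags D n" using X by (simp add: E_Obj)
    then have "pull D n (min (2 * n)) Y = Y" by (intro pull_ident) auto
    then show ?thesis using X Y by (simp add: fcomp_apply top_cut_def cut_functor_obj fident_def)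
  qed
  show "arr_map (fcomp E cut_functor (top_cut E length_functor)) u = arr_map (fident E) u" if u: "u \<in> Arr E" for u
  proof -
    obtain Y m \<phi> n g where ueq [simp]: "u = (Y, (m, \<phi>, n), g)" by (metis surj_pair)
    have top: "arr_map (top_cut E length_functor) u = (2 * m, u, 2 * n)"
      using u zigzag_mapsD(2)[of g D n] by (auto simp: top_cut_def E_simps E_Arr)
    have "arr_map (top_cut E length_functor) u \<in> Arr (cut_cat E length_functor)"
      using functorD(2)[OF L.is_functor_top_cut u] .
    then have v: "(2 * m, (Y, (m, \<phi>, n), g), 2 * n) \<in> Arr (cut_cat E length_functor)"
      unfolding top unfolding ueq .
    note v' = cut_cat_arrD[OF v]
    note Y = cut_arrD[OF v']
    have 1: "pull D m (min (2 * m)) Y = Y" using Y by (intro pull_ident) auto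
    have 2: "pull D n (min (2 * n)) (zz_cod g) = zz_cod g" using Y by (intro pull_ident) auto
    have 3: "pull D n (\<lambda>x. min (2 * m) (pad_index m \<phi> x)) Y = zz_dom g"
      unfolding Y(4) by (rule pull_cong) (simp add: pad_le[OF v'] min_absorb2)
    have "assemble n (pull D n (\<lambda>x. min (2 * m) (pad_index m \<phi> x)) Y) (pull D n (min (2 * n)) (zz_cod g))
       (cut_component Y (pad_index m \<phi>) (2 * m) g (2 * n)) = g" (is "?f = _")
    proof (rule zigzag_map_eq_component[OF cut_map[OF v'] Y(3)])
      show "component ?f x = component g x" if x: "x \<le> 2 * n" for x
      proof -
        have "Dom D (component g x) = entry Y (pad_index m \<phi> x)"
          using component_arrow[OF Y(3) x] x by (simp add: Y(4) entry_pull)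
        then have "Comp D (component g x) (Ide D (entry Y (pad_index m \<phi> x))) = component g x"
          using Comp_Ide[OF component_arrow(1)[OF Y(3) x]] by simp
        then show ?thesis
          using x by (simp add: component_assemble cut_component_def pad_le[OF v'] min_absorb2)
      qed
    qed (simp_all add: 2 3)
    then show ?thesis
      using u cut_functor_arr[OF v] top 1 by (simp add: fcomp_apply fident_def)
  qed
qed


section \<open>Constant zig-zags\<close>

definition const_zigzag :: "nat \<Rightarrow> 'o \<Rightarrow> ('o, 'm) zigzag" where
  "const_zigzag k X = \<lparr>bar = (\<lambda>j\<in>{..k}. X), mid = (\<lambda>j\<in>{1..k}. X),
     fwd = (\<lambda>j\<in>{1..k}. Ide D X), bwd = (\<lambda>j\<in>{1..k}. Ide D X)\<rparr>"

definition const_map :: "nat \<Rightarrow> 'm \<Rightarrow> ('o, 'm) zigzag_map" where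
  "const_map k f = assemble k (const_zigzag k (Dom D f)) (const_zigzag k (Cod D f)) (\<lambda>x. f)"

lemma entry_const: "x \<le> 2 * k \<Longrightarrow> entry (const_zigzag k X) x = X"
  by (cases x rule: half_cases) (auto simp: const_zigzag_def)

lemma const_zigzag_zigzags: "X \<in> Obj D \<Longrightarrow> const_zigzag k X \<in> zigzags D k"
  by (auto simp: const_zigzag_def zigzags_def Ide_Arr Dom_Ide Cod_Ide)

lemma pull_0: "pull D n (\<lambda>x. 0) Y = const_zigzag n (bar Y 0)"
  by (simp add: pull_def const_zigzag_def entry_def)

lemma link_const:
  assumes "zigzag_le x y" "x \<le> 2 * k" "y \<le> 2 * k"
  shows "link D (const_zigzag k X) x y = Ide D X"
  using assms(1)
proof (cases rule: zigzag_le_cases)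
  case 1
  then show ?thesis using assms by (simp add: entry_const)
next
  case (2 j)
  then show ?thesis using assms by (simp add: const_zigzag_def)
next
  case (3 j)
  then show ?thesis using assms unfolding 3 link_down by (simp add: const_zigzag_def)
qed

lemma pull_const:
  assumes "zigzag_mono n m \<rho>"
  shows "pull D n \<rho> (const_zigzag m X) = const_zigzag n X"
proof -
  have le: "\<rho> x \<le> 2 * m" if "x \<le> 2 * n" for x using assms that by (simp add: zigzag_mono_def)
  have zle: "zigzag_le (\<rho> (2 * j)) (\<rho> (Suc (2 * j)))" "zigzag_le (\<rho> (Suc (Suc (2 * j)))) (\<rho> (Suc (2 * j)))" if "j < n" for j
    using assms that zigzag_le_steps[of j] by (auto simp: zigzag_mono_def)
  show ?thesis
    unfolding pull_def const_zigzag_def[of n]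
    by (intro zigzag_eqI) (simp_all add: entry_const link_const le zle)
qed

lemma const_map_simps [simp]:
  "zz_dom (const_map k f) = const_zigzag k (Dom D f)" "zz_cod (const_map k f) = const_zigzag k (Cod D f)"
  by (simp_all add: const_map_def)

lemma component_const: "x \<le> 2 * k \<Longrightarrow> component (const_map k f) x = f"
  by (simp add: const_map_def component_assemble)

lemma const_map_maps: "f \<in> Arr D \<Longrightarrow> const_map k f \<in> zigzag_maps D k"
  unfolding const_map_def
  by (rule assemble_zigzag_maps)
    (auto simp: const_zigzag_zigzags Dom_Obj Cod_Obj entry_const link_const Comp_Ide Ide_Comp)

text \<open>Since padding preserves constant zig-zags, a length and an object of \<open>D\<close> may be chosen
  independently of each other.\<close>

definition constant_functor where
  "constant_functor C S U = \<lparr>obj_map = (\<lambda>X\<in>Obj C. (obj_map S X, const_zigzag (obj_map S X) (obj_map U X))),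
     arr_map = (\<lambda>f\<in>Arr C. (const_zigzag (obj_map S (Dom C f)) (obj_map U (Dom C f)), arr_map S f,
        const_map (obj_map S (Cod C f)) (arr_map U f)))\<rparr>"

lemma is_functor_constant:
  assumes C: "category C" and S: "is_functor C J S" and U: "is_functor C D U"
  shows "is_functor C E (constant_functor C S U)"
proof -
  interpret C: category C by fact
  let ?K = "constant_functor C S U"
  have arrS: "\<exists>\<phi>. arr_map S f = (obj_map S (Dom C f), \<phi>, obj_map S (Cod C f)) \<and>
      (obj_map S (Dom C f), \<phi>, obj_map S (Cod C f)) \<in> Arr J" if f: "f \<in> Arr C" for f
  proof -
    obtain m \<phi> n where e: "arr_map S f = (m, \<phi>, n)" by (cases "arr_map S f")
    show ?thesis using functorD(2-4)[OF S f] by (simp add: e)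
  qed
  have o: "obj_map ?K X \<in> Obj E" if "X \<in> Obj C" for X
    using that functorD(1)[OF U that] by (simp add: constant_functor_def E_Obj const_zigzag_zigzags)
  have a: "arr_map ?K f \<in> Arr E \<and> Dom E (arr_map ?K f) = obj_map ?K (Dom C f) \<and>
      Cod E (arr_map ?K f) = obj_map ?K (Cod C f)" if f: "f \<in> Arr C" for f
  proof -
    obtain \<phi> where \<phi>: "arr_map S f = (obj_map S (Dom C f), \<phi>, obj_map S (Cod C f))"
      "(obj_map S (Dom C f), \<phi>, obj_map S (Cod C f)) \<in> Arr J" using arrS[OF f] by blast
    show ?thesis
      using \<phi> f functorD(1-4)[OF U] C.Dom_Obj[OF f] C.Cod_Obj[OF f]
        pull_const[OF zigzag_mono_pad_index[OF J_strict[OF \<phi>(2)]]]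
      by (simp add: constant_functor_def E_Arr E_simps const_zigzag_zigzags const_map_maps)
  qed
  have i: "arr_map ?K (Ide C X) = Ide E (obj_map ?K X)" if X: "X \<in> Obj C" for X
  proof -
    have "const_map k (Ide D Y) = Ide (Lambda D k) (const_zigzag k Y)" if Y: "Y \<in> Obj D" for k Y
    proof (rule zigzag_map_eq_component)
      show "const_map k (Ide D Y) \<in> zigzag_maps D k" by (rule const_map_maps[OF Ide_Arr[OF Y]])
      show "Ide (Lambda D k) (const_zigzag k Y) \<in> zigzag_maps D k"
        using category.Ide_Arr[OF category_Lambda[OF category_D, of k]] const_zigzag_zigzags[OF Y] by simp
    qed (use Y in \<open>simp_all add: Dom_Ide Cod_Ide component_const component_Ide entry_const\<close>)
    then show ?thesis
      using X functorD(5)[OF S X] functorD(5)[OF U X] functorD(1)[OF U X]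
      by (simp add: constant_functor_def E_simps C.Ide_Arr C.Dom_Ide C.Cod_Ide)
  qed
  have c: "arr_map ?K (Comp C g f) = Comp E (arr_map ?K g) (arr_map ?K f)"
    if gf: "g \<in> Arr C" "f \<in> Arr C" "Dom C g = Cod C f" for g f
  proof -
    obtain \<phi> where \<phi>: "arr_map S f = (obj_map S (Dom C f), \<phi>, obj_map S (Cod C f))"
      using arrS[OF gf(2)] by blast
    obtain \<psi> where \<psi>: "arr_map S g = (obj_map S (Cod C f), \<psi>, obj_map S (Cod C g))"
      "(obj_map S (Cod C f), \<psi>, obj_map S (Cod C g)) \<in> Arr J" using arrS[OF gf(1)] gf(3) by auto
    let ?f = "arr_map U f" and ?g = "arr_map U g" and ?n = "obj_map S (Cod C f)" and ?l = "obj_map S (Cod C g)"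
    have U': "?f \<in> Arr D" "?g \<in> Arr D" "Dom D ?g = Cod D ?f" "arr_map U (Comp C g f) = Comp D ?g ?f"
      using functorD(2-4,6)[OF U] gf by auto
    note sm = J_strict[OF \<psi>(2)]
    note L = category_Lambda[OF category_D, of ?l]
    have La: "Lambda_arr D (?n, \<psi>, ?l) (const_map ?n ?f) \<in> zigzag_maps D ?l"
      using const_map_maps[OF U'(1)] J_inj[OF \<psi>(2)] by (intro Lambda_arr_zigzag_maps[OF category_D])
    have co: "Lambda_obj D (?n, \<psi>, ?l) (const_zigzag ?n X) = const_zigzag ?l X" for X
      using pull_const[OF zigzag_mono_pad_index[OF sm]] by (simp add: Lambda_obj_eq_pull[OF sm])
    have "const_map ?l (Comp D ?g ?f) = Comp (Lambda D ?l) (const_map ?l ?g) (Lambda_arr D (?n, \<psi>, ?l) (const_map ?n ?f))"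
    proof (rule zigzag_map_eq_component)
      show "const_map ?l (Comp D ?g ?f) \<in> zigzag_maps D ?l" by (rule const_map_maps[OF Comp_Arr[OF U'(2,1,3)]])
      show "Comp (Lambda D ?l) (const_map ?l ?g) (Lambda_arr D (?n, \<psi>, ?l) (const_map ?n ?f)) \<in> zigzag_maps D ?l"
        using category.Comp_Arr[OF L, of "const_map ?l ?g"] const_map_maps[OF U'(2)] La U'(3) co by simp
      have "pad_index ?n \<psi> x \<le> 2 * ?n" for x unfolding pad_index_def by (rule last_index_le)
      then show "component (const_map ?l (Comp D ?g ?f)) x
        = component (Comp (Lambda D ?l) (const_map ?l ?g) (Lambda_arr D (?n, \<psi>, ?l) (const_map ?n ?f))) x"
        if "x \<le> 2 * ?l" for x
        using that by (simp add: component_Comp component_const component_Lambda_arr[OF sm])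
    qed (use U' co in \<open>simp_all add: Dom_Comp Cod_Comp\<close>)
    then show ?thesis
      using gf \<phi> \<psi> functorD(6)[OF S gf] U'
      by (simp add: constant_functor_def C.Comp_Arr C.Dom_Comp C.Cod_Comp E_Comp[OF const_map_maps[OF U'(1)]])
  qed
  have ext: "obj_map ?K \<in> extensional (Obj C)" "arr_map ?K \<in> extensional (Arr C)"
    by (simp_all add: constant_functor_def)
  show ?thesis
    unfolding is_functor_def PiE_iff using o a i c ext by blast
qed

end


section \<open>From constant zig-zags to length zero\<close>

context stepped_category
begin

definition forget_cut where
  "forget_cut = \<lparr>obj_map = (\<lambda>(X, z)\<in>Obj (cut_cat C P). X), arr_map = (\<lambda>(z, f, y)\<in>Arr (cut_cat C P). f)\<rparr>"

lemma is_functor_forget_cut: "is_functor (cut_cat C P) C forget_cut"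
proof -
  let ?C = "cut_cat C P"
  have c: "arr_map forget_cut (Comp ?C g f) = Comp C (arr_map forget_cut g) (arr_map forget_cut f)"
    if gf: "g \<in> Arr ?C" "f \<in> Arr ?C" "Dom ?C g = Cod ?C f" for g f
    using category.Comp_Arr[OF category_cut_cat gf] gf
    by (cases g, cases f) (simp add: forget_cut_def)
  have i: "arr_map forget_cut (Ide ?C X) = Ide C (obj_map forget_cut X)" if X: "X \<in> Obj ?C" for X
    using category.Ide_Arr[OF category_cut_cat X] X by (cases X) (simp add: forget_cut_def)
  have a: "arr_map forget_cut f \<in> Arr C \<and> Dom C (arr_map forget_cut f) = obj_map forget_cut (Dom ?C f) \<and>
     Cod C (arr_map forget_cut f) = obj_map forget_cut (Cod ?C f)" if f: "f \<in> Arr ?C" for f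
    using category.Dom_Obj[OF category_cut_cat f] category.Cod_Obj[OF category_cut_cat f] f
    by (cases f) (simp add: forget_cut_def)
  have o: "obj_map forget_cut X \<in> Obj C" if X: "X \<in> Obj ?C" for X
    using X by (cases X) (simp add: forget_cut_def)
  have ext: "obj_map forget_cut \<in> extensional (Obj ?C)" "arr_map forget_cut \<in> extensional (Arr ?C)"
    by (simp_all add: forget_cut_def)
  show ?thesis
    unfolding is_functor_def PiE_iff using o a i c ext by blast
qed

text \<open>A natural family of cuts, given as a functor \<open>K\<close>, relates its two extreme members.\<close>

lemma homotopic_cut_ends:
  assumes K: "is_functor (cut_cat C P) E K"
  shows "homotopic_with (\<lambda>_. True) (classifying_space C) (classifying_space E)
    (classifying_map E (fcomp C K (bottom_cut C))) (classifying_map E (fcomp C K (top_cut C P)))"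
proof (rule homotopic_with_eq)
  show "homotopic_with (\<lambda>_. True) (classifying_space C) (classifying_space E)
    (classifying_map E K \<circ> classifying_map (cut_cat C P) (bottom_cut C))
    (classifying_map E K \<circ> classifying_map (cut_cat C P) (top_cut C P))"
    by (rule homotopic_with_compose_continuous_map_left[OF homotopic_bottom_top_cut
        continuous_map_classifying_map[OF K]]) auto
  show "classifying_map E (fcomp C K (bottom_cut C)) x
      = (classifying_map E K \<circ> classifying_map (cut_cat C P) (bottom_cut C)) x"
    "classifying_map E (fcomp C K (top_cut C P)) x
      = (classifying_map E K \<circ> classifying_map (cut_cat C P) (top_cut C P)) x"
    if "x \<in> topspace (classifying_space C)" for x
    using that classifying_map_fcomp[OF category_axioms is_functor_bottom_cut category_cut_cat K]
      classifying_map_fcomp[OF category_axioms is_functor_top_cut category_cut_cat K] by simp_all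
qed auto

end

text \<open>The lengths at the stages \<open>0, 1, 2\<close> of a zig-zag \<open>[0] \<rightarrow> \<cdot> \<leftarrow> [n]\<close> of functors in \<open>[n]\<close>. The flag
  tells whether the middle stage is \<open>[n + 1]\<close>, with a new first element, or \<open>[n]\<close>.\<close>

definition stage_length :: "bool \<Rightarrow> nat \<Rightarrow> nat \<Rightarrow> nat" where
  "stage_length b z n = (if z = 0 then 0 else if z = 1 \<and> b then Suc n else n)"

text \<open>If an element is adjoined, all stages are subsets of \<open>[n + 1]\<close>: stage \<open>0\<close> is the new element \<open>0\<close>, and stage \<open>2\<close> consists
  of the others. The maps are restrictions of the extension of \<open>\<phi>\<close> that preserves the new element. Otherwise, they are the unique
  arrows of \<open>Delta_le\<close>.\<close>

definition stage_step :: "bool \<Rightarrow> nat \<Rightarrow> nat \<Rightarrow> nat \<Rightarrow> (nat \<Rightarrow> nat) \<Rightarrow> nat \<Rightarrow> nat \<Rightarrow> nat" where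
  "stage_step b z y m \<phi> n i = (if b
     then (if z = 0 then 0 else if z = 1 then (if i = 0 then 0 else Suc (\<phi> (i - 1)))
       else if y = 1 then Suc (\<phi> i) else \<phi> i)
     else stage_length b y n - stage_length b z m + i)"

definition stage_map :: "bool \<Rightarrow> nat \<Rightarrow> nat \<Rightarrow> ord_map \<Rightarrow> ord_map" where
  "stage_map b z y = (\<lambda>(m, \<phi>, n). (stage_length b z m,
     (\<lambda>i\<in>{..stage_length b z m}. stage_step b z y m \<phi> n i), stage_length b y n))"

lemma Delta_le_Arr: "(m, \<phi>, n) \<in> Arr Delta_le \<longleftrightarrow> m \<le> n \<and> \<phi> = (\<lambda>i\<in>{..m}. n - m + i)"
  by (auto simp: Delta_le_def Delta_def)

lemma stage_map_inj:
  assumes \<phi>: "(m, \<phi>, n) \<in> Arr Delta_inj" and zy: "(z, y) \<in> {(0, 0), (1, 1), (2, 2), (0, 1), (2, 1)}"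
  shows "stage_map True z y (m, \<phi>, n) \<in> Arr Delta_inj"
proof -
  have sm: "strict_mono_on {..m} \<phi>" and le: "\<And>i. i \<le> m \<Longrightarrow> \<phi> i \<le> n"
    using \<phi> by (auto simp: PiE_iff)
  have lt: "\<phi> i < \<phi> j" if "i < j" "j \<le> m" for i j using strict_mono_onD[OF sm, of i j] that by auto
  have "\<phi> (i - 1) < \<phi> (j - 1)" if "0 < i" "i < j" "j \<le> Suc m" for i j using lt[of "i - 1" "j - 1"] that by auto
  then show ?thesis
    using zy le lt by (auto simp: stage_map_def stage_step_def stage_length_def strict_mono_on_def)
qed

lemma stage_map_le:
  assumes \<phi>: "(m, \<phi>, n) \<in> Arr Delta_le" and zy: "(z, y) \<in> {(0, 0), (1, 1), (2, 2), (0, 1), (2, 1)}"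
  shows "stage_map False z y (m, \<phi>, n) \<in> Arr Delta_le"
  using assms unfolding stage_map_def prod.case Delta_le_Arr by (auto simp: stage_step_def stage_length_def)

lemma stage_map_Comp_inj:
  assumes \<phi>: "(m, \<phi>, n) \<in> Arr Delta_inj"
    and zy: "(z, y) \<in> {(0, 0), (1, 1), (2, 2), (0, 1), (2, 1)}" "(y, w) \<in> {(0, 0), (1, 1), (2, 2), (0, 1), (2, 1)}"
  shows "stage_map True z w (m, compose {..m} \<psi> \<phi>, l)
    = Comp Delta (stage_map True y w (n, \<psi>, l)) (stage_map True z y (m, \<phi>, n))"
proof -
  have le: "\<phi> i \<le> n" if "i \<le> m" for i using \<phi> that by (auto simp: PiE_iff)
  have step: "stage_step True z w m (compose {..m} \<psi> \<phi>) l i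
      = stage_step True y w n \<psi> l (stage_step True z y m \<phi> n i)
    \<and> stage_step True z y m \<phi> n i \<le> stage_length True y n" if i: "i \<le> stage_length True z m" for i
  proof -
    consider "z = 0" "y = 0" | "z = 0" "y = 1" | "z = 1" "y = 1" "w = 1" | "z = 2" "y = 2" | "z = 2" "y = 1" "w = 1"
      using zy by auto
    then show ?thesis
    proof cases
      case 3
      then show ?thesis using i le[of "i - 1"]
        by (cases i) (simp_all add: stage_step_def stage_length_def compose_def)
    qed (use i le[of i] in \<open>simp_all add: stage_step_def stage_length_def compose_def\<close>)
  qed
  show ?thesis
    unfolding stage_map_def prod.case Delta_simps compose_def
    using step by (auto simp: compose_def restrict_def fun_eq_iff)
qed

lemma stage_map_Comp_le:
  assumes \<phi>: "(m, \<phi>, n) \<in> Arr Delta_le" and \<psi>: "(n, \<psi>, l) \<in> Arr Delta_le"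
    and zy: "(z, y) \<in> {(0, 0), (1, 1), (2, 2), (0, 1), (2, 1)}" "(y, w) \<in> {(0, 0), (1, 1), (2, 2), (0, 1), (2, 1)}"
  shows "stage_map False z w (m, compose {..m} \<psi> \<phi>, l)
    = Comp Delta (stage_map False y w (n, \<psi>, l)) (stage_map False z y (m, \<phi>, n))"
proof -
  have "stage_length False z m \<le> stage_length False y n" "stage_length False y n \<le> stage_length False w l"
    using \<phi> \<psi> zy unfolding Delta_le_Arr by (auto simp: stage_length_def)
  then show ?thesis
    by (auto simp: stage_map_def stage_step_def compose_def restrict_def fun_eq_iff)
qed

lemma stage_map_Ide: "stage_map b z z (Ide Delta n) = Ide Delta (stage_length b z n)"
  by (auto simp: stage_map_def stage_step_def stage_length_def restrict_def fun_eq_iff)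

context Lambda_setting
begin

text \<open>With a single step at each object and trivial insertion maps, a functor on \<open>cut_cat E one_step\<close> is
  a zig-zag of three functors on \<open>E\<close> and two natural transformations.\<close>

definition one_step where
  "one_step = \<lparr>obj_map = (\<lambda>X\<in>Obj E. 1), arr_map = (\<lambda>f\<in>Arr E. Ide Delta_inj 1)\<rparr>"

lemma is_functor_one_step: "is_functor E Delta_inj one_step"
proof -
  have "Ide Delta_inj 1 \<in> Arr Delta_inj" "1 \<in> Obj Delta_inj"
    using category.Ide_Arr[OF category_Delta_inj, of 1] by (auto simp: Delta_inj_def Delta_def)
  then show ?thesis
    by (auto simp: is_functor_def one_step_def E.Ide_Arr E.Comp_Arr E.Dom_Obj E.Cod_Obj compose_def fun_eq_iff
      simp del: One_nat_def)
qed

sublocale One: stepped_category E one_step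
  by unfold_locales (rule is_functor_one_step)

abbreviation "stages \<equiv> cut_cat E one_step"

lemma one_step_Obj: "((n, Y), z) \<in> Obj stages \<longleftrightarrow> Y \<in> zigzags D n \<and> z \<le> 2"
  by (auto simp: height_def one_step_def E_Obj)

lemma one_step_Arr: "(z, u, y) \<in> Arr stages \<longleftrightarrow> u \<in> Arr E \<and> (z, y) \<in> {(0, 0), (1, 1), (2, 2), (0, 1), (2, 1)}"
proof -
  have r: "retract one_step u y = y" if "u \<in> Arr E" "y \<le> 2"
    using pad_index_ident[of y 1] that by (simp add: retract_def embed_def one_step_def pad_index_def)
  have "(z, u, y) \<in> Arr stages \<longleftrightarrow> u \<in> Arr E \<and> z \<le> 2 \<and> y \<le> 2 \<and> zigzag_le z y"
    using r by (auto simp: height_def one_step_def E.Dom_Obj E.Cod_Obj)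
  moreover have "z \<le> 2 \<and> y \<le> 2 \<and> zigzag_le z y \<longleftrightarrow> (z, y) \<in> {(0, 0), (1, 1), (2, 2), (0, 1), (2, 1)}"
    unfolding zigzag_le_def by auto presburger+
  ultimately show ?thesis by blast
qed

lemma stage_map_Arr:
  assumes "(m, \<phi>, n) \<in> Arr J" "(z, y) \<in> {(0, 0), (1, 1), (2, 2), (0, 1), (2, 1)}"
  shows "stage_map (J = Delta_inj) z y (m, \<phi>, n) \<in> Arr J"
proof (cases "J = Delta_inj")
  case True
  then show ?thesis using stage_map_inj[OF J_inj[OF assms(1)] assms(2)] by simp
next
  case False
  then have "J = Delta_le" using J by simp
  then show ?thesis using stage_map_le[OF _ assms(2)] assms(1) False by simp
qed

lemma stage_map_Comp:
  assumes "(m, \<phi>, n) \<in> Arr J" "(n, \<psi>, l) \<in> Arr J"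
    "(z, y) \<in> {(0, 0), (1, 1), (2, 2), (0, 1), (2, 1)}" "(y, w) \<in> {(0, 0), (1, 1), (2, 2), (0, 1), (2, 1)}"
  shows "stage_map (J = Delta_inj) z w (m, compose {..m} \<psi> \<phi>, l)
    = Comp J (stage_map (J = Delta_inj) y w (n, \<psi>, l)) (stage_map (J = Delta_inj) z y (m, \<phi>, n))"
proof (cases "J = Delta_inj")
  case True
  then have "(J = Delta_inj) = True" by simp
  then show ?thesis unfolding J_simps
    using stage_map_Comp_inj[OF J_inj[OF assms(1)] assms(3,4)] by (simp only:)
next
  case False
  then have "(J = Delta_inj) = False" "J = Delta_le" using J by simp_all
  then show ?thesis unfolding J_simps
    using stage_map_Comp_le[OF _ _ assms(3,4)] assms(1,2) by (simp only:)
qed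

definition stage_functor where
  "stage_functor = \<lparr>obj_map = (\<lambda>((n, Y), z)\<in>Obj stages. stage_length (J = Delta_inj) z n),
     arr_map = (\<lambda>(z, (Y, \<phi>, g), y)\<in>Arr stages. stage_map (J = Delta_inj) z y \<phi>)\<rparr>"

lemma is_functor_stage: "is_functor stages J stage_functor"
proof -
  let ?stage_zigzag = stage_functor
  note sd = stage_functor_def
  have a: "arr_map ?stage_zigzag u \<in> Arr J \<and> Dom J (arr_map ?stage_zigzag u) = obj_map ?stage_zigzag (Dom stages u) \<and> Cod J (arr_map ?stage_zigzag u) = obj_map ?stage_zigzag (Cod stages u)"
    if u: "u \<in> Arr stages" for u
  proof -
    obtain z Y m \<phi> n g y where ueq: "u = (z, (Y, (m, \<phi>, n), g), y)" by (metis surj_pair)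
    have u': "(Y, (m, \<phi>, n), g) \<in> Arr E" "(z, y) \<in> {(0, 0), (1, 1), (2, 2), (0, 1), (2, 1)}"
      using u unfolding ueq one_step_Arr by auto
    have "(m, \<phi>, n) \<in> Arr J" using u'(1) by (simp add: E_Arr)
    from stage_map_Arr[OF this u'(2)] show ?thesis
      using u category.Dom_Obj[OF One.category_cut_cat u] category.Cod_Obj[OF One.category_cut_cat u] unfolding ueq
      by (simp add: sd E_simps del: cut_cat_simps(1,2)) (simp add: stage_map_def)
  qed
  have i: "arr_map ?stage_zigzag (Ide stages X) = Ide J (obj_map ?stage_zigzag X)" if X: "X \<in> Obj stages" for X
  proof -
    obtain n Y z where [simp]: "X = ((n, Y), z)" by (metis surj_pair)
    show ?thesis
      using category.Ide_Arr[OF One.category_cut_cat X] X stage_map_Ide[of _ z n]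
      by (simp add: sd E_simps del: cut_cat_simps(1,2))
  qed
  have c: "arr_map ?stage_zigzag (Comp stages v u) = Comp J (arr_map ?stage_zigzag v) (arr_map ?stage_zigzag u)"
    if vu: "v \<in> Arr stages" "u \<in> Arr stages" "Dom stages v = Cod stages u" for v u
  proof -
    obtain z Y m \<phi> n g y where u: "u = (z, (Y, (m, \<phi>, n), g), y)" by (metis surj_pair)
    obtain y' W n' \<psi> l h w where v: "v = (y', (W, (n', \<psi>, l), h), w)" by (metis surj_pair)
    have e: "y' = y" "n' = n" using vu(3) by (auto simp: u v E_simps)
    note v = v[unfolded e]
    have u': "(Y, (m, \<phi>, n), g) \<in> Arr E" "(z, y) \<in> {(0, 0), (1, 1), (2, 2), (0, 1), (2, 1)}"
      using vu(2) unfolding u one_step_Arr by auto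
    have v': "(W, (n, \<psi>, l), h) \<in> Arr E" "(y, w) \<in> {(0, 0), (1, 1), (2, 2), (0, 1), (2, 1)}"
      using vu(1) unfolding v one_step_Arr by auto
    have g: "g \<in> zigzag_maps D n" "(m, \<phi>, n) \<in> Arr J" "(n, \<psi>, l) \<in> Arr J" using u'(1) v'(1) by (auto simp: E_Arr)
    have "Comp stages v u = (z, (Y, (m, compose {..m} \<psi> \<phi>, l), Comp (Lambda D l) h (Lambda_arr D (n, \<psi>, l) g)), w)"
      by (simp add: u v E_Comp[OF g(1)])
    then show ?thesis
      using category.Comp_Arr[OF One.category_cut_cat vu] vu(1,2) stage_map_Comp[OF g(2,3) u'(2) v'(2)]
      by (simp add: sd u v del: cut_cat_simps J_simps)
  qed
  have ext: "obj_map ?stage_zigzag \<in> extensional (Obj stages)" "arr_map ?stage_zigzag \<in> extensional (Arr stages)"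
    by (simp_all add: sd)
  have o: "obj_map ?stage_zigzag X \<in> Obj J" for X by simp
  show ?thesis
    unfolding is_functor_def PiE_iff using o a i c ext by blast
qed

abbreviation "proj \<equiv> proj0 J D"

lemmas functor_proj = is_functor_proj0[OF category_D J]
lemmas functor_incl = is_functor_incl[OF category_D J]

lemma proj0_obj: "Y \<in> zigzags D n \<Longrightarrow> obj_map proj (n, Y) = bar Y 0"
  by (simp add: proj0_def E_Obj)

lemma proj0_arr: "(Y, \<phi>, g) \<in> Arr E \<Longrightarrow> arr_map proj (Y, \<phi>, g) = bar_map g 0"
  by (simp add: proj0_def)

abbreviation "stage_base \<equiv> fcomp stages proj One.forget_cut"

lemma is_functor_stage_base: "is_functor stages D stage_base"
  by (rule is_functor_fcomp[OF One.category_cut_cat One.is_functor_forget_cut functor_proj])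

lemma stage_base_simps: "(X, z) \<in> Obj stages \<Longrightarrow> obj_map stage_base (X, z) = obj_map proj X"
  "(z, u, y) \<in> Arr stages \<Longrightarrow> arr_map stage_base (z, u, y) = arr_map proj u"
  by (simp_all add: fcomp_apply One.forget_cut_def)

abbreviation "stage_zigzag \<equiv> constant_functor stages stage_functor stage_base"

lemma is_functor_stage_zigzag: "is_functor stages E stage_zigzag"
  by (rule is_functor_constant[OF One.category_cut_cat is_functor_stage is_functor_stage_base])

lemma stage_zigzag_obj: "((n, Y), z) \<in> Obj stages \<Longrightarrow>
    obj_map stage_zigzag ((n, Y), z) = (stage_length (J = Delta_inj) z n, const_zigzag (stage_length (J = Delta_inj) z n) (bar Y 0))"
  using stage_base_simps(1)[of "(n, Y)" z] proj0_obj[of Y n]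
  by (simp add: constant_functor_def stage_functor_def one_step_Obj del: cut_cat_simps)

lemma stage_zigzag_arr:
  assumes u: "(z, (Y, (m, \<phi>, n), g), y) \<in> Arr stages"
  shows "arr_map stage_zigzag (z, (Y, (m, \<phi>, n), g), y) = (const_zigzag (stage_length (J = Delta_inj) z m) (bar Y 0), stage_map (J = Delta_inj) z y (m, \<phi>, n),
      const_map (stage_length (J = Delta_inj) y n) (bar_map g 0))"
proof -
  have u': "(Y, (m, \<phi>, n), g) \<in> Arr E" using u unfolding one_step_Arr by simp
  have "((m, Y), z) \<in> Obj stages" "((n, zz_cod g), y) \<in> Obj stages"
    using category.Dom_Obj[OF One.category_cut_cat u] category.Cod_Obj[OF One.category_cut_cat u] by (simp_all add: E_simps)
  then show ?thesis
    using u stage_base_simps(1)[of "(m, Y)" z] stage_base_simps(2)[OF u] proj0_obj[of Y m] proj0_arr[OF u']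
    by (simp add: constant_functor_def stage_functor_def one_step_Obj E_simps del: cut_cat_simps(1,2))
qed

lemma const_zigzag_0: "const_zigzag 0 X = zigzag0 X"
  by (auto simp: const_zigzag_def zigzag0_def restrict_def fun_eq_iff)

lemma const_map_0: "const_map 0 f = zigzag_map0 D f"
  by (auto simp: const_map_def assemble_def const_zigzag_0 zigzag_map0_def restrict_def fun_eq_iff)

lemma stage_bottom: "fcomp E stage_zigzag (bottom_cut E) = fcomp E (incl J D) proj"
proof (rule functor_eqI[of E E])
  show "is_functor E E (fcomp E stage_zigzag (bottom_cut E))"
    by (rule is_functor_fcomp[OF category_E One.is_functor_bottom_cut is_functor_stage_zigzag])
  show "is_functor E E (fcomp E (incl J D) proj)"
    by (rule is_functor_fcomp[OF category_E functor_proj functor_incl])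
  show "obj_map (fcomp E stage_zigzag (bottom_cut E)) X = obj_map (fcomp E (incl J D) proj) X" if X: "X \<in> Obj E" for X
  proof -
    obtain n Y where [simp]: "X = (n, Y)" by (cases X)
    have Y: "Y \<in> zigzags D n" using X by (simp add: E_Obj)
    then have "((n, Y), 0) \<in> Obj stages" by (subst one_step_Obj) simp
    from stage_zigzag_obj[OF this] show ?thesis
      using X zigzagsD(1)[OF Y, of 0]
      by (simp add: fcomp_apply bottom_cut_def proj0_obj[OF Y] incl_def const_zigzag_0 stage_length_def)
  qed
  show "arr_map (fcomp E stage_zigzag (bottom_cut E)) u = arr_map (fcomp E (incl J D) proj) u" if u: "u \<in> Arr E" for u
  proof -
    obtain Y m \<phi> n g where [simp]: "u = (Y, (m, \<phi>, n), g)" by (metis surj_pair)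
    have Y: "Y \<in> zigzags D m" using u by (simp add: E_Arr)
    have "(0, (Y, (m, \<phi>, n), g), 0) \<in> Arr stages" using u unfolding one_step_Arr by simp
    note Su = stage_zigzag_arr[OF this]
    have "arr_map proj u \<in> Arr D" "Dom D (arr_map proj u) = bar Y 0"
      using functorD(2,3)[OF functor_proj u] proj0_obj[OF Y] by (simp_all add: E_simps)
    moreover have "stage_map (J = Delta_inj) 0 0 (m, \<phi>, n) = Ide J 0"
      by (auto simp: stage_map_def stage_length_def stage_step_def restrict_def fun_eq_iff)
    ultimately show ?thesis
      using u Su proj0_arr[of Y "(m, \<phi>, n)" g]
      by (simp add: fcomp_apply bottom_cut_def incl_def const_zigzag_0 const_map_0 stage_length_def)
  qed
qed

text \<open>Cutting at \<open>0\<close> is the last stage of the one family and the first stage of the other one.\<close>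

lemma stage_top: "fcomp E stage_zigzag (top_cut E one_step) = fcomp E cut_functor (bottom_cut E)"
proof (rule functor_eqI[of E E])
  show "is_functor E E (fcomp E stage_zigzag (top_cut E one_step))"
    by (rule is_functor_fcomp[OF category_E One.is_functor_top_cut is_functor_stage_zigzag])
  show "is_functor E E (fcomp E cut_functor (bottom_cut E))"
    by (rule is_functor_fcomp[OF category_E L.is_functor_bottom_cut is_functor_cut])
  have m0: "min 0 = (\<lambda>x :: nat. 0)" by (rule ext) simp
  have h: "height one_step X = 2" if "X \<in> Obj E" for X using that by (simp add: height_def one_step_def)
  show "obj_map (fcomp E stage_zigzag (top_cut E one_step)) X = obj_map (fcomp E cut_functor (bottom_cut E)) X"
    if X: "X \<in> Obj E" for X
  proof -
    obtain n Y where [simp]: "X = (n, Y)" by (cases X)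
    have Y: "Y \<in> zigzags D n" using X by (simp add: E_Obj)
    then have "((n, Y), 2) \<in> Obj stages" by (subst one_step_Obj) simp
    from stage_zigzag_obj[OF this] show ?thesis
      using X h[OF X] Y
      by (simp add: fcomp_apply top_cut_def bottom_cut_def cut_functor_obj stage_length_def pull_0 m0)
  qed
  show "arr_map (fcomp E stage_zigzag (top_cut E one_step)) u = arr_map (fcomp E cut_functor (bottom_cut E)) u"
    if u: "u \<in> Arr E" for u
  proof -
    obtain Y m \<phi> n g where ueq: "u = (Y, (m, \<phi>, n), g)" by (metis surj_pair)
    have "arr_map (bottom_cut E) u \<in> Arr (cut_cat E length_functor)"
      by (rule functorD(2)[OF L.is_functor_bottom_cut u])
    then have v: "(0, (Y, (m, \<phi>, n), g), 0) \<in> Arr (cut_cat E length_functor)"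
      using u unfolding ueq by (simp add: bottom_cut_def del: cut_cat_simps)
    note v' = cut_cat_arrD[OF v]
    note Y = cut_arrD[OF v']
    have "(2, (Y, (m, \<phi>, n), g), 2) \<in> Arr stages" using u unfolding ueq one_step_Arr by simp
    note Su = stage_zigzag_arr[OF this]
    have top: "arr_map (top_cut E one_step) u = (2, u, 2)"
      using u h E.Dom_Obj[OF u] E.Cod_Obj[OF u] by (simp add: top_cut_def)
    have "\<phi> \<in> extensional {..m}" using J_inj[OF Y(1)] by (simp add: PiE_iff)
    then have st: "stage_map (J = Delta_inj) 2 2 (m, \<phi>, n) = (m, \<phi>, n)"
    proof (cases "J = Delta_inj")
      case True
      then show ?thesis using \<open>\<phi> \<in> extensional {..m}\<close>
        by (simp add: stage_map_def stage_length_def stage_step_def extensional_restrict)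
    next
      case False
      then have "J = Delta_le" using J by simp
      then have "m \<le> n" "\<phi> = (\<lambda>i\<in>{..m}. n - m + i)" using Y(1) Delta_le_Arr[of m \<phi> n] by simp_all
      then show ?thesis using False
        by (auto simp: stage_map_def stage_length_def stage_step_def restrict_def fun_eq_iff)
    qed
    have p0: "pad_index m \<phi> 0 = 0"
      using pad_index_even[OF Y(5), of 0] last_index_zero[OF Y(5)] by simp
    have e0: "entry Y' 0 = bar Y' 0" "component f 0 = bar_map f 0" for Y' :: "('o, 'm) zigzag" and f :: "('o, 'm) zigzag_map"
      by (simp_all add: entry_def component_def)
    have d: "bar_map g 0 \<in> Arr D" "Dom D (bar_map g 0) = bar Y 0" "Cod D (bar_map g 0) = bar (zz_cod g) 0"
    proof -
      show "bar_map g 0 \<in> Arr D" "Cod D (bar_map g 0) = bar (zz_cod g) 0"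
        using component_arrow[OF Y(3), of 0] by (simp_all add: e0)
      have "entry (zz_dom g) 0 = entry Y 0" unfolding Y(4) by (simp add: entry_pull p0)
      then show "Dom D (bar_map g 0) = bar Y 0" using component_arrow(2)[OF Y(3), of 0] by (simp add: e0)
    qed
    have "cut_component Y (pad_index m \<phi>) 0 g 0 x = bar_map g 0" for x
      using Comp_Ide[OF d(1)] by (simp add: cut_component_def p0 e0 d(2))
    then have "cut_component Y (pad_index m \<phi>) 0 g 0 = (\<lambda>x. bar_map g 0)" by blast
    then have "const_map n (bar_map g 0)
      = assemble n (pull D n (\<lambda>x. min 0 (pad_index m \<phi> x)) Y) (pull D n (min 0) (zz_cod g)) (cut_component Y (pad_index m \<phi>) 0 g 0)"
      by (simp add: const_map_def pull_0 m0 d)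
    moreover have "arr_map (bottom_cut E) u = (0, u, 0)" using u by (simp add: bottom_cut_def)
    ultimately show ?thesis
      using u cut_functor_arr[OF v] Su top st unfolding ueq
      by (simp add: fcomp_apply pull_0 m0 stage_length_def)
  qed
qed

lemma proj0_incl: "fcomp D proj (incl J D) = fident D"
proof (rule functor_eqI[of D D])
  show "is_functor D D (fcomp D proj (incl J D))"
    by (rule is_functor_fcomp[OF category_D functor_incl functor_proj])
  show "is_functor D D (fident D)"
    by (auto simp: is_functor_def fident_def Ide_Arr Comp_Arr Dom_Obj Cod_Obj)
  show "obj_map (fcomp D proj (incl J D)) X = obj_map (fident D) X" if X: "X \<in> Obj D" for X
  proof -
    have i: "obj_map (incl J D) X = (0, zigzag0 X)" using X by (simp add: incl_def)
    then have "zigzag0 X \<in> zigzags D 0" using functorD(1)[OF functor_incl X] by (simp add: E_Obj)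
    then show ?thesis using X i by (simp add: fcomp_apply fident_def proj0_obj zigzag0_def)
  qed
  show "arr_map (fcomp D proj (incl J D)) f = arr_map (fident D) f" if f: "f \<in> Arr D" for f
  proof -
    have i: "arr_map (incl J D) f = (zigzag0 (Dom D f), Ide J 0, zigzag_map0 D f)" using f by (simp add: incl_def)
    then have "(zigzag0 (Dom D f), Ide J 0, zigzag_map0 D f) \<in> Arr E" using functorD(2)[OF functor_incl f] by simp
    from proj0_arr[OF this] show ?thesis using f i by (simp add: fcomp_apply fident_def zigzag_map0_def)
  qed
qed

lemma homotopic_incl_proj0:
  "homotopic_with (\<lambda>_. True) (classifying_space E) (classifying_space E)
     (classifying_map E (fcomp E (incl J D) proj)) (classifying_map E (fident E))"
  using homotopic_with_trans[OF One.homotopic_cut_ends[OF is_functor_stage_zigzag, unfolded stage_bottom stage_top]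
    L.homotopic_cut_ends[OF is_functor_cut, unfolded cut_functor_top]] .

end

theorem theorem2p6:
  fixes D :: "('o, 'm) cat" and J :: "(nat, ord_map) cat"
  assumes "category D" and "J \<in> {Delta_inj, Delta_le}"
  shows "classifying_space (Lambda_star J D) homotopy_equivalent_space classifying_space D
    \<and> is_functor D (Lambda_star J D) (incl J D)
    \<and> is_functor (Lambda_star J D) D (proj0 J D)
    \<and> continuous_map (classifying_space D) (classifying_space (Lambda_star J D))
        (classifying_map (Lambda_star J D) (incl J D))
    \<and> continuous_map (classifying_space (Lambda_star J D)) (classifying_space D)
        (classifying_map D (proj0 J D))
    \<and> homotopic_with (\<lambda>_. True) (classifying_space D) (classifying_space D)
        (classifying_map D (proj0 J D) \<circ> classifying_map (Lambda_star J D) (incl J D)) id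
    \<and> homotopic_with (\<lambda>_. True) (classifying_space (Lambda_star J D)) (classifying_space (Lambda_star J D))
        (classifying_map (Lambda_star J D) (incl J D) \<circ> classifying_map D (proj0 J D)) id"
proof -
  interpret Lambda_setting D J
    using assms by (simp add: Lambda_setting_def Lambda_setting_axioms_def)
  have ci: "continuous_map (classifying_space D) (classifying_space E) (classifying_map E (incl J D))"
    by (rule continuous_map_classifying_map[OF functor_incl])
  have cq: "continuous_map (classifying_space E) (classifying_space D) (classifying_map D proj)"
    by (rule continuous_map_classifying_map[OF functor_proj])
  have 1: "homotopic_with (\<lambda>_. True) (classifying_space D) (classifying_space D)
      (classifying_map D proj \<circ> classifying_map E (incl J D)) id"
  proof (rule homotopic_with_equal)
    show "continuous_map (classifying_space D) (classifying_space D) (classifying_map D proj \<circ> classifying_map E (incl J D))"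
      by (rule continuous_map_compose[OF ci cq])
    show "(classifying_map D proj \<circ> classifying_map E (incl J D)) x = id x" if "x \<in> topspace (classifying_space D)" for x
      using classifying_map_fcomp[OF category_D functor_incl category_E functor_proj that]
        classifying_map_fident[OF category_D that] by (simp add: proj0_incl)
  qed auto
  have 2: "homotopic_with (\<lambda>_. True) (classifying_space E) (classifying_space E)
      (classifying_map E (incl J D) \<circ> classifying_map D proj) id"
  proof (rule homotopic_with_eq[OF homotopic_incl_proj0])
    show "(classifying_map E (incl J D) \<circ> classifying_map D proj) x = classifying_map E (fcomp E (incl J D) proj) x"
      if "x \<in> topspace (classifying_space E)" for x
      using classifying_map_fcomp[OF category_E functor_proj category_D functor_incl that] by simp
    show "id x = classifying_map E (fident E) x" if "x \<in> topspace (classifying_space E)" for x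
      using classifying_map_fident[OF category_E that] by simp
  qed auto
  have "classifying_space E homotopy_equivalent_space classifying_space D"
    unfolding homotopy_equivalent_space_def using ci cq 1 2 by blast
  then show ?thesis
    using functor_incl functor_proj ci cq 1 2 by blast
qed

end
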